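(* Let $k\ge 2$ be an integer. Let $n\to+\infty$ and let $m=m(n)$ be a sequence of positive integers with $m=\Theta(n\ln n)$. Let $(X,Q)$ be a random vector with values in $\{0,1,2,\dots\}\times[0,1]$ (whose distribution does not depend on $n$), and let $G_{[n,m]}$ be the associated superposition of Bernoulli random graphs defined in the context. Put $h(x,q)=1-(1-q)^{\max\{x-1,0\}}$ and $$\alpha=\mathbf{E}\bigl(Q\,\mathbb{I}_{\{X\ge 2\}}\bigr),\qquad \kappa^*=\mathbf{E}\bigl(X h(X,Q)\bigr),\qquad \tau^*=\mathbf{E}\bigl((X)_2\,Q(1-Q)^{X-2}\bigr),$$ $$\lambda^*_{n,m,k}=\ln n+(k-1)\ln\frac{m}{n}-\frac{m}{n}\kappa^*.$$ Assume that $\alpha>0$, $\tau^*>0$ and $$\mathbf{E}\bigl(Xh(X,Q)\ln(1+X)\bigr)<\infty,\qquad \mathbf{E}\bigl(X\min\{1,XQ\}\ln(1+X)\bigr)<\infty,$$ $$\mathbf{E}\bigl(X^{j}Q^{j-1}\bigr)<\infty\quad\text{for all integers } 2\le j\le k.$$ Then: (i) if $\lambda^*_{n,m,k}\to-\infty$, then $\mathbf{P}\{G_{[n,m]}\text{ is vertex }k\text{-connected}\}\to 1$; (ii) if $\lambda^*_{n,m,k}\to+\infty$, then $\mathbf{P}\{G_{[n,m]}\text{ is edge }k\text{-connected}\}\to 0$.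
   Context: Random graph model. Let $(X_1,Q_1),(X_2,Q_2),\dots$ be i.i.d. copies of $(X,Q)$ ($X$ and $Q$ need not be independent). Given $n$ and $m$, put $\mathcal V=[n]=\{1,\dots,n\}$. Let $G_i=(\mathcal V_i,\mathcal E_i)$, $1\le i\le m$, be independent random graphs generated as follows: first sample $(X_i,Q_i)$; then choose $\mathcal V_i\subset\mathcal V$ uniformly at random among all subsets of $\mathcal V$ of size $\min\{X_i,n\}$; then declare each pair of distinct vertices of $\mathcal V_i$ to be an edge (an element of $\mathcal E_i$) independently with probability $Q_i$. The graph $G_{[n,m]}$ has vertex set $\mathcal V=[n]$ and edge set $\bigcup_{i=1}^m\mathcal E_i$. A graph is called vertex (respectively edge) $k$-connected if the removal of any $k-1$ vertices (respectively edges) does not disconnect it. Conventions: $(x)_t=x(x-1)\cdots(x-t+1)$ is the falling factorial; $0^0=1$; the expression $(x)_2q(1-q)^{x-2}$ is $0$ for $x\in\{0,1\}$; $\mathbb{I}$ denotes an indicator; $m=\Theta(n\ln n)$ means that $c_1 n\ln n\le m\le c_2 n\ln n$ for some constants $0<c_1\le c_2<\infty$ and all large $n$. *)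

theory Defs
  imports "HOL-Probability.Probability" "HOL-Library.Landau_Symbols"
begin

section \<open>Simple graphs and \<open>k\<close>-connectivity\<close>

text \<open>A graph is a pair (vertex set, edge set); an edge is a two-element set of vertices.\<close>

type_synonym 'v graph = "'v set \<times> 'v set set"

definition vertex_pairs :: "'v set \<Rightarrow> 'v set set" where
  "vertex_pairs V = {e. e \<subseteq> V \<and> card e = 2}"

definition graph_connected :: "'v graph \<Rightarrow> bool" where
  "graph_connected G \<longleftrightarrow>
     (\<forall>u\<in>fst G. \<forall>v\<in>fst G. (u, v) \<in> {(a, b). {a, b} \<in> snd G}\<^sup>*)"

definition remove_vertices :: "'v graph \<Rightarrow> 'v set \<Rightarrow> 'v graph" where
  "remove_vertices G S = (fst G - S, {e \<in> snd G. e \<inter> S = {}})"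

definition remove_edges :: "'v graph \<Rightarrow> 'v set set \<Rightarrow> 'v graph" where
  "remove_edges G F = (fst G, snd G - F)"

text \<open>
  The removal of \<^emph>\<open>at most\<close> \<open>k - 1\<close> vertices (edges) leaves a connected graph.  For \<open>k \<ge> 1\<close> this
  agrees with removing exactly \<open>k - 1\<close> of them as soon as the graph has at least \<open>k + 1\<close> vertices
  (at least \<open>k - 1\<close> edges); the edge version below is not vacuously true of a graph with fewer
  than \<open>k - 1\<close> edges.
\<close>

definition vertex_k_connected :: "nat \<Rightarrow> 'v graph \<Rightarrow> bool" where
  "vertex_k_connected k G \<longleftrightarrow>
     (\<forall>S. S \<subseteq> fst G \<and> finite S \<and> card S < k \<longrightarrow> graph_connected (remove_vertices G S))"

definition edge_k_connected :: "nat \<Rightarrow> 'v graph \<Rightarrow> bool" where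
  "edge_k_connected k G \<longleftrightarrow>
     (\<forall>F. F \<subseteq> snd G \<and> finite F \<and> card F < k \<longrightarrow> graph_connected (remove_edges G F))"


section \<open>Superpositions of Bernoulli random graphs\<close>

text \<open>Given \<open>(x, q)\<close>: a uniform vertex subset of size \<open>min x n\<close>, then independent edge coins
  with success probability \<open>q\<close>.\<close>

definition community_pmf :: "nat \<Rightarrow> nat \<times> real \<Rightarrow> nat graph pmf" where
  "community_pmf n xq =
     bind_pmf (pmf_of_set {V. V \<subseteq> {1..n} \<and> card V = min (fst xq) n}) (\<lambda>V.
     map_pmf (\<lambda>coin. (V, {e \<in> vertex_pairs V. coin e}))
       (Pi_pmf (vertex_pairs V) False (\<lambda>_. bernoulli_pmf (snd xq))))"

text \<open>
  Joint law of \<open>(G i)\<close>, \<open>1 \<le> i \<le> m\<close>, where \<open>D\<close> is the law of \<open>(X, Q)\<close>: sample i.i.d. pairs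
  \<open>(X i, Q i)\<close>, then the communities independently given these pairs.  All sets of families
  are measurable for this law; that the communities themselves are independent and identically
  distributed is \<open>communities_indep\<close> below.  Outside of \<open>{1..m}\<close> the family is \<open>({}, {})\<close>.
\<close>

definition communities :: "(nat \<times> real) measure \<Rightarrow> nat \<Rightarrow> nat \<Rightarrow> (nat \<Rightarrow> nat graph) measure" where
  "communities D n m =
     PiM {1..m} (\<lambda>_. D) \<bind>
       (\<lambda>xq. measure_pmf (Pi_pmf {1..m} ({}, {}) (\<lambda>i. community_pmf n (xq i))))"

definition superposition :: "nat \<Rightarrow> nat \<Rightarrow> (nat \<Rightarrow> nat graph) \<Rightarrow> nat graph" where
  "superposition n m G = ({1..n}, \<Union>i\<in>{1..m}. snd (G i))"


subsection \<open>Well-definedness of the model\<close>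

lemma finite_vertex_pairs: "finite V \<Longrightarrow> finite (vertex_pairs V)"
  unfolding vertex_pairs_def by (rule finite_subset[of _ "Pow V"]) auto

lemma vertex_choices:
  "finite {V. V \<subseteq> {1..n} \<and> card V = min x n}"
  "{V. V \<subseteq> {1..n::nat} \<and> card V = min x n} \<noteq> {}"
proof -
  show "finite {V. V \<subseteq> {1..n} \<and> card V = min x n}"
    by (rule finite_subset[of _ "Pow {1..n}"]) auto
  have "{1..min x n} \<in> {V. V \<subseteq> {1..n} \<and> card V = min x n}" by auto
  thus "{V. V \<subseteq> {1..n::nat} \<and> card V = min x n} \<noteq> {}" by blast
qed

lemma set_community_pmf_subset:
  "set_pmf (community_pmf n xq) \<subseteq> Pow {1..n} \<times> Pow (Pow {1..n})"
  unfolding community_pmf_def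
  using vertex_choices[of n "fst xq"] by (auto simp: vertex_pairs_def)

lemma measurable_pmf_kernel:
  assumes "finite S" "\<And>x. x \<in> space N \<Longrightarrow> set_pmf (f x) \<subseteq> S"
    and "\<And>y. y \<in> S \<Longrightarrow> (\<lambda>x. pmf (f x) y) \<in> borel_measurable N"
  shows "(\<lambda>x. measure_pmf (f x)) \<in> measurable N (subprob_algebra (count_space UNIV))"
proof (rule measurable_subprob_algebra)
  fix A
  have "emeasure (measure_pmf (f x)) A = (\<Sum>y\<in>A \<inter> S. ennreal (pmf (f x) y))"
    if "x \<in> space N" for x
  proof -
    have "emeasure (measure_pmf (f x)) A = emeasure (measure_pmf (f x)) (A \<inter> S)"
      by (rule emeasure_eq_AE) (use assms(2)[OF that] in \<open>auto simp: AE_measure_pmf_iff\<close>)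
    also have "\<dots> = (\<Sum>y\<in>A \<inter> S. ennreal (pmf (f x) y))"
      by (subst emeasure_measure_pmf_finite) (use assms(1) in \<open>auto simp: sum_ennreal\<close>)
    finally show ?thesis .
  qed
  moreover have "(\<lambda>x. \<Sum>y\<in>A \<inter> S. ennreal (pmf (f x) y)) \<in> borel_measurable N"
    using assms(3) by (intro borel_measurable_sum measurable_compose[OF _ measurable_ennreal]) auto
  ultimately show "(\<lambda>x. emeasure (measure_pmf (f x)) A) \<in> borel_measurable N"
    by (subst measurable_cong) auto
qed (auto intro: measure_pmf.subprob_space_axioms)

lemma measurable_const_if:
  "(P \<Longrightarrow> f \<in> borel_measurable N) \<Longrightarrow> (\<lambda>x. if P then f x else (0::real)) \<in> borel_measurable N"
  by (cases P) simp_all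

lemma measurable_pmf_bernoulli: "(\<lambda>q. pmf (bernoulli_pmf q) b) \<in> borel_measurable borel"
proof -
  have "(\<lambda>q. pmf (bernoulli_pmf q) b) =
        (\<lambda>q. if b then min 1 (max 0 q) else 1 - min 1 (max 0 q))"
    by (intro ext) (simp add: bernoulli_pmf.rep_eq)
  thus ?thesis by (cases b) simp_all
qed

lemma measurable_pmf_community:
  "(\<lambda>xq. pmf (community_pmf n xq) g) \<in> borel_measurable (count_space UNIV \<Otimes>\<^sub>M borel)"
proof (rule measurable_pair_measure_countable1)
  fix x :: nat
  let ?S = "{V. V \<subseteq> {1..n} \<and> card V = min x n}"
  let ?p = "\<lambda>V q. Pi_pmf (vertex_pairs V) False (\<lambda>_. bernoulli_pmf q)"
  let ?h = "\<lambda>V coin. (V, {e \<in> vertex_pairs V. coin e})"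
  have meas: "(\<lambda>q. pmf (map_pmf (?h V) (?p V q)) g) \<in> borel_measurable borel"
    if V: "V \<in> ?S" for V
  proof -
    from V have fV: "finite (vertex_pairs V)"
      using finite_subset[of V "{1..n}"] by (auto intro: finite_vertex_pairs)
    have "(\<lambda>q. measure_pmf (?p V q)) \<in> measurable borel (subprob_algebra (count_space UNIV))"
    proof (rule measurable_pmf_kernel)
      show "finite (PiE_dflt (vertex_pairs V) False (\<lambda>_. UNIV :: bool set))"
        using fV by auto
      show "set_pmf (?p V q) \<subseteq> PiE_dflt (vertex_pairs V) False (\<lambda>_. UNIV)" for q
        by (rule order_trans[OF set_Pi_pmf_subset'[OF fV]]) (auto simp: PiE_dflt_def)
      show "(\<lambda>q. pmf (?p V q) c) \<in> borel_measurable borel" for c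
        unfolding pmf_Pi[OF fV]
        by (intro measurable_const_if borel_measurable_prod measurable_pmf_bernoulli)
    qed
    from measurable_emeasure_kernel[OF this, of "?h V -` {g}"]
    have "(\<lambda>q. enn2real (emeasure (measure_pmf (?p V q)) (?h V -` {g}))) \<in> borel_measurable borel"
      by (intro measurable_compose[OF _ borel_measurable_enn2real]) auto
    thus ?thesis by (simp add: pmf_map measure_def)
  qed
  have "(\<lambda>q. pmf (community_pmf n (x, q)) g) =
        (\<lambda>q. \<Sum>V\<in>?S. pmf (map_pmf (?h V) (?p V q)) g * pmf (pmf_of_set ?S) V)"
    unfolding community_pmf_def pmf_bind fst_conv snd_conv
    using vertex_choices[of n x]
    by (intro ext integral_measure_pmf_real) auto
  thus "(\<lambda>q. pmf (community_pmf n (x, q)) g) \<in> borel_measurable borel"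
    using meas by (auto intro!: borel_measurable_sum borel_measurable_times)
qed auto

lemma measurable_community:
  "(\<lambda>xq. measure_pmf (community_pmf n xq))
     \<in> measurable (count_space UNIV \<Otimes>\<^sub>M borel) (subprob_algebra (count_space UNIV))"
  by (rule measurable_pmf_kernel[OF _ set_community_pmf_subset measurable_pmf_community]) simp

lemma measurable_communities:
  assumes D: "sets D = sets (count_space UNIV \<Otimes>\<^sub>M borel)"
  shows "(\<lambda>xq. measure_pmf (Pi_pmf {1..m::nat} ({}, {}) (\<lambda>i. community_pmf n (xq i))))
     \<in> measurable (PiM {1..m} (\<lambda>_. D)) (subprob_algebra (count_space UNIV))"
proof (rule measurable_pmf_kernel)
  let ?F = "PiE_dflt {1..m} ({}, {}) (\<lambda>_. Pow {1..n} \<times> Pow (Pow {1..n}))"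
  show "finite ?F" by auto
  show "set_pmf (Pi_pmf {1..m} ({}, {}) (\<lambda>i. community_pmf n (xq i))) \<subseteq> ?F" for xq
  proof (rule order_trans[OF set_Pi_pmf_subset'])
    show "PiE_dflt {1..m} ({}, {}) (set_pmf \<circ> (\<lambda>i. community_pmf n (xq i))) \<subseteq> ?F"
      unfolding PiE_dflt_def o_def using set_community_pmf_subset[of n] by blast
  qed simp
  show "(\<lambda>xq. pmf (Pi_pmf {1..m} ({}, {}) (\<lambda>i. community_pmf n (xq i))) c)
      \<in> borel_measurable (PiM {1..m} (\<lambda>_. D))" for c
  proof -
    have "(\<lambda>xq. pmf (community_pmf n (xq i)) (c i)) \<in> borel_measurable (PiM {1..m} (\<lambda>_. D))"
      if "i \<in> {1..m}" for i
    proof (rule measurable_compose[OF measurable_component_singleton[OF that]])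
      show "(\<lambda>xq. pmf (community_pmf n xq) (c i)) \<in> borel_measurable D"
        using measurable_pmf_community[of n "c i"] measurable_cong_sets[OF D refl] by blast
    qed
    thus ?thesis
      unfolding pmf_Pi[OF finite_atLeastAtMost]
      by (intro measurable_const_if borel_measurable_prod)
  qed
qed

lemma prob_space_communities:
  assumes D: "sets D = sets (count_space UNIV \<Otimes>\<^sub>M borel)" and "prob_space D"
  shows "prob_space (communities D n m)"
proof -
  interpret prob_space "PiM {1..m} (\<lambda>_. D)" by (intro prob_space_PiM assms)
  show ?thesis unfolding communities_def
    by (rule prob_space_bind[OF _ measurable_communities[OF D]])
       (auto intro: measure_pmf.prob_space_axioms)
qed

lemma sets_communities:
  assumes D: "sets D = sets (count_space UNIV \<Otimes>\<^sub>M borel)" and "prob_space D"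
  shows "sets (communities D n m) = UNIV"
proof -
  interpret prob_space "PiM {1..m} (\<lambda>_. D)" by (intro prob_space_PiM assms)
  show ?thesis unfolding communities_def
    by (subst sets_bind[OF sets_kernel[OF measurable_communities[OF D]]])
       (use not_empty in simp_all)
qed

text \<open>Each \<open>G i\<close> has the law \<open>D \<bind> community_pmf n\<close>, and \<open>G 1, \<dots>, G m\<close> are independent.\<close>

lemma communities_indep:
  assumes D: "sets D = sets (count_space UNIV \<Otimes>\<^sub>M borel)" and "prob_space D"
  shows "emeasure (communities D n m) {G. \<forall>i\<in>{1..m}. G i \<in> A i} =
    (\<Prod>i\<in>{1..m}. emeasure (D \<bind> (\<lambda>xq. measure_pmf (community_pmf n xq))) (A i))"
proof -
  interpret D: prob_space D by fact
  interpret P: product_sigma_finite "\<lambda>_::nat. D" by standard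
  interpret PP: prob_space "PiM {1..m} (\<lambda>_. D)" by (intro prob_space_PiM assms)
  have K: "(\<lambda>xq. measure_pmf (community_pmf n xq)) \<in> measurable D (subprob_algebra (count_space UNIV))"
    using measurable_community[of n] measurable_cong_sets[OF D refl] by blast
  have "emeasure (communities D n m) {G. \<forall>i\<in>{1..m}. G i \<in> A i} =
     (\<integral>\<^sup>+xq. emeasure (measure_pmf (Pi_pmf {1..m} ({}, {}) (\<lambda>i. community_pmf n (xq i))))
         {G. \<forall>i\<in>{1..m}. G i \<in> A i} \<partial>PiM {1..m} (\<lambda>_. D))"
    unfolding communities_def
    by (rule emeasure_bind[OF PP.not_empty measurable_communities[OF D]]) auto
  also have "\<dots> = (\<integral>\<^sup>+xq. (\<Prod>i\<in>{1..m}. emeasure (measure_pmf (community_pmf n (xq i))) (A i))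
      \<partial>PiM {1..m} (\<lambda>_. D))"
  proof (rule nn_integral_cong)
    fix xq
    have "{G. \<forall>i\<in>{1..m}. G i \<in> A i} = Pi {1..m} A" by auto
    thus "emeasure (measure_pmf (Pi_pmf {1..m} ({}, {}) (\<lambda>i. community_pmf n (xq i))))
         {G. \<forall>i\<in>{1..m}. G i \<in> A i} =
       (\<Prod>i\<in>{1..m}. emeasure (measure_pmf (community_pmf n (xq i))) (A i))"
      by (simp only: measure_pmf.emeasure_eq_measure) (simp add: measure_Pi_pmf_Pi prod_ennreal)
  qed
  also have "\<dots> = (\<Prod>i\<in>{1..m}. \<integral>\<^sup>+xq. emeasure (measure_pmf (community_pmf n xq)) (A i) \<partial>D)"
    by (rule P.product_nn_integral_prod) (auto intro!: measurable_emeasure_kernel[OF K])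
  also have "\<dots> = (\<Prod>i\<in>{1..m}. emeasure (D \<bind> (\<lambda>xq. measure_pmf (community_pmf n xq))) (A i))"
    by (intro prod.cong refl emeasure_bind[OF D.not_empty K, symmetric]) auto
  finally show ?thesis .
qed


section \<open>Parameters\<close>

text \<open>Truncated subtraction on \<open>nat\<close> makes the exponent \<open>max {x - 1, 0}\<close>.\<close>

definition h :: "nat \<Rightarrow> real \<Rightarrow> real" where
  "h x q = 1 - (1 - q) ^ (x - 1)"

definition alpha :: "'a measure \<Rightarrow> ('a \<Rightarrow> nat) \<Rightarrow> ('a \<Rightarrow> real) \<Rightarrow> real" where
  "alpha M X Q = (\<integral>\<omega>. Q \<omega> * indicator {\<omega>. X \<omega> \<ge> 2} \<omega> \<partial>M)"

definition kappa :: "'a measure \<Rightarrow> ('a \<Rightarrow> nat) \<Rightarrow> ('a \<Rightarrow> real) \<Rightarrow> real" where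
  "kappa M X Q = (\<integral>\<omega>. real (X \<omega>) * h (X \<omega>) (Q \<omega>) \<partial>M)"

text \<open>The integrand vanishes for \<open>X \<in> {0, 1}\<close>, where the exponent \<open>X - 2\<close> is truncated.\<close>

definition tau :: "'a measure \<Rightarrow> ('a \<Rightarrow> nat) \<Rightarrow> ('a \<Rightarrow> real) \<Rightarrow> real" where
  "tau M X Q =
     (\<integral>\<omega>. real (X \<omega>) * (real (X \<omega>) - 1) * Q \<omega> * (1 - Q \<omega>) ^ (X \<omega> - 2) \<partial>M)"

definition lambda ::
    "'a measure \<Rightarrow> ('a \<Rightarrow> nat) \<Rightarrow> ('a \<Rightarrow> real) \<Rightarrow> nat \<Rightarrow> nat \<Rightarrow> nat \<Rightarrow> real" where
  "lambda M X Q n m k =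
     ln (real n) + real (k - 1) * ln (real m / real n) - real m / real n * kappa M X Q"

definition XQ_law :: "'a measure \<Rightarrow> ('a \<Rightarrow> nat) \<Rightarrow> ('a \<Rightarrow> real) \<Rightarrow> (nat \<times> real) measure" where
  "XQ_law M X Q = distr M (count_space UNIV \<Otimes>\<^sub>M borel) (\<lambda>\<omega>. (X \<omega>, Q \<omega>))"

end

(* If a graph on [n] is not vertex k-connected, then some nonempty set A of at most n/2 vertices has fewer
   than k outside neighbours.  These neighbours are covered by t < k communities, so a union bound over the
   choice of the covering communities gives
     P(A has fewer than k neighbours) <= sum over t < k of (m choose t) p^t rho^(m-t),
   where p bounds the probability that one community joins A to its complement and rho the probability
   that all its edges from A lead into a fixed set of fewer than k vertices.  For |A| <= n^(1-eps) the
   X ln(1+X)-moment makes rho <= exp(-(|A|/n) (kappa - o(1/ln n))) uniformly in A, and the sum over such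
   A is O(exp lambda); for larger A the bound 1 - rho >= const * alpha |A|/n beats the entropy of A
   once eps is small.  For the second statement, the number of vertices that have degree one in exactly
   k - 1 communities and degree zero in all others has mean of order exp lambda, and the second moment
   method applies since a community containing edges at two given vertices has probability o(1/m). *)

theory Submission
  imports Defs "HOL-Real_Asymp.Real_Asymp"
begin

section \<open>Obstructions to connectivity\<close>

text \<open>An error o(1/ln n) in the rate of \<rho> is what the argument can afford: the exponent
  carries m |A|/n, of order |A| ln n, so the error costs at most a factor e^|A|, which the 1/|A|! in
  the number of sets A absorbs. This is where the factor ln(1+X) of the moment condition enters.
  Communities are counted rather than neighbours because one community can supply several dependent
  neighbours at once. Each covering community costs m p, at most |A| \<kappa> m/n, however many
  neighbours it supplies, and at most k-1 of them reproduce the power (m/n)^(k-1) in exp \<lambda>.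
  The threshold n^(1-eps) is a compromise. Below it, a community rarely meets A in two vertices, so
  its chance of leaving A is nearly additive over A; for A of linear size this fails. Above it, the
  entropy per vertex is only about eps ln n, small against \<alpha> m/n, so the cruder expansion
  bound is enough. In the second part, degree exactly one in each chosen community keeps the total
  degree at most k-1; one community gives a fixed vertex degree one with probability about \<tau>/n,
  so \<tau> > 0 keeps the mean at the order of exp \<lambda>.\<close>

definition nb :: "nat \<Rightarrow> nat set set \<Rightarrow> nat set \<Rightarrow> nat set" where
  "nb n E A = {w \<in> {1..n} - A. \<exists>v\<in>A. {v, w} \<in> E}"

definition incident :: "'v set set \<Rightarrow> 'v \<Rightarrow> 'v set set" where
  "incident E v = {e \<in> E. v \<in> e}"

text \<open>Deleting a separating set \<open>S\<close> leaves the component \<open>C\<close> of some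
  vertex and a nonempty rest \<open>B\<close> with no edge between them. All outside neighbours of
  either one lie in \<open>S\<close>, and one of the two has at most n/2 vertices.\<close>

lemma not_vertex_k_connectedE:
  assumes "\<not> vertex_k_connected k ({1..n::nat}, E)"
  obtains A where "A \<subseteq> {1..n}" "A \<noteq> {}" "2 * card A \<le> n" "card (nb n E A) < k"
proof -
  from assms obtain S where S: "S \<subseteq> {1..n}" "finite S" "card S < k"
      and nc: "\<not> graph_connected (remove_vertices ({1..n}, E) S)"
    unfolding vertex_k_connected_def by auto
  define R where "R = {(a, b). {a, b} \<in> snd (remove_vertices ({1..n}, E) S)}"
  from nc obtain u v where uv: "u \<in> {1..n} - S" "v \<in> {1..n} - S" "(u, v) \<notin> R\<^sup>*"
    unfolding graph_connected_def R_def by (auto simp: remove_vertices_def)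
  define C where "C = {w \<in> {1..n} - S. (u, w) \<in> R\<^sup>*}"
  define B where "B = {1..n} - S - C"
  have fin: "finite C" "finite B" by (auto simp: C_def B_def)
  have CB: "C \<noteq> {}" "B \<noteq> {}" "C \<subseteq> {1..n}" "B \<subseteq> {1..n}" "C \<inter> B = {}"
    using uv by (auto simp: C_def B_def)
  have no: "{x, y} \<notin> E" if "x \<in> C" "y \<in> B" for x y
  proof
    assume "{x, y} \<in> E"
    then have "(x, y) \<in> R"
      using that by (auto simp: R_def remove_vertices_def C_def B_def)
    with \<open>x \<in> C\<close> have "(u, y) \<in> R\<^sup>*" by (auto simp: C_def)
    with that show False by (auto simp: C_def B_def)
  qed
  have "nb n E C \<subseteq> S" using no by (auto simp: nb_def B_def)
  then have kC: "card (nb n E C) < k" using S card_mono le_less_trans by blast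
  have "nb n E B \<subseteq> S"
    using no unfolding nb_def B_def by (auto simp: insert_commute)
  then have kB: "card (nb n E B) < k" using S card_mono le_less_trans by blast
  have "card C + card B = card (C \<union> B)" using fin CB by (simp add: card_Un_disjoint)
  also have "\<dots> \<le> card {1..n}" using CB by (intro card_mono) auto
  finally have "card C + card B \<le> n" by simp
  then consider "2 * card C \<le> n" | "2 * card B \<le> n" by linarith
  then show thesis by cases (use that CB kC kB in blast)+
qed

text \<open>Removing all edges at \<open>v\<close> isolates it; the second vertex \<open>u\<close>
  is then unreachable.\<close>

lemma not_edge_k_connected:
  assumes "v \<in> V" "u \<in> V" "u \<noteq> v" "finite (incident E v)" "card (incident E v) < k"
  shows "\<not> edge_k_connected k (V, E)"
proof
  assume "edge_k_connected k (V, E)"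
  then have "graph_connected (remove_edges (V, E) (incident E v))"
    using assms(4,5) unfolding edge_k_connected_def by (auto simp: incident_def)
  then have "(v, u) \<in> {(a, b). {a, b} \<in> E - incident E v}\<^sup>*"
    using assms unfolding graph_connected_def remove_edges_def by auto
  then show False
  proof (cases rule: converse_rtranclE)
    case (step y)
    then show ?thesis by (auto simp: incident_def)
  qed (use \<open>u \<noteq> v\<close> in simp)
qed

lemma nb_UN: "nb n (\<Union>i\<in>I. E i) A = (\<Union>i\<in>I. nb n (E i) A)"
  by (auto simp: nb_def)

lemma incident_UN: "incident (\<Union>i\<in>I. E i) v = (\<Union>i\<in>I. incident (E i) v)"
  by (auto simp: incident_def)

lemma incident_vertex_pairs:
  assumes "v \<in> V"
  shows "incident (vertex_pairs V) v = (\<lambda>w. {v, w}) ` (V - {v})"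
proof (intro equalityI subsetI)
  fix e assume "e \<in> incident (vertex_pairs V) v"
  then have e: "e \<subseteq> V" "card e = 2" "v \<in> e" by (auto simp: incident_def vertex_pairs_def)
  from e(2) obtain x y where xy: "e = {x, y}" "x \<noteq> y" by (meson card_2_iff)
  show "e \<in> (\<lambda>w. {v, w}) ` (V - {v})"
  proof (cases "x = v")
    case True
    then show ?thesis using e xy by blast
  next
    case False
    then have "e = {v, x}" using e xy by blast
    then show ?thesis using e False by blast
  qed
qed (use assms in \<open>auto simp: incident_def vertex_pairs_def\<close>)

lemma card_incident_vertex_pairs:
  assumes "v \<in> V"
  shows "card (incident (vertex_pairs V) v) = card V - 1"
proof -
  have "inj_on (\<lambda>w. {v, w}) (V - {v})" by (auto simp: inj_on_def doubleton_eq_iff)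
  then show ?thesis using assms
    by (simp add: incident_vertex_pairs card_image card_Diff_singleton_if)
qed

section \<open>Coins of a single community\<close>

text \<open>The edge part of \<open>community_pmf\<close> for a frozen vertex set, so that coin
  computations and the uniform choice of the vertex set can be treated separately.\<close>

definition coin_edges :: "nat set \<Rightarrow> real \<Rightarrow> nat set set pmf" where
  "coin_edges V q = map_pmf (\<lambda>coin. {e \<in> vertex_pairs V. coin e})
     (Pi_pmf (vertex_pairs V) False (\<lambda>_. bernoulli_pmf q))"

lemma incident_coin:
  "incident {e \<in> P. coin e} v = {e \<in> incident P v. coin e}"
  by (auto simp: incident_def)

lemma prob_no_coin:
  assumes "finite P" "F \<subseteq> P" "0 \<le> q" "q \<le> 1"
  shows "measure_pmf.prob (Pi_pmf P False (\<lambda>_. bernoulli_pmf q)) {coin. {e \<in> F. coin e} = {}} =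
    (1 - q) ^ card F"
proof -
  have "{coin. {e \<in> F. coin e} = {}} = Pi P (\<lambda>e. if e \<in> F then {False} else UNIV)"
    using assms(2) by (auto simp: Pi_def)
  then have "measure_pmf.prob (Pi_pmf P False (\<lambda>_. bernoulli_pmf q)) {coin. {e \<in> F. coin e} = {}} =
     (\<Prod>e\<in>P. if e \<in> F then 1 - q else 1)"
    using assms by (simp only: measure_Pi_pmf_Pi) (auto intro!: prod.cong simp: measure_pmf_single)
  also have "\<dots> = (\<Prod>e\<in>F. 1 - q)"
    using assms by (simp add: prod.If_cases Int_absorb1)
  finally show ?thesis by simp
qed

lemma prob_one_coin:
  assumes "finite P" "F \<subseteq> P" "0 \<le> q" "q \<le> 1"
  shows "measure_pmf.prob (Pi_pmf P False (\<lambda>_. bernoulli_pmf q)) {coin. card {e \<in> F. coin e} = 1} =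
    real (card F) * q * (1 - q) ^ (card F - 1)"
proof -
  let ?p = "Pi_pmf P False (\<lambda>_. bernoulli_pmf q)"
  define B where "B e0 = {coin. {e \<in> F. coin e} = {e0}}" for e0 :: 'a
  have [simp]: "finite F" using assms finite_subset by blast
  have pB: "measure_pmf.prob ?p (B e0) = q * (1 - q) ^ (card F - 1)" if e0: "e0 \<in> F" for e0
  proof -
    have "B e0 = Pi P (\<lambda>e. if e \<in> F then {e = e0} else UNIV)"
      using assms(2) e0 by (auto simp: Pi_def B_def)
    then have "measure_pmf.prob ?p (B e0) =
       (\<Prod>e\<in>P. if e \<in> F then (if e = e0 then q else 1 - q) else 1)"
      using assms by (simp only: measure_Pi_pmf_Pi) (auto intro!: prod.cong simp: measure_pmf_single)
    also have "\<dots> = (\<Prod>e\<in>F. if e = e0 then q else 1 - q)"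
      using assms by (simp add: prod.If_cases Int_absorb1)
    also have "\<dots> = q * (\<Prod>e\<in>F - {e0}. if e = e0 then q else 1 - q)"
      using e0 by (subst prod.remove[of _ e0]) auto
    also have "(\<Prod>e\<in>F - {e0}. if e = e0 then q else 1 - q) = (\<Prod>e\<in>F - {e0}. 1 - q)"
      by (intro prod.cong) auto
    finally show ?thesis using e0 by (simp add: card_Diff_singleton_if)
  qed
  have "{coin. card {e \<in> F. coin e} = 1} = (\<Union>e0\<in>F. B e0)"
    by (auto simp: B_def card_1_singleton_iff)
  then have "measure_pmf.prob ?p {coin. card {e \<in> F. coin e} = 1} = (\<Sum>e0\<in>F. measure_pmf.prob ?p (B e0))"
    by (simp only:) (rule measure_pmf.finite_measure_finite_Union, auto simp: disjoint_family_on_def B_def)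
  then show ?thesis by (simp add: pB)
qed

context
  fixes V :: "nat set" and q :: real
  assumes V: "finite V" and q: "0 \<le> q" "q \<le> 1"
begin

lemma prob_coin_nonisolated:
  assumes "v \<in> V"
  shows "measure_pmf.prob (coin_edges V q) {E. incident E v \<noteq> {}} = h (card V) q"
proof -
  let ?p = "Pi_pmf (vertex_pairs V) False (\<lambda>_. bernoulli_pmf q)"
  have "measure_pmf.prob (coin_edges V q) {E. incident E v \<noteq> {}} =
     measure_pmf.prob ?p (UNIV - {coin. {e \<in> incident (vertex_pairs V) v. coin e} = {}})"
    by (auto simp: coin_edges_def incident_coin intro!: arg_cong[where f = "measure_pmf.prob ?p"])
  also have "\<dots> = 1 - measure_pmf.prob ?p {coin. {e \<in> incident (vertex_pairs V) v. coin e} = {}}"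
    using measure_pmf.prob_compl[of _ ?p] by simp
  also have "\<dots> = h (card V) q"
    using V q assms by (subst prob_no_coin)
      (auto simp: h_def card_incident_vertex_pairs finite_vertex_pairs, auto simp: incident_def)
  finally show ?thesis .
qed

text \<open>A vertex of \<open>V\<close> has \<open>card V - 1\<close> potential edges, exactly one
  of which must be present. For \<open>card V = 1\<close> the exponent is truncated, but the real
  factor \<open>card V - 1\<close> is then 0.\<close>

lemma prob_coin_degree_one:
  assumes "v \<in> V"
  shows "measure_pmf.prob (coin_edges V q) {E. card (incident E v) = 1} =
    (real (card V) - 1) * q * (1 - q) ^ (card V - 2)"
proof -
  let ?p = "Pi_pmf (vertex_pairs V) False (\<lambda>_. bernoulli_pmf q)"
  have "card V > 0" using assms V by (auto simp: card_gt_0_iff)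
  have "measure_pmf.prob (coin_edges V q) {E. card (incident E v) = 1} =
     measure_pmf.prob ?p {coin. card {e \<in> incident (vertex_pairs V) v. coin e} = 1}"
    by (simp add: coin_edges_def incident_coin)
  also have "\<dots> = (real (card V) - 1) * q * (1 - q) ^ (card V - 2)"
    using V q assms \<open>card V > 0\<close> by (subst prob_one_coin)
      (auto simp: card_incident_vertex_pairs finite_vertex_pairs of_nat_diff numeral_2_eq_2, 
       auto simp: incident_def)
  finally show ?thesis .
qed

lemma prob_coin_edge:
  assumes "v \<in> V" "w \<in> V" "v \<noteq> w"
  shows "measure_pmf.prob (coin_edges V q) {E. {v, w} \<in> E} = q"
proof -
  let ?p = "Pi_pmf (vertex_pairs V) False (\<lambda>_. bernoulli_pmf q)"
  have e: "{v, w} \<in> vertex_pairs V" using assms by (auto simp: vertex_pairs_def)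
  have "measure_pmf.prob (coin_edges V q) {E. {v, w} \<in> E} =
     measure_pmf.prob ?p {coin. card {e \<in> {{v, w}}. coin e} = 1}"
    using e by (auto simp: coin_edges_def card_1_singleton_iff
        intro!: arg_cong[where f = "measure_pmf.prob ?p"])
  also have "\<dots> = q"
    using e V q by (subst prob_one_coin) (auto simp: finite_vertex_pairs)
  finally show ?thesis .
qed

end

lemma incident_coin_notin:
  assumes "v \<notin> V" "E \<in> set_pmf (coin_edges V q)"
  shows "incident E v = {}"
  using assms by (auto simp: coin_edges_def incident_def vertex_pairs_def)

lemma community_pmf_eq:
  "community_pmf n (x, q) =
     bind_pmf (pmf_of_set {V. V \<subseteq> {1..n} \<and> card V = min x n}) (\<lambda>V. map_pmf (Pair V) (coin_edges V q))"
  by (simp add: community_pmf_def coin_edges_def map_pmf_comp)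

lemma h_bounds:
  assumes "0 \<le> q" "q \<le> 1"
  shows "0 \<le> h x q" "h x q \<le> 1"
  using assms by (auto simp: h_def power_le_one)

lemma h_mono:
  assumes "0 \<le> q" "q \<le> 1" "x \<le> y"
  shows "h x q \<le> h y q"
  using assms unfolding h_def by (intro diff_mono power_decreasing) auto

section \<open>Uniform vertex subsets\<close>

definition subsets_of_size :: "nat \<Rightarrow> nat \<Rightarrow> nat set set" where
  "subsets_of_size n j = {V. V \<subseteq> {1..n} \<and> card V = j}"

lemma finite_subsets_of_size: "finite (subsets_of_size n j)"
  by (rule finite_subset[of _ "Pow {1..n}"]) (auto simp: subsets_of_size_def)

lemma card_subsets_of_size: "card (subsets_of_size n j) = n choose j"
  unfolding subsets_of_size_def by (subst n_subsets) auto

lemma card_subsets_containing: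
  assumes "W \<subseteq> {1..n}" "card W \<le> j"
  shows "card {V \<in> subsets_of_size n j. W \<subseteq> V} = (n - card W) choose (j - card W)"
proof -
  have [simp]: "finite W" using assms finite_subset by blast
  have fin: "finite V" if "V \<subseteq> {1..n}" for V using that finite_subset by blast
  have "bij_betw (\<lambda>V. V - W) {V \<in> subsets_of_size n j. W \<subseteq> V}
     {U. U \<subseteq> {1..n} - W \<and> card U = j - card W}"
  proof (rule bij_betw_byWitness[where f' = "\<lambda>U. U \<union> W"])
    show "(\<lambda>U. U \<union> W) ` {U. U \<subseteq> {1..n} - W \<and> card U = j - card W}
        \<subseteq> {V \<in> subsets_of_size n j. W \<subseteq> V}"
    proof clarify
      fix U assume U: "U \<subseteq> {1..n} - W" "card U = j - card W"
      then have "finite U" using fin by blast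
      then have "card (U \<union> W) = j" using U assms by (subst card_Un_disjoint) auto
      then show "U \<union> W \<in> subsets_of_size n j \<and> W \<subseteq> U \<union> W"
        using U assms by (auto simp: subsets_of_size_def)
    qed
  qed (auto simp: subsets_of_size_def card_Diff_subset)
  then have "card {V \<in> subsets_of_size n j. W \<subseteq> V} =
      card {U. U \<subseteq> {1..n} - W \<and> card U = j - card W}"
    by (rule bij_betw_same_card)
  also have "\<dots> = (n - card W) choose (j - card W)"
    using assms by (subst n_subsets) (auto simp: card_Diff_subset)
  finally show ?thesis .
qed

lemma card_subsets_containing_1:
  assumes "v \<in> {1..n}" "j \<le> n"
  shows "real (card {V \<in> subsets_of_size n j. v \<in> V}) = real j / real n * real (n choose j)"
proof (cases "j = 0")
  case True
  have "V = {}" if "V \<in> subsets_of_size n 0" for V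
    using that finite_subset[of V "{1..n}"] by (auto simp: subsets_of_size_def)
  then have "{V \<in> subsets_of_size n j. v \<in> V} = {}" using True by blast
  then show ?thesis using True by (simp only: card.empty of_nat_0 mult_zero_left div_0)
next
  case False
  have "card {V \<in> subsets_of_size n j. v \<in> V} = (n - 1) choose (j - 1)"
    using card_subsets_containing[of "{v}" n j] assms False by simp
  moreover have "j * (n choose j) = n * ((n - 1) choose (j - 1))"
    using False by (intro times_binomial_minus1_eq) auto
  then have "real j * real (n choose j) = real n * real ((n - 1) choose (j - 1))"
    by (metis of_nat_mult)
  ultimately show ?thesis using assms by (simp add: field_simps)
qed

lemma card_subsets_containing_2:
  assumes "u \<in> {1..n}" "v \<in> {1..n}" "u \<noteq> v" "j \<le> n"
  shows "real (card {V \<in> subsets_of_size n j. u \<in> V \<and> v \<in> V}) =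
    real j * (real j - 1) / (real n * (real n - 1)) * real (n choose j)"
proof (cases "j \<le> 1")
  case True
  have "{V \<in> subsets_of_size n j. u \<in> V \<and> v \<in> V} = {}"
  proof (rule ccontr)
    assume "{V \<in> subsets_of_size n j. u \<in> V \<and> v \<in> V} \<noteq> {}"
    then obtain V where V: "V \<subseteq> {1..n}" "card V = j" "{u, v} \<subseteq> V"
      by (auto simp: subsets_of_size_def)
    then have "card {u, v} \<le> j" using finite_subset[of V "{1..n}"] by (metis card_mono finite_atLeastAtMost)
    then show False using True assms by simp
  qed
  moreover have "j = 0 \<or> j = 1" using True by auto
  ultimately show ?thesis by (auto simp del: Collect_empty_eq)
next
  case False
  have "n \<ge> 2" using assms False by auto
  have "card {V \<in> subsets_of_size n j. u \<in> V \<and> v \<in> V} = (n - 2) choose (j - 2)"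
    using card_subsets_containing[of "{u, v}" n j] assms False by (simp add: numeral_2_eq_2)
  moreover have "j * (n choose j) = n * ((n - 1) choose (j - 1))"
    using False by (intro times_binomial_minus1_eq) auto
  then have "real j * real (n choose j) = real n * real ((n - 1) choose (j - 1))"
    by (metis of_nat_mult)
  moreover have "(j - 1) * ((n - 1) choose (j - 1)) = (n - 1) * ((n - 1 - 1) choose (j - 1 - 1))"
    using False by (intro times_binomial_minus1_eq) auto
  then have "real (j - 1) * real ((n - 1) choose (j - 1)) = real (n - 1) * real ((n - 2) choose (j - 2))"
    by (metis of_nat_mult diff_diff_left one_add_one)
  then have "(real j - 1) * real ((n - 1) choose (j - 1)) = (real n - 1) * real ((n - 2) choose (j - 2))"
    using False \<open>n \<ge> 2\<close> by (simp add: of_nat_diff)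
  ultimately have "(real j - 1) * (real j * real (n choose j)) =
      real n * (real n - 1) * real (card {V \<in> subsets_of_size n j. u \<in> V \<and> v \<in> V})"
    by (metis mult.assoc mult.left_commute)
  moreover have "real n * (real n - 1) \<noteq> 0" using \<open>n \<ge> 2\<close> by auto
  ultimately show ?thesis by (simp add: field_simps)
qed

text \<open>Since j \<le> n, (j-1)/(n-1) \<le> j/n: under sampling without replacement, two
  memberships are negatively correlated.\<close>

lemma card_subsets_containing_2_le:
  assumes "u \<in> {1..n}" "v \<in> {1..n}" "u \<noteq> v" "j \<le> n"
  shows "real (card {V \<in> subsets_of_size n j. u \<in> V \<and> v \<in> V}) \<le>
    (real j / real n)\<^sup>2 * real (n choose j)"
proof -
  have n: "n \<ge> 2" using assms by auto
  have "real j * (real j - 1) / (real n * (real n - 1)) = real j / real n * ((real j - 1) / (real n - 1))"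
    by simp
  also have "\<dots> \<le> real j / real n * (real j / real n)"
  proof (rule mult_left_mono)
    show "(real j - 1) / (real n - 1) \<le> real j / real n"
      using n assms by (simp add: field_simps)
  qed auto
  finally show ?thesis
    unfolding card_subsets_containing_2[OF assms] power2_eq_square
    by (intro mult_right_mono) auto
qed

section \<open>A single community\<close>

lemma prob_community:
  "measure_pmf.prob (community_pmf n (x, q)) {g. R (snd g)} =
     (\<Sum>V\<in>subsets_of_size n (min x n). measure_pmf.prob (coin_edges V q) {E. R E}) / real (n choose min x n)"
proof -
  let ?S = "subsets_of_size n (min x n)"
  have S: "finite ?S" "?S \<noteq> {}"
    using vertex_choices[of n x] by (simp_all add: subsets_of_size_def)
  have "measure_pmf.prob (map_pmf (Pair V) (coin_edges V q)) {g. R (snd g)} =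
     measure_pmf.prob (coin_edges V q) {E. R E}" for V
    by simp
  then have "ennreal (measure_pmf.prob (community_pmf n (x, q)) {g. R (snd g)}) =
     (\<integral>\<^sup>+V. ennreal (measure_pmf.prob (coin_edges V q) {E. R E}) \<partial>pmf_of_set ?S)"
    by (simp add: community_pmf_eq subsets_of_size_def measure_pmf.emeasure_eq_measure[symmetric])
  also have "\<dots> = ennreal (\<integral>V. measure_pmf.prob (coin_edges V q) {E. R E} \<partial>pmf_of_set ?S)"
    using S by (intro nn_integral_eq_integral integrable_measure_pmf_finite) auto
  finally have "measure_pmf.prob (community_pmf n (x, q)) {g. R (snd g)} =
     (\<integral>V. measure_pmf.prob (coin_edges V q) {E. R E} \<partial>pmf_of_set ?S)"
    by (simp add: integral_nonneg_AE)
  also have "\<dots> = (\<Sum>V\<in>?S. measure_pmf.prob (coin_edges V q) {E. R E}) / card ?S"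
    using S by (intro integral_pmf_of_set)
  finally show ?thesis by (simp add: card_subsets_of_size)
qed

lemma sum_if_card:
  "finite S \<Longrightarrow> (\<Sum>V\<in>S. if P V then c else 0) = real (card {V \<in> S. P V}) * c"
  by (simp add: sum.If_cases Int_def)

context
  fixes n x :: nat and q :: real
  assumes q: "0 \<le> q" "q \<le> 1"
begin

abbreviation (input) "j \<equiv> min x n"
abbreviation (input) "S \<equiv> subsets_of_size n j"

lemma sizes: "V \<in> S \<Longrightarrow> finite V \<and> card V = j \<and> V \<subseteq> {1..n}"
  using finite_subset[of V "{1..n}"] by (auto simp: subsets_of_size_def)

lemma choose_pos: "real (n choose j) > 0"
  by simp

lemma prob_community_nonisolated:
  assumes "v \<in> {1..n}"
  shows "measure_pmf.prob (community_pmf n (x, q)) {g. incident (snd g) v \<noteq> {}} =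
     real j / real n * h j q"
proof -
  have "measure_pmf.prob (coin_edges V q) {E. incident E v \<noteq> {}} = (if v \<in> V then h j q else 0)"
    if V: "V \<in> S" for V
  proof (cases "v \<in> V")
    case True
    then show ?thesis using prob_coin_nonisolated[OF _ q] sizes[OF V] by simp
  next
    case False
    have "measure_pmf.prob (coin_edges V q) {E. incident E v \<noteq> {}} = 0"
      using incident_coin_notin[OF False]
      by (subst measure_pmf.prob_eq_0) (auto simp: AE_measure_pmf_iff)
    then show ?thesis using False by simp
  qed
  then have "(\<Sum>V\<in>S. measure_pmf.prob (coin_edges V q) {E. incident E v \<noteq> {}}) =
     real (card {V \<in> S. v \<in> V}) * h j q"
    by (simp add: sum_if_card finite_subsets_of_size)
  then show ?thesis
    unfolding prob_community[where R = "\<lambda>E. incident E v \<noteq> {}"]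
    using assms by (simp add: card_subsets_containing_1)
qed

lemma prob_community_degree_one:
  assumes "v \<in> {1..n}"
  shows "measure_pmf.prob (community_pmf n (x, q)) {g. card (incident (snd g) v) = 1} =
     real j / real n * ((real j - 1) * q * (1 - q) ^ (j - 2))"
proof -
  have "measure_pmf.prob (coin_edges V q) {E. card (incident E v) = 1} =
      (if v \<in> V then (real j - 1) * q * (1 - q) ^ (j - 2) else 0)"
    if V: "V \<in> S" for V
  proof (cases "v \<in> V")
    case True
    then show ?thesis using prob_coin_degree_one[OF _ q] sizes[OF V] by simp
  next
    case False
    have "measure_pmf.prob (coin_edges V q) {E. card (incident E v) = 1} = 0"
      using incident_coin_notin[OF False]
      by (subst measure_pmf.prob_eq_0) (auto simp: AE_measure_pmf_iff)
    then show ?thesis using False by simp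
  qed
  then have "(\<Sum>V\<in>S. measure_pmf.prob (coin_edges V q) {E. card (incident E v) = 1}) =
     real (card {V \<in> S. v \<in> V}) * ((real j - 1) * q * (1 - q) ^ (j - 2))"
    by (simp add: sum_if_card finite_subsets_of_size)
  then show ?thesis
    unfolding prob_community[where R = "\<lambda>E. card (incident E v) = 1"]
    using assms by (simp add: card_subsets_containing_1)
qed

text \<open>Both vertices must be chosen, and then one of them is already nonisolated with
  probability \<open>h j q\<close>. Keeping this single factor \<open>h\<close> is enough, because
  the square of j/n turns the bound into X h times X/n after averaging.\<close>

lemma prob_community_both_nonisolated:
  assumes "u \<in> {1..n}" "v \<in> {1..n}" "u \<noteq> v"
  shows "measure_pmf.prob (community_pmf n (x, q))
      {g. incident (snd g) u \<noteq> {} \<and> incident (snd g) v \<noteq> {}} \<le> (real j / real n)\<^sup>2 * h j q"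
proof -
  have "measure_pmf.prob (coin_edges V q) {E. incident E u \<noteq> {} \<and> incident E v \<noteq> {}} \<le>
      (if u \<in> V \<and> v \<in> V then h j q else 0)"
    if V: "V \<in> S" for V
  proof (cases "u \<in> V \<and> v \<in> V")
    case True
    have "measure_pmf.prob (coin_edges V q) {E. incident E u \<noteq> {} \<and> incident E v \<noteq> {}} \<le>
        measure_pmf.prob (coin_edges V q) {E. incident E u \<noteq> {}}"
      by (intro measure_pmf.finite_measure_mono) auto
    also have "\<dots> = h j q" using True prob_coin_nonisolated[OF _ q] sizes[OF V] by simp
    finally show ?thesis using True by simp
  next
    case False
    have "measure_pmf.prob (coin_edges V q) {E. incident E u \<noteq> {} \<and> incident E v \<noteq> {}} = 0"
      using incident_coin_notin False
      by (subst measure_pmf.prob_eq_0) (auto simp: AE_measure_pmf_iff)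
    then show ?thesis using False by auto
  qed
  then have "(\<Sum>V\<in>S. measure_pmf.prob (coin_edges V q) {E. incident E u \<noteq> {} \<and> incident E v \<noteq> {}}) \<le>
     (\<Sum>V\<in>S. if u \<in> V \<and> v \<in> V then h j q else 0)"
    by (rule sum_mono)
  also have "\<dots> = real (card {V \<in> S. u \<in> V \<and> v \<in> V}) * h j q"
    by (simp add: sum_if_card finite_subsets_of_size)
  also have "\<dots> \<le> (real j / real n)\<^sup>2 * real (n choose j) * h j q"
    using assms h_bounds[OF q] by (intro mult_right_mono card_subsets_containing_2_le) auto
  finally show ?thesis
    unfolding prob_community[where R = "\<lambda>E. incident E u \<noteq> {} \<and> incident E v \<noteq> {}"]
    by (simp add: field_simps)
qed

section \<open>Edges of one community leaving a vertex set\<close>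

context
  fixes A B :: "nat set"
  assumes A: "A \<subseteq> {1..n}"
begin

text \<open>If the community meets \<open>A \<union> B\<close> in a single vertex v of A, then every
  edge at v leads to a new neighbour outside \<open>B\<close>. The probability of such a meeting is
  bounded below as in Bonferroni's inequality: single memberships minus pairs, the pairs costing at
  most (|A| + k) (j/n)^2 for each vertex of A.\<close>

lemma prob_community_expand_small:
  assumes B: "B \<subseteq> {1..n}" and s: "card B < k"
  shows "measure_pmf.prob (community_pmf n (x, q)) {g. \<not> nb n (snd g) A \<subseteq> B} \<ge>
    real (card A) / real n * (real j * h j q * (1 - min 1 ((real (card A) + real k) * real j / real n)))"
proof -
  let ?U = "A \<union> B"
  let ?p = "\<lambda>V. measure_pmf.prob (coin_edges V q) {E. \<not> nb n E A \<subseteq> B}"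
  have fin: "finite A" "finite B" using A B finite_subset by blast+
  \<comment> \<open>This weight equals |A \<inter> V| (2 - |U \<inter> V|) with U = A \<union> B. It
    is 1 if V meets U only in one vertex of A, and at most 0 in all other cases, so it lies below
    the indicator of the favourable event, while its sum over V needs only membership counts of one
    and two vertices.\<close>
  define ind where "ind V = (\<Sum>v\<in>A. (if v \<in> V then 1 else 0) -
     (\<Sum>w\<in>?U - {v}. if v \<in> V \<and> w \<in> V then 1 else 0 :: real))" for V
  have main: "ind V * h j q \<le> ?p V" if V: "V \<in> S" for V
  proof -
    have ind: "ind V = real (card (A \<inter> V)) * (2 - real (card (?U \<inter> V)))"
    proof -
      have "(if v \<in> V then 1 else 0) - (\<Sum>w\<in>?U - {v}. if v \<in> V \<and> w \<in> V then 1 else 0 :: real) =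
        (if v \<in> V then 2 - real (card (?U \<inter> V)) else 0)" if "v \<in> A" for v
      proof (cases "v \<in> V")
        case True
        have "{w \<in> ?U - {v}. v \<in> V \<and> w \<in> V} = ?U \<inter> V - {v}" using True by auto
        then have "real (card {w \<in> ?U - {v}. v \<in> V \<and> w \<in> V}) = real (card (?U \<inter> V)) - 1"
          using True that fin by (simp add: card_Diff_singleton_if card_gt_0_iff of_nat_diff Suc_le_eq)
             (subst of_nat_diff, auto simp: Suc_le_eq card_gt_0_iff)
        then show ?thesis using True fin by (subst sum_if_card) auto
      qed auto
      then have "ind V = (\<Sum>v\<in>A. if v \<in> V then 2 - real (card (?U \<inter> V)) else 0)"
        unfolding ind_def by (intro sum.cong refl) blast
      also have "\<dots> = real (card {v \<in> A. v \<in> V}) * (2 - real (card (?U \<inter> V)))"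
        using fin by (subst sum_if_card) auto
      finally show ?thesis by (simp add: Int_def)
    qed
    consider "A \<inter> V = {}" | "card (?U \<inter> V) \<ge> 2" | "A \<inter> V \<noteq> {}" "card (?U \<inter> V) < 2" by linarith
    then show ?thesis
    proof cases
      case 1
      then show ?thesis using ind by simp
    next
      case 2
      then have "ind V \<le> 0" unfolding ind by (intro mult_nonneg_nonpos) auto
      then have "ind V * h j q \<le> 0" using h_bounds[OF q] by (intro mult_nonpos_nonneg) auto
      then show ?thesis using measure_nonneg order_trans by blast
    next
      case 3
      then obtain v where v: "v \<in> A" "v \<in> V" by blast
      have "card (?U \<inter> V) \<noteq> 0" using v fin by auto
      then have "card (?U \<inter> V) = 1" using 3 by linarith
      then obtain y where "?U \<inter> V = {y}" by (metis card_1_singletonE)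
      moreover have "v \<in> ?U \<inter> V" using v by blast
      ultimately have U: "?U \<inter> V = {v}" by simp
      then have AV: "A \<inter> V = {v}" using v by blast
      have "ind V * h j q = h (card V) q" using sizes[OF V] unfolding ind U AV by simp
      also have "\<dots> = measure_pmf.prob (coin_edges V q) {E. incident E v \<noteq> {}}"
        using prob_coin_nonisolated[OF _ q] sizes[OF V] v by simp
      also have "\<dots> \<le> ?p V"
      proof (rule measure_pmf.finite_measure_mono_AE)
        show "AE E in coin_edges V q. E \<in> {E. incident E v \<noteq> {}} \<longrightarrow> E \<in> {E. \<not> nb n E A \<subseteq> B}"
        proof (unfold AE_measure_pmf_iff, intro ballI impI)
          fix E assume E: "E \<in> set_pmf (coin_edges V q)" "E \<in> {E. incident E v \<noteq> {}}"
          then obtain e where e: "e \<in> E" "v \<in> e" by (auto simp: incident_def)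
          have "e \<in> vertex_pairs V" using E(1) e by (auto simp: coin_edges_def)
          then have "e \<in> incident (vertex_pairs V) v" using e by (auto simp: incident_def)
          \<comment> \<open>The other end of an edge at \<open>v\<close> lies in \<open>V\<close>,
            and \<open>v\<close> is the only vertex of \<open>V\<close> in
            \<open>A \<union> B\<close>.\<close>
          then obtain w where w: "w \<in> V" "w \<noteq> v" "e = {v, w}"
            using v by (auto simp: incident_vertex_pairs)
          have "w \<notin> ?U" using w U by blast
          then have "w \<in> nb n E A - B" using w e v sizes[OF V] by (auto simp: nb_def)
          then show "E \<in> {E. \<not> nb n E A \<subseteq> B}" by blast
        qed
      qed simp
      finally show ?thesis .
    qed
  qed
  let ?N = "real (n choose j)"
  let ?r = "real j / real n"
  have sumind: "(\<Sum>V\<in>S. ind V) \<ge> real (card A) * ?r * (1 - (real (card A) + real k) * ?r) * ?N"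
  proof -
    have "(\<Sum>V\<in>S. ind V) = (\<Sum>v\<in>A. (\<Sum>V\<in>S. (if v \<in> V then 1 else 0)) -
     (\<Sum>w\<in>?U - {v}. (\<Sum>V\<in>S. if v \<in> V \<and> w \<in> V then 1 else 0 :: real)))"
      unfolding ind_def
      by (subst sum.swap) (intro sum.cong refl, subst sum_subtractf, subst (2) sum.swap, simp)
    also have "\<dots> \<ge> (\<Sum>v\<in>A. ?r * ?N - (real (card A) + real k) * (?r\<^sup>2 * ?N))"
    proof (intro sum_mono diff_mono)
      fix v assume v: "v \<in> A"
      show "?r * ?N \<le> (\<Sum>V\<in>S. (if v \<in> V then 1 else 0))"
        using v A by (subst sum_if_card) (auto simp: finite_subsets_of_size card_subsets_containing_1)
      have "(\<Sum>w\<in>?U - {v}. (\<Sum>V\<in>S. if v \<in> V \<and> w \<in> V then 1 else 0 :: real)) \<le>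
          (\<Sum>w\<in>?U - {v}. ?r\<^sup>2 * ?N)"
      proof (rule sum_mono)
        fix w assume w: "w \<in> ?U - {v}"
        have vw: "v \<in> {1..n}" "w \<in> {1..n}" using v w A B by blast+
        show "(\<Sum>V\<in>S. if v \<in> V \<and> w \<in> V then 1 else 0 :: real) \<le> ?r\<^sup>2 * ?N"
          using w card_subsets_containing_2_le[OF vw, of j]
          by (subst sum_if_card) (auto simp: finite_subsets_of_size)
      qed
      also have "\<dots> = real (card (?U - {v})) * (?r\<^sup>2 * ?N)" by simp
      also have "\<dots> \<le> (real (card A) + real k) * (?r\<^sup>2 * ?N)"
      proof (rule mult_right_mono)
        have "card (?U - {v}) \<le> card ?U" using fin by (intro card_mono) auto
        also have "\<dots> \<le> card A + card B" by (rule card_Un_le)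
        finally show "real (card (?U - {v})) \<le> real (card A) + real k" using s by linarith
      qed simp
      finally show "(\<Sum>w\<in>?U - {v}. (\<Sum>V\<in>S. if v \<in> V \<and> w \<in> V then 1 else 0 :: real)) \<le>
         (real (card A) + real k) * (?r\<^sup>2 * ?N)" .
    qed
    finally show ?thesis by (simp add: algebra_simps power2_eq_square add_divide_distrib)
  qed
  have prob: "measure_pmf.prob (community_pmf n (x, q)) {g. \<not> nb n (snd g) A \<subseteq> B} \<ge>
      real (card A) * ?r * (1 - (real (card A) + real k) * ?r) * h j q"
  proof -
    have "real (card A) * ?r * (1 - (real (card A) + real k) * ?r) * ?N * h j q \<le> (\<Sum>V\<in>S. ind V) * h j q"
      using sumind h_bounds[OF q] by (intro mult_right_mono) auto
    also have "\<dots> \<le> (\<Sum>V\<in>S. ?p V)"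
      unfolding sum_distrib_right by (intro sum_mono main)
    finally have "real (card A) * ?r * (1 - (real (card A) + real k) * ?r) * h j q * ?N \<le> (\<Sum>V\<in>S. ?p V)"
      by (simp add: algebra_simps)
    then show ?thesis
      unfolding prob_community[where R = "\<lambda>E. \<not> nb n E A \<subseteq> B"]
      using choose_pos by (simp only: pos_le_divide_eq)
  qed
  \<comment> \<open>Where the Bonferroni bound would be negative, the \<open>min\<close> makes the
    claim the trivial bound 0.\<close>
  show ?thesis
  proof (cases "(real (card A) + real k) * real j / real n \<le> 1")
    case True
    then show ?thesis using prob by (simp add: algebra_simps)
  qed simp
qed

text \<open>The number of pairs in (A \<inter> V) x (B \<inter> V) divided by its maximum j(j-1) is
  at most the indicator that V meets both sets. On averaging, j(j-1) cancels, so the bound depends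
  on the size of the community only through j \<ge> 2; one fixed possible edge between A and B
  contributes the factor q.\<close>

lemma prob_community_expand_large:
  assumes x: "2 \<le> j" and disj: "A \<inter> B = {}" and B: "B \<subseteq> {1..n}"
  shows "measure_pmf.prob (community_pmf n (x, q)) {g. \<not> nb n (snd g) A \<subseteq> {1..n} - B} \<ge>
    q * real (card A) * real (card B) / (real n)\<^sup>2"
proof -
  let ?p = "\<lambda>V. measure_pmf.prob (coin_edges V q) {E. \<not> nb n E A \<subseteq> {1..n} - B}"
  have fin: "finite A" "finite B" using A B finite_subset by blast+
  define ind where "ind V = (\<Sum>v\<in>A. \<Sum>w\<in>B. if v \<in> V \<and> w \<in> V then 1 else 0 :: real)" for V
  let ?jj = "real j * (real j - 1)"
  have jj: "?jj > 0" using x by auto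
  have main: "ind V * q / ?jj \<le> ?p V" if V: "V \<in> S" for V
  proof (cases "A \<inter> V = {} \<or> B \<inter> V = {}")
    case True
    then have "ind V = 0" unfolding ind_def by (intro sum.neutral ballI) auto
    then show ?thesis by simp
  next
    case False
    then obtain v w where vw: "v \<in> A" "v \<in> V" "w \<in> B" "w \<in> V" by blast
    let ?a = "card (A \<inter> V)" and ?b = "card (B \<inter> V)"
    have "ind V = (\<Sum>v\<in>A. if v \<in> V then real ?b else 0)"
      unfolding ind_def using fin by (intro sum.cong refl) (auto simp: sum.If_cases Int_def)
    also have "\<dots> = real ?a * real ?b" using fin by (simp add: sum.If_cases Int_def)
    finally have ind: "ind V = real ?a * real ?b" .
    have "?a + ?b = card ((A \<union> B) \<inter> V)"
      using fin disj by (subst card_Un_disjoint[symmetric]) (auto simp: Int_Un_distrib2)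
    also have "\<dots> \<le> card V" using sizes[OF V] by (intro card_mono) auto
    finally have ab: "?a + ?b \<le> j" using sizes[OF V] by simp
    have "?a > 0" "?b > 0" using vw fin by (auto simp: card_gt_0_iff)
    \<comment> \<open>Both intersections are nonempty and disjoint in \<open>V\<close>, hence ?a
      \<le> j and ?b \<le> j - 1.\<close>
    then have "ind V \<le> ?jj" unfolding ind using ab by (intro mult_mono) (simp_all, linarith+)
    then have "ind V * q / ?jj \<le> q" using mult_left_mono[of "ind V" ?jj q] jj q
      by (simp only: pos_divide_le_eq mult.commute)
    also have "q = measure_pmf.prob (coin_edges V q) {E. {v, w} \<in> E}"
      using vw disj sizes[OF V] q by (subst prob_coin_edge) auto
    also have "\<dots> \<le> ?p V"
    proof (intro measure_pmf.finite_measure_mono subsetI)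
      fix E assume "E \<in> {E. {v, w} \<in> E}"
      then have "w \<in> nb n E A \<inter> B" using vw disj B by (auto simp: nb_def)
      then show "E \<in> {E. \<not> nb n E A \<subseteq> {1..n} - B}" by blast
    qed simp
    finally show ?thesis .
  qed
  let ?N = "real (n choose j)"
  have "(\<Sum>V\<in>S. ind V) = (\<Sum>v\<in>A. \<Sum>w\<in>B. \<Sum>V\<in>S. if v \<in> V \<and> w \<in> V then 1 else 0)"
    unfolding ind_def by (subst sum.swap) (intro sum.cong refl sum.swap)
  also have "\<dots> = (\<Sum>v\<in>A. \<Sum>w\<in>B. ?jj / (real n * (real n - 1)) * ?N)"
  proof (intro sum.cong refl)
    fix v w assume "v \<in> A" "w \<in> B"
    then have "v \<in> {1..n}" "w \<in> {1..n}" "v \<noteq> w" using A B disj by blast+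
    then show "(\<Sum>V\<in>S. if v \<in> V \<and> w \<in> V then 1 else 0) = ?jj / (real n * (real n - 1)) * ?N"
      using card_subsets_containing_2[of v n w j] by (subst sum_if_card[OF finite_subsets_of_size]) simp
  qed
  also have "\<dots> = real (card A) * real (card B) * (?jj / (real n * (real n - 1)) * ?N)" by simp
  finally have sumind: "(\<Sum>V\<in>S. ind V) = real (card A) * real (card B) * (?jj / (real n * (real n - 1)) * ?N)" .
  have n: "n \<ge> 2" using x by simp
  have "q * real (card A) * real (card B) / (real n)\<^sup>2 * ?N \<le>
      q * real (card A) * real (card B) / (real n * (real n - 1)) * ?N"
    unfolding power2_eq_square using n q by (intro mult_right_mono divide_left_mono mult_left_mono) auto
  also have "\<dots> = (\<Sum>V\<in>S. ind V) * q / ?jj" 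
  proof -
    have "q * a * b / d * c = a * b * (t / d * c) * q / t" if "t > 0" for a b c d t :: real
      using that by simp
    from this[OF jj] show ?thesis unfolding sumind .
  qed
  also have "\<dots> \<le> (\<Sum>V\<in>S. ?p V)"
    unfolding sum_distrib_right sum_divide_distrib by (intro sum_mono main)
  finally show ?thesis
    unfolding prob_community[where R = "\<lambda>E. \<not> nb n E A \<subseteq> {1..n} - B"]
    using choose_pos by (simp only: pos_le_divide_eq)
qed

end

end

section \<open>Independent communities\<close>

lemma prod_if_mem:
  fixes f g :: "'a \<Rightarrow> real"
  assumes "finite I" "T \<subseteq> I"
  shows "(\<Prod>i\<in>I. if i \<in> T then f i else g i) = (\<Prod>i\<in>T. f i) * (\<Prod>i\<in>I - T. g i)"
  using assms by (simp add: prod.If_cases Int_absorb1 Diff_eq)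

text \<open>Chebyshev's inequality for the number N of events that occur: where none occurs, (N -
  c)^2 equals c^2 for the mean c.\<close>

lemma (in prob_space) second_moment_bound:
  assumes I: "finite I" "I \<noteq> {}"
    and ev: "\<And>v. v \<in> I \<Longrightarrow> A v \<in> events"
    and a: "\<And>v. v \<in> I \<Longrightarrow> prob (A v) = a" "a > 0"
    and b: "\<And>u v. u \<in> I \<Longrightarrow> v \<in> I \<Longrightarrow> u \<noteq> v \<Longrightarrow> prob (A u \<inter> A v) \<le> b"
    and b0: "b \<ge> 0"
  shows "prob (space M - (\<Union>v\<in>I. A v)) \<le> 1 / (real (card I) * a) + b / a\<^sup>2 - 1"
proof -
  define N where "N = (\<lambda>\<omega>. \<Sum>v\<in>I. indicator (A v) \<omega> :: real)"
  define c where "c = real (card I) * a"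
  let ?E = "space M - (\<Union>v\<in>I. A v)"
  have cI: "real (card I) > 0" using I by (simp add: card_gt_0_iff)
  then have c: "c > 0" using a by (simp add: c_def)
  have E: "?E \<in> events" using ev I by auto
  have intN: "integrable M N" unfolding N_def using ev by (auto intro!: integrable_real_indicator simp: emeasure_eq_measure)
  have N2: "(N \<omega>)\<^sup>2 = (\<Sum>u\<in>I. \<Sum>v\<in>I. indicator (A u \<inter> A v) \<omega>)" for \<omega>
    by (simp add: N_def power2_eq_square sum_product indicator_inter_arith)
  have ind: "integrable M (\<lambda>\<omega>. indicator (A u \<inter> A v) \<omega> :: real)"
    and Eind: "expectation (\<lambda>\<omega>. indicator (A u \<inter> A v) \<omega> :: real) = prob (A u \<inter> A v)"
    if "u \<in> I" "v \<in> I" for u v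
    using ev[OF that(1)] ev[OF that(2)] by (auto simp: less_top[symmetric])
  have intN2: "integrable M (\<lambda>\<omega>. (N \<omega>)\<^sup>2)"
    unfolding N2 by (intro Bochner_Integration.integrable_sum ind)
  have EN: "expectation N = c"
    unfolding N_def c_def using ev a by (subst Bochner_Integration.integral_sum) (auto simp: emeasure_eq_measure)
  have "expectation (\<lambda>\<omega>. (N \<omega>)\<^sup>2) = (\<Sum>u\<in>I. expectation (\<lambda>\<omega>. \<Sum>v\<in>I. indicator (A u \<inter> A v) \<omega>))"
    unfolding N2 by (intro Bochner_Integration.integral_sum Bochner_Integration.integrable_sum ind)
  also have "\<dots> = (\<Sum>u\<in>I. \<Sum>v\<in>I. expectation (\<lambda>\<omega>. indicator (A u \<inter> A v) \<omega>))"
    by (intro sum.cong refl Bochner_Integration.integral_sum ind)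
  also have "\<dots> = (\<Sum>u\<in>I. \<Sum>v\<in>I. prob (A u \<inter> A v))"
    by (intro sum.cong refl Eind)
  \<comment> \<open>The diagonal pairs receive the nonnegative \<open>b\<close> as well, which gives
    the double sum the closed form c + |I|^2 b.\<close>
  also have "\<dots> \<le> (\<Sum>u\<in>I. \<Sum>v\<in>I. (if v = u then a else 0) + b)"
    using a b b0 by (intro sum_mono) (auto split: if_splits)
  also have "\<dots> = c + (real (card I))\<^sup>2 * b"
    using I by (simp add: sum.distrib c_def power2_eq_square algebra_simps)
  finally have EN2: "expectation (\<lambda>\<omega>. (N \<omega>)\<^sup>2) \<le> c + (real (card I))\<^sup>2 * b" .
  have "c\<^sup>2 * prob ?E = expectation (\<lambda>\<omega>. c\<^sup>2 * indicator ?E \<omega>)"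
    using E by (simp add: emeasure_eq_measure)
  also have "\<dots> \<le> expectation (\<lambda>\<omega>. (N \<omega> - c)\<^sup>2)"
  proof (rule integral_mono)
    show "integrable M (\<lambda>\<omega>. c\<^sup>2 * indicator ?E \<omega>)"
      using E by (auto intro!: integrable_real_indicator simp: emeasure_eq_measure)
    show "integrable M (\<lambda>\<omega>. (N \<omega> - c)\<^sup>2)"
      using intN intN2 by (simp add: power2_diff)
    fix \<omega>
    have "N \<omega> = 0" if "\<omega> \<in> ?E" using that by (auto simp: N_def intro!: sum.neutral)
    then show "c\<^sup>2 * indicator ?E \<omega> \<le> (N \<omega> - c)\<^sup>2" by (auto simp: indicator_def)
  qed
  also have "\<dots> = expectation (\<lambda>\<omega>. (N \<omega>)\<^sup>2) - c\<^sup>2"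
    using intN intN2 EN by (simp add: power2_diff prob_space) (simp add: power2_eq_square)
  also have "\<dots> \<le> c + (real (card I))\<^sup>2 * b - c\<^sup>2" using EN2 by simp
  finally have "prob ?E \<le> (c + (real (card I))\<^sup>2 * b - c\<^sup>2) / c\<^sup>2"
    using c by (subst pos_le_divide_eq) (auto simp: mult.commute)
  also have "\<dots> = 1 / c + b / a\<^sup>2 - 1"
    using c a cI by (simp add: c_def diff_divide_distrib add_divide_distrib power2_eq_square)
  finally show ?thesis by (simp add: c_def)
qed

locale iid_family = P: prob_space P + N: prob_space \<nu>
  for P :: "(nat \<Rightarrow> 'g) measure" and \<nu> :: "'g measure" +
  fixes m :: nat
  assumes sets_P: "sets P = UNIV" and sets_\<nu>: "sets \<nu> = UNIV"
    and product: "\<And>A. measure P {G. \<forall>i\<in>{1..m}. G i \<in> A i} = (\<Prod>i\<in>{1..m}. measure \<nu> (A i))"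
begin

text \<open>The union of the \<open>N (G i)\<close> is already covered by fewer than \<open>k\<close> of them, one for each of its
  points; all the other \<open>N (G i)\<close> lie in this union.\<close>

lemma prob_small_union:
  fixes N :: "'g \<Rightarrow> nat set"
  assumes U: "finite U" "\<And>g. N g \<subseteq> U"
    and p: "measure \<nu> {g. N g \<noteq> {}} \<le> p"
    and \<rho>: "\<And>S. S \<subseteq> U \<Longrightarrow> card S < k \<Longrightarrow> measure \<nu> {g. N g \<subseteq> S} \<le> \<rho>"
    and k: "k \<le> m" "0 < k"
  shows "measure P {G. card (\<Union>i\<in>{1..m}. N (G i)) < k} \<le> (\<Sum>t<k. real (m choose t) * p ^ t * \<rho> ^ (m - t))"
proof -
  define \<T> where "\<T> = {T. T \<subseteq> {1..m} \<and> card T < k}"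
  define \<G> where "\<G> T = {g \<in> PiE T (\<lambda>_. Pow U - {{}}). card (\<Union>(g ` T)) < k}" for T :: "nat set"
  \<comment> \<open>For the covering indices the exact value \<open>g i\<close> is prescribed, not
    only that it is nonempty: the union of all values is then a fixed set, and the condition on
    every other index becomes a product event.\<close>
  define B where "B T g i = (if i \<in> T then {x. N x = g i} else {x. N x \<subseteq> \<Union>(g ` T)})"
    for T :: "nat set" and g :: "nat \<Rightarrow> nat set" and i
  let ?F = "\<lambda>T g. {G. \<forall>i\<in>{1..m}. G i \<in> B T g i}"
  have finT: "finite T" if "T \<in> \<T>" for T using that finite_subset by (auto simp: \<T>_def)
  have fT: "finite \<T>" by (rule finite_subset[of _ "Pow {1..m}"]) (auto simp: \<T>_def)
  have fPi: "finite (PiE T (\<lambda>_. Pow U - {{}}))" if "T \<in> \<T>" for T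
    using finT[OF that] U by (intro finite_PiE) auto
  then have fG: "finite (\<G> T)" if "T \<in> \<T>" for T
    using that by (auto simp: \<G>_def intro: finite_subset)
  have p0: "0 \<le> p" using p measure_nonneg order_trans by blast
  have "measure \<nu> {g. N g \<subseteq> {}} \<le> \<rho>" using k by (intro \<rho>) auto
  then have \<rho>0: "0 \<le> \<rho>" by (rule order_trans[OF measure_nonneg])
  have "{G. card (\<Union>i\<in>{1..m}. N (G i)) < k} \<subseteq> (\<Union>T\<in>\<T>. \<Union>g\<in>\<G> T. ?F T g)"
  proof
    fix G assume "G \<in> {G. card (\<Union>i\<in>{1..m}. N (G i)) < k}"
    define S where "S = (\<Union>i\<in>{1..m}. N (G i))"
    have cS: "card S < k" using \<open>G \<in> _\<close> by (simp add: S_def)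
    have fS: "finite S" using U by (auto simp: S_def intro: finite_subset)
    have "\<forall>w\<in>S. \<exists>i\<in>{1..m}. w \<in> N (G i)" by (auto simp: S_def)
    then obtain f where f: "\<And>w. w \<in> S \<Longrightarrow> f w \<in> {1..m} \<and> w \<in> N (G (f w))" by metis
    \<comment> \<open>One covering index per point of the union, so \<open>T\<close> has at most
      \<open>card S\<close> elements, hence fewer than \<open>k\<close>.\<close>
    define T where "T = f ` S"
    define g where "g = restrict (\<lambda>i. N (G i)) T"
    have T: "T \<in> \<T>" using f cS card_image_le[OF fS, of f] by (auto simp: \<T>_def T_def)
    have gT: "\<Union>(g ` T) = S"
    proof
      show "\<Union>(g ` T) \<subseteq> S"
      proof
        fix x assume "x \<in> \<Union>(g ` T)"
        then obtain w where "w \<in> S" "x \<in> N (G (f w))" by (auto simp: g_def T_def)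
        then show "x \<in> S" using f[of w] unfolding S_def by blast
      qed
      show "S \<subseteq> \<Union>(g ` T)" using f by (auto simp: g_def T_def)
    qed
    have "N (G i) \<noteq> {}" if "i \<in> T" for i using that f by (auto simp: T_def)
    then have "g \<in> \<G> T" using cS gT U by (auto simp: \<G>_def g_def)
    moreover have "G \<in> ?F T g" using gT by (auto simp: B_def g_def S_def)
    ultimately show "G \<in> (\<Union>T\<in>\<T>. \<Union>g\<in>\<G> T. ?F T g)" using T by blast
  qed
  then have "measure P {G. card (\<Union>i\<in>{1..m}. N (G i)) < k} \<le> measure P (\<Union>T\<in>\<T>. \<Union>g\<in>\<G> T. ?F T g)"
    by (intro P.finite_measure_mono) (auto simp: sets_P)
  also have "\<dots> \<le> (\<Sum>T\<in>\<T>. measure P (\<Union>g\<in>\<G> T. ?F T g))"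
    using fT by (intro measure_UNION_le) (auto simp: sets_P)
  also have "\<dots> \<le> (\<Sum>T\<in>\<T>. \<Sum>g\<in>\<G> T. measure P (?F T g))"
    using fG by (intro sum_mono measure_UNION_le) (auto simp: sets_P)
  also have "\<dots> \<le> (\<Sum>T\<in>\<T>. p ^ card T * \<rho> ^ (m - card T))"
  proof (rule sum_mono)
    fix T assume T: "T \<in> \<T>"
    then have T': "T \<subseteq> {1..m}" "finite T" using finT[OF T] by (auto simp: \<T>_def)
    have "(\<Sum>g\<in>\<G> T. measure P (?F T g)) \<le>
        (\<Sum>g\<in>\<G> T. (\<Prod>i\<in>T. measure \<nu> {x. N x = g i}) * \<rho> ^ (m - card T))"
    proof (rule sum_mono)
      fix g assume g: "g \<in> \<G> T"
      have "measure P (?F T g) = (\<Prod>i\<in>{1..m}. measure \<nu> (B T g i))" by (rule product)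
      also have "\<dots> = (\<Prod>i\<in>{1..m}. if i \<in> T then measure \<nu> {x. N x = g i} else measure \<nu> {x. N x \<subseteq> \<Union>(g ` T)})"
        by (intro prod.cong) (auto simp: B_def)
      also have "\<dots> = (\<Prod>i\<in>T. measure \<nu> {x. N x = g i}) * measure \<nu> {x. N x \<subseteq> \<Union>(g ` T)} ^ (m - card T)"
        using T' by (subst prod_if_mem) (auto simp: card_Diff_subset)
      also have "\<dots> \<le> (\<Prod>i\<in>T. measure \<nu> {x. N x = g i}) * \<rho> ^ (m - card T)"
        using g by (intro mult_left_mono power_mono \<rho> prod_nonneg) (auto simp: \<G>_def PiE_iff)
      finally show "measure P (?F T g) \<le> (\<Prod>i\<in>T. measure \<nu> {x. N x = g i}) * \<rho> ^ (m - card T)" .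
    qed
    \<comment> \<open>The restriction to small unions was needed only to apply \<rho>. Without it,
      the sum over all \<open>g\<close> factorizes, and each factor is the probability that
      \<open>N\<close> is nonempty.\<close>
    also have "\<dots> \<le> (\<Sum>g\<in>PiE T (\<lambda>_. Pow U - {{}}). (\<Prod>i\<in>T. measure \<nu> {x. N x = g i}) * \<rho> ^ (m - card T))"
      using fPi[OF T] \<rho>0 by (intro sum_mono2) (auto simp: \<G>_def intro!: mult_nonneg_nonneg prod_nonneg)
    also have "\<dots> = (\<Prod>i\<in>T. \<Sum>C\<in>Pow U - {{}}. measure \<nu> {x. N x = C}) * \<rho> ^ (m - card T)"
      using T' U by (subst prod_sum_PiE) (auto simp: sum_distrib_right)
    also have "(\<Sum>C\<in>Pow U - {{}}. measure \<nu> {x. N x = C}) = measure \<nu> (\<Union>C\<in>Pow U - {{}}. {x. N x = C})"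
      using U by (intro N.finite_measure_finite_Union[symmetric]) (auto simp: sets_\<nu> disjoint_family_on_def)
    also have "(\<Union>C\<in>Pow U - {{}}. {x. N x = C}) = {x. N x \<noteq> {}}" using U by auto
    also have "(\<Prod>i\<in>T. measure \<nu> {x. N x \<noteq> {}}) * \<rho> ^ (m - card T) \<le> p ^ card T * \<rho> ^ (m - card T)"
      using p \<rho>0 by (intro mult_right_mono) (auto intro!: power_mono)
    finally show "(\<Sum>g\<in>\<G> T. measure P (?F T g)) \<le> p ^ card T * \<rho> ^ (m - card T)" .
  qed
  also have "\<dots> = (\<Sum>t<k. \<Sum>T\<in>{T\<in>\<T>. card T = t}. p ^ card T * \<rho> ^ (m - card T))"
    using fT by (intro sum.group[symmetric]) (auto simp: \<T>_def)
  also have "\<dots> = (\<Sum>t<k. real (m choose t) * p ^ t * \<rho> ^ (m - t))"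
  proof (rule sum.cong)
    fix t assume t: "t \<in> {..<k}"
    then have "{T\<in>\<T>. card T = t} = {T. T \<subseteq> {1..m} \<and> card T = t}" by (auto simp: \<T>_def)
    then have "card {T\<in>\<T>. card T = t} = m choose t" by (simp add: n_subsets)
    then show "(\<Sum>T\<in>{T\<in>\<T>. card T = t}. p ^ card T * \<rho> ^ (m - card T)) =
       real (m choose t) * p ^ t * \<rho> ^ (m - t)" by simp
  qed simp
  finally show ?thesis .
qed

section \<open>Events with exactly r exceptional communities\<close>

definition pick :: "nat \<Rightarrow> 'g set \<Rightarrow> 'g set \<Rightarrow> (nat \<Rightarrow> 'g) set" where
  "pick r B1 B0 = {G. \<exists>T\<subseteq>{1..m}. card T = r \<and> (\<forall>i\<in>{1..m}. G i \<in> (if i \<in> T then B1 else B0))}"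

lemma pick_eq:
  "pick r B1 B0 = (\<Union>T\<in>{T. T \<subseteq> {1..m} \<and> card T = r}. {G. \<forall>i\<in>{1..m}. G i \<in> (if i \<in> T then B1 else B0)})"
  by (auto simp: pick_def)

lemma finite_subsets_card: "finite {T. T \<subseteq> {1..m} \<and> card T = r}"
  by (rule finite_subset[of _ "Pow {1..m}"]) auto

text \<open>Disjointness of \<open>B1\<close> and \<open>B0\<close> makes the set T of exceptional
  indices a function of G, so the events for different T are disjoint.\<close>

lemma prob_pick:
  assumes "B1 \<inter> B0 = {}"
  shows "measure P (pick r B1 B0) = real (m choose r) * measure \<nu> B1 ^ r * measure \<nu> B0 ^ (m - r)"
proof -
  let ?F = "\<lambda>T. {G. \<forall>i\<in>{1..m}. G i \<in> (if i \<in> T then B1 else B0)}"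
  have "?F T \<inter> ?F T' = {}" if "T \<subseteq> {1..m}" "T' \<subseteq> {1..m}" "T \<noteq> T'" for T T'
  proof -
    from that obtain i where i: "i \<in> {1..m}" "i \<in> T \<longleftrightarrow> i \<notin> T'" by blast
    have False if "G \<in> ?F T" "G \<in> ?F T'" for G
    proof -
      have "G i \<in> (if i \<in> T then B1 else B0) \<inter> (if i \<in> T' then B1 else B0)" using that i(1) by blast
      then show False using i(2) assms by (cases "i \<in> T") auto
    qed
    then show ?thesis by blast
  qed
  then have "measure P (pick r B1 B0) = (\<Sum>T\<in>{T. T \<subseteq> {1..m} \<and> card T = r}. measure P (?F T))"
    unfolding pick_eq
    by (intro P.finite_measure_finite_Union finite_subsets_card) (auto simp: sets_P disjoint_family_on_def)
  also have "\<dots> = (\<Sum>T\<in>{T. T \<subseteq> {1..m} \<and> card T = r}. measure \<nu> B1 ^ r * measure \<nu> B0 ^ (m - r))"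
  proof (rule sum.cong)
    fix T assume T: "T \<in> {T. T \<subseteq> {1..m} \<and> card T = r}"
    then have "finite T" using finite_subset by auto
    have "measure P (?F T) = (\<Prod>i\<in>{1..m}. if i \<in> T then measure \<nu> B1 else measure \<nu> B0)"
      unfolding product by (intro prod.cong) auto
    then show "measure P (?F T) = measure \<nu> B1 ^ r * measure \<nu> B0 ^ (m - r)"
      using T \<open>finite T\<close> by (subst (asm) prod_if_mem) (auto simp: card_Diff_subset)
  qed simp
  finally show ?thesis by (simp add: n_subsets)
qed

text \<open>Pairs (T, T') are grouped by their overlap s. Disjoint pairs give the main term. Each
  common index replaces b^2 by \<rho> and removes a factor of order m from the number of pairs, a
  relative cost \<rho>/(m b^2) \<le> y; as y \<le> 1, every s \<ge> 1 contributes at most (2r)^r y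
  relative to the main term.\<close>

lemma prob_pick_both:
  assumes "measure \<nu> (B1 \<inter> C1) \<le> \<rho>" "measure \<nu> (B1 \<inter> C0) \<le> b" "measure \<nu> (B0 \<inter> C1) \<le> b"
    and "measure \<nu> (B0 \<inter> C0) \<le> z" "z \<le> 1" and b: "b > 0" and y: "\<rho> \<le> y * (real m * b\<^sup>2)" "y \<le> 1"
    and m: "m > 0" "r \<le> m"
  shows "measure P (pick r B1 B0 \<inter> pick r C1 C0) \<le>
    z ^ (m - 2 * r) * (real (m choose r))\<^sup>2 * b ^ (2 * r) * (1 + real r * (2 * real r) ^ r * y)"
proof -
  let ?\<T> = "{T. T \<subseteq> {1..m} \<and> card T = r}"
  let ?F = "\<lambda>T. {G. \<forall>i\<in>{1..m}. G i \<in> (if i \<in> T then B1 else B0)}"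
  let ?H = "\<lambda>T. {G. \<forall>i\<in>{1..m}. G i \<in> (if i \<in> T then C1 else C0)}"
  define f where "f s = z ^ (m - 2 * r) * (\<rho> ^ s * b ^ (2 * (r - s)))" for s
  have z0: "0 \<le> z" using assms(4) measure_nonneg order_trans by blast
  have \<rho>0: "0 \<le> \<rho>" using assms(1) measure_nonneg order_trans by blast
  have "0 \<le> y * (real m * b\<^sup>2)" using y \<rho>0 by linarith
  moreover have "real m * b\<^sup>2 > 0" using b m by simp
  ultimately have y0: "0 \<le> y" by (simp only: zero_le_mult_iff) linarith
  have f0: "0 \<le> f s" for s using z0 \<rho>0 b by (simp add: f_def)
  have one: "measure P (?F T \<inter> ?H T') \<le> f (card (T \<inter> T'))" if "T \<in> ?\<T>" "T' \<in> ?\<T>" for T T'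
  proof -
    have T: "finite T" "finite T'" "T \<subseteq> {1..m}" "T' \<subseteq> {1..m}" "card T = r" "card T' = r"
      using that finite_subset by auto
    have "?F T \<inter> ?H T' = {G. \<forall>i\<in>{1..m}. G i \<in> (if i \<in> T then B1 else B0) \<inter> (if i \<in> T' then C1 else C0)}"
      by auto
    then have "measure P (?F T \<inter> ?H T') =
       (\<Prod>i\<in>{1..m}. measure \<nu> ((if i \<in> T then B1 else B0) \<inter> (if i \<in> T' then C1 else C0)))"
      by (simp only: product)
    also have "\<dots> \<le> (\<Prod>i\<in>{1..m}. if i \<in> T then (if i \<in> T' then \<rho> else b) else (if i \<in> T' then b else z))"
      using assms(1-4) by (intro prod_mono) auto
    also have "\<dots> = (\<Prod>i\<in>T. if i \<in> T \<inter> T' then \<rho> else b) * (\<Prod>i\<in>{1..m} - T. if i \<in> T' - T then b else z)"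
      using T by (subst prod_if_mem) (auto intro!: arg_cong2[where f = "(*)"] prod.cong)
    also have "\<dots> = \<rho> ^ card (T \<inter> T') * b ^ card (T - T \<inter> T') *
        (b ^ card (T' - T) * z ^ card ({1..m} - T - (T' - T)))"
      using T by (subst prod_if_mem, simp, simp, subst prod_if_mem) auto
    also have "card (T - T \<inter> T') = r - card (T \<inter> T')" using T by (subst card_Diff_subset) auto
    also have "card (T' - T) = r - card (T \<inter> T')"
      using T card_Diff_subset_Int[of T' T] by (simp add: Int_commute)
    also have "\<rho> ^ card (T \<inter> T') * b ^ (r - card (T \<inter> T')) *
        (b ^ (r - card (T \<inter> T')) * z ^ card ({1..m} - T - (T' - T))) =
        z ^ card ({1..m} - T - (T' - T)) * (\<rho> ^ card (T \<inter> T') * b ^ (2 * (r - card (T \<inter> T'))))"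
      by (simp add: mult_2 power_add)
    also have "\<dots> \<le> f (card (T \<inter> T'))"
      unfolding f_def
    proof (intro mult_right_mono power_decreasing)
      \<comment> \<open>At most 2r indices are exceptional for either event; since z \<le> 1, the
        exponent of z may be lowered to m - 2r uniformly in the overlap.\<close>
      have "card (T \<union> T') \<le> 2 * r" using card_Un_le[of T T'] T by simp
      moreover have "{1..m} - T - (T' - T) = {1..m} - (T \<union> T')" by blast
      moreover have "card ({1..m} - (T \<union> T')) = m - card (T \<union> T')"
        using T by (subst card_Diff_subset) auto
      ultimately show "m - 2 * r \<le> card ({1..m} - T - (T' - T))" by simp
    qed (use z0 \<open>z \<le> 1\<close> \<rho>0 b in auto)
    finally show ?thesis .
  qed
  define Z where "Z = z ^ (m - 2 * r) * real (m choose r) * b ^ (2 * r)"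
  have Z0: "0 \<le> Z" using z0 b by (simp add: Z_def)
  have inner: "(\<Sum>T'\<in>?\<T>. f (card (T \<inter> T'))) \<le> Z * (1 + real r * (2 * real r) ^ r * y)" if T: "T \<in> ?\<T>" for T
  proof -
    have fT: "finite T" "T \<subseteq> {1..m}" "card T = r" using T finite_subset by auto
    have "(\<Sum>T'\<in>?\<T>. f (card (T \<inter> T'))) = (\<Sum>s\<le>r. \<Sum>T'\<in>{T'\<in>?\<T>. card (T \<inter> T') = s}. f (card (T \<inter> T')))"
      using fT by (intro sum.group[symmetric] finite_subsets_card) (auto intro!: card_mono simp: fT(3)[symmetric])
    also have "\<dots> = (\<Sum>s\<le>r. real (card {T'\<in>?\<T>. card (T \<inter> T') = s}) * f s)"
      by (intro sum.cong) auto
    also have "\<dots> \<le> (\<Sum>s\<le>r. if s = 0 then Z else Z * ((2 * real r) ^ r * y))"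
    proof (rule sum_mono)
      fix s assume s: "s \<in> {..r}"
      show "real (card {T'\<in>?\<T>. card (T \<inter> T') = s}) * f s \<le> (if s = 0 then Z else Z * ((2 * real r) ^ r * y))"
      proof (cases "s = 0")
        case True
        have "card {T'\<in>?\<T>. card (T \<inter> T') = s} \<le> card ?\<T>"
          by (intro card_mono finite_subsets_card) auto
        then have "real (card {T'\<in>?\<T>. card (T \<inter> T') = s}) * f s \<le> real (m choose r) * f s"
          using f0[of s] by (intro mult_right_mono) (auto simp: n_subsets)
        then show ?thesis using True by (simp add: f_def Z_def mult_ac)
      next
        case False
        then have rs: "1 \<le> s" "s \<le> r" "1 \<le> r" using s by auto
        let ?W = "{W. W \<subseteq> {1..m} \<and> card W = r - s}"
        \<comment> \<open>\<open>T'\<close> is determined by its trace on \<open>T\<close> (at most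
          2^r choices) and by its r - s elements outside.\<close>
        have "card {T'\<in>?\<T>. card (T \<inter> T') = s} \<le> card (Pow T \<times> ?W)"
        proof (rule card_inj_on_le)
          show "inj_on (\<lambda>T'. (T \<inter> T', T' - T)) {T'\<in>?\<T>. card (T \<inter> T') = s}"
            by (rule inj_onI) blast
          show "(\<lambda>T'. (T \<inter> T', T' - T)) ` {T'\<in>?\<T>. card (T \<inter> T') = s} \<subseteq> Pow T \<times> ?W"
          proof (rule image_subsetI)
            fix T' assume "T' \<in> {T'\<in>?\<T>. card (T \<inter> T') = s}"
            then have T': "T' \<subseteq> {1..m}" "card T' = r" "s = card (T \<inter> T')" by auto
            then have "finite T'" using finite_subset by auto
            then have "card (T' - T) = r - card (T \<inter> T')"
              using T' fT card_Diff_subset_Int[of T' T] by (simp add: Int_commute)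
            then show "(T \<inter> T', T' - T) \<in> Pow T \<times> ?W"
              using T' by auto
          qed
          show "finite (Pow T \<times> ?W)" using fT finite_subsets_card by auto
        qed
        also have "\<dots> = 2 ^ r * (m choose (r - s))"
          using fT by (simp add: card_cartesian_product card_Pow n_subsets)
        also have "\<dots> \<le> 2 ^ r * m ^ (r - s)"
          using m rs by (intro mult_left_mono binomial_le_pow) auto
        finally have "real (card {T'\<in>?\<T>. card (T \<inter> T') = s}) \<le> real (2 ^ r * m ^ (r - s))"
          by (rule of_nat_mono)
        then have cnt: "real (card {T'\<in>?\<T>. card (T \<inter> T') = s}) \<le> 2 ^ r * real m ^ (r - s)"
          by (simp only: of_nat_mult of_nat_power of_nat_numeral)
        have \<rho>s: "\<rho> ^ s \<le> y * (real m ^ s * b ^ (2 * s))"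
        proof -
          have "\<rho> ^ s \<le> (y * (real m * b\<^sup>2)) ^ s" using y \<rho>0 by (intro power_mono) auto
          also have "\<dots> = y ^ s * (real m ^ s * b ^ (2 * s))"
            by (simp add: power_mult_distrib power_mult)
          also have "\<dots> \<le> y ^ 1 * (real m ^ s * b ^ (2 * s))"
            using rs y y0 b by (intro mult_right_mono power_decreasing) auto
          finally show ?thesis by simp
        qed
        \<comment> \<open>This returns from the crude count m^r to the binomial coefficient of the
          main term and is the origin of the factor r^r.\<close>
        have mr: "real m ^ r \<le> real r ^ r * real (m choose r)"
        proof -
          have "(real m / real r) ^ r \<le> real (m choose r)"
            using m rs by (intro binomial_ge_n_over_k_pow_k) auto
          then show ?thesis using rs by (simp add: power_divide field_simps)
        qed
        have "real (card {T'\<in>?\<T>. card (T \<inter> T') = s}) * f s \<le>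
           (2 ^ r * real m ^ (r - s)) * (z ^ (m - 2 * r) * ((y * (real m ^ s * b ^ (2 * s))) * b ^ (2 * (r - s))))"
          unfolding f_def using z0 b \<rho>0 y0
          by (intro mult_mono cnt mult_left_mono mult_right_mono \<rho>s) auto
        also have "\<dots> = 2 ^ r * (real m ^ (r - s) * real m ^ s) * (z ^ (m - 2 * r) * y * (b ^ (2 * s) * b ^ (2 * (r - s))))"
          by (simp add: mult_ac)
        also have "real m ^ (r - s) * real m ^ s = real m ^ r" using rs by (simp flip: power_add)
        also have "b ^ (2 * s) * b ^ (2 * (r - s)) = b ^ (2 * r)"
          using rs by (simp flip: power_add add: algebra_simps)
        also have "2 ^ r * real m ^ r * (z ^ (m - 2 * r) * y * b ^ (2 * r)) \<le>
          2 ^ r * (real r ^ r * real (m choose r)) * (z ^ (m - 2 * r) * y * b ^ (2 * r))"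
          using z0 y0 b by (intro mult_right_mono mult_left_mono mr) auto
        also have "\<dots> = Z * ((2 * real r) ^ r * y)"
          by (simp add: Z_def power_mult_distrib mult_ac)
        finally show ?thesis using False by simp
      qed
    qed
    also have "\<dots> = Z + (\<Sum>s\<in>{..r} - {0}. Z * ((2 * real r) ^ r * y))"
      by (subst sum.remove[of _ 0]) (auto intro!: sum.cong)
    also have "\<dots> = Z * (1 + real r * (2 * real r) ^ r * y)"
      by (simp add: card_Diff_subset algebra_simps)
    finally show ?thesis .
  qed
  have "pick r B1 B0 \<inter> pick r C1 C0 = (\<Union>T\<in>?\<T>. \<Union>T'\<in>?\<T>. ?F T \<inter> ?H T')"
    by (auto simp: pick_eq)
  then have "measure P (pick r B1 B0 \<inter> pick r C1 C0) \<le> (\<Sum>T\<in>?\<T>. measure P (\<Union>T'\<in>?\<T>. ?F T \<inter> ?H T'))"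
    by (simp only:) (intro measure_UNION_le finite_subsets_card, simp add: sets_P)
  also have "\<dots> \<le> (\<Sum>T\<in>?\<T>. \<Sum>T'\<in>?\<T>. measure P (?F T \<inter> ?H T'))"
    by (intro sum_mono measure_UNION_le finite_subsets_card) (simp add: sets_P)
  also have "\<dots> \<le> (\<Sum>T\<in>?\<T>. \<Sum>T'\<in>?\<T>. f (card (T \<inter> T')))"
    by (intro sum_mono one)
  also have "\<dots> \<le> (\<Sum>T\<in>?\<T>. Z * (1 + real r * (2 * real r) ^ r * y))"
    by (intro sum_mono inner)
  also have "\<dots> = real (m choose r) * (Z * (1 + real r * (2 * real r) ^ r * y))"
    by (simp add: n_subsets)
  finally show ?thesis by (simp add: Z_def power2_eq_square mult_ac)
qed

end

section \<open>The law of a community\<close>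

definition community_law :: "(nat \<times> real) measure \<Rightarrow> nat \<Rightarrow> nat graph measure" where
  "community_law D n = D \<bind> (\<lambda>xq. measure_pmf (community_pmf n xq))"

lemma community_kernel:
  assumes "sets D = sets (count_space UNIV \<Otimes>\<^sub>M borel)"
  shows "(\<lambda>xq. measure_pmf (community_pmf n xq)) \<in> measurable D (subprob_algebra (count_space UNIV))"
  using measurable_community[of n] measurable_cong_sets[OF assms refl] by blast

lemma iid_communities:
  assumes D: "sets D = sets (count_space UNIV \<Otimes>\<^sub>M borel)" and "prob_space D"
  shows "iid_family (communities D n m) (community_law D n) m"
proof -
  interpret D: prob_space D by fact
  interpret P: prob_space "communities D n m" by (rule prob_space_communities[OF assms])
  interpret N: prob_space "community_law D n"
    unfolding community_law_def
    by (rule D.prob_space_bind[OF _ community_kernel[OF D]]) (auto intro: measure_pmf.prob_space_axioms)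
  show ?thesis
  proof
    show "sets (communities D n m) = UNIV" by (rule sets_communities[OF assms])
    show "sets (community_law D n) = UNIV"
      unfolding community_law_def
      by (subst sets_bind[OF sets_kernel[OF community_kernel[OF D]]]) (use D.not_empty in simp_all)
    show "measure (communities D n m) {G. \<forall>i\<in>{1..m}. G i \<in> A i} =
        (\<Prod>i\<in>{1..m}. measure (community_law D n) (A i))" for A
      using communities_indep[OF assms, where A = A and n = n and m = m]
      by (simp add: community_law_def[symmetric] P.emeasure_eq_measure N.emeasure_eq_measure
          prod_ennreal prod_nonneg)
  qed
qed

text \<open>As X takes countably many values, measurability may be checked with X frozen, also where
  X occurs in an exponent.\<close>

lemma measurable_nat_param:
  fixes X :: "'a \<Rightarrow> nat"
  assumes "X \<in> measurable M (count_space UNIV)" "\<And>x. f x \<in> borel_measurable M"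
  shows "(\<lambda>\<omega>. f (X \<omega>) \<omega>) \<in> borel_measurable M"
  using assms(2,1) by (rule measurable_compose_countable)

locale community_model = prob_space M for M :: "'a measure" +
  fixes X :: "'a \<Rightarrow> nat" and Q :: "'a \<Rightarrow> real"
  assumes X_meas: "X \<in> measurable M (count_space UNIV)"
    and Q_meas: "Q \<in> borel_measurable M"
    and Q_bounds: "\<And>\<omega>. \<omega> \<in> space M \<Longrightarrow> 0 \<le> Q \<omega> \<and> Q \<omega> \<le> 1"
    and log_moment: "integrable M (\<lambda>\<omega>. real (X \<omega>) * h (X \<omega>) (Q \<omega>) * ln (1 + real (X \<omega>)))"
begin

abbreviation "D \<equiv> XQ_law M X Q"
abbreviation "\<nu> n \<equiv> community_law D n"
abbreviation "\<kappa> \<equiv> kappa M X Q"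
abbreviation "\<alpha> \<equiv> alpha M X Q"
abbreviation "\<tau> \<equiv> tau M X Q"

definition Xh :: "'a \<Rightarrow> real" where
  "Xh \<omega> = real (X \<omega>) * h (X \<omega>) (Q \<omega>)"

text \<open>The part of \<kappa> that may be lost. For |A| + k \<le> n^(1-\<epsilon>) it bounds the
  loss from communities meeting the relevant set more than once; for \<epsilon> = 1 it is n times a
  bound for the probability that one community has edges at two given vertices.\<close>

definition tail :: "real \<Rightarrow> nat \<Rightarrow> real" where
  "tail \<epsilon> n = expectation (\<lambda>\<omega>. Xh \<omega> * min 1 (real (X \<omega>) * real n powr - \<epsilon>))"

lemma XQ_meas: "(\<lambda>\<omega>. (X \<omega>, Q \<omega>)) \<in> measurable M (count_space UNIV \<Otimes>\<^sub>M borel)"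
  using X_meas Q_meas by simp

lemma sets_D: "sets D = sets (count_space UNIV \<Otimes>\<^sub>M borel)"
  by (simp add: XQ_law_def)

lemma prob_space_D: "prob_space D"
  unfolding XQ_law_def by (rule prob_space_distr[OF XQ_meas])

lemma iid: "iid_family (communities D n m) (\<nu> n) m"
  by (rule iid_communities[OF sets_D prob_space_D])

lemma prob_space_\<nu>: "prob_space (\<nu> n)"
  using iid[of n 0] by (simp add: iid_family_def)

lemma sets_\<nu>: "sets (\<nu> n) = UNIV"
  using iid_family.sets_\<nu>[OF iid] .

lemma integrable_community:
  "integrable M (\<lambda>\<omega>. measure_pmf.prob (community_pmf n (X \<omega>, Q \<omega>)) E)"
proof (rule integrable_const_bound[where B = 1])
  have "(\<lambda>xq. emeasure (measure_pmf (community_pmf n xq)) E) \<in> borel_measurable (count_space UNIV \<Otimes>\<^sub>M borel)"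
    by (rule measurable_emeasure_kernel[OF measurable_community]) auto
  then have "(\<lambda>xq. measure_pmf.prob (community_pmf n xq) E) \<in> borel_measurable (count_space UNIV \<Otimes>\<^sub>M borel)"
    unfolding measure_def by (rule measurable_compose) simp
  from measurable_compose[OF XQ_meas this]
  show "(\<lambda>\<omega>. measure_pmf.prob (community_pmf n (X \<omega>, Q \<omega>)) E) \<in> borel_measurable M" by simp
qed simp

lemma law_eq:
  "measure (\<nu> n) E = expectation (\<lambda>\<omega>. measure_pmf.prob (community_pmf n (X \<omega>, Q \<omega>)) E)"
proof -
  interpret N: prob_space "\<nu> n" by (rule prob_space_\<nu>)
  interpret D: prob_space D by (rule prob_space_D)
  have "emeasure (\<nu> n) E = (\<integral>\<^sup>+xq. emeasure (measure_pmf (community_pmf n xq)) E \<partial>D)"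
    unfolding community_law_def
    by (rule emeasure_bind[OF D.not_empty community_kernel[OF sets_D]]) auto
  also have "\<dots> = (\<integral>\<^sup>+\<omega>. emeasure (measure_pmf (community_pmf n (X \<omega>, Q \<omega>))) E \<partial>M)"
    unfolding XQ_law_def
    by (rule nn_integral_distr[OF XQ_meas], subst measurable_distr_eq1)
       (rule measurable_emeasure_kernel[OF measurable_community], auto)
  also have "\<dots> = ennreal (expectation (\<lambda>\<omega>. measure_pmf.prob (community_pmf n (X \<omega>, Q \<omega>)) E))"
    unfolding measure_pmf.emeasure_eq_measure
    by (rule nn_integral_eq_integral[OF integrable_community]) auto
  finally show ?thesis by (simp add: N.emeasure_eq_measure integral_nonneg_AE)
qed

lemma h_meas: "(\<lambda>\<omega>. h (X \<omega>) (Q \<omega>)) \<in> borel_measurable M"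
  by (rule measurable_nat_param[OF X_meas]) (use Q_meas in \<open>simp add: h_def\<close>)

lemma X_real_meas: "(\<lambda>\<omega>. real (X \<omega>)) \<in> borel_measurable M"
  using X_meas by simp

lemma Xh_meas: "Xh \<in> borel_measurable M"
  unfolding Xh_def using h_meas X_real_meas by simp

lemma Xh_nonneg: "\<omega> \<in> space M \<Longrightarrow> 0 \<le> Xh \<omega>"
  using Q_bounds h_bounds by (simp add: Xh_def)

lemma Xh_log_integrable: "integrable M (\<lambda>\<omega>. Xh \<omega> * ln (1 + real (X \<omega>)))"
  using log_moment by (simp add: Xh_def)

lemma Xh_le_log: "\<omega> \<in> space M \<Longrightarrow> Xh \<omega> \<le> Xh \<omega> * ln (1 + real (X \<omega>)) / ln 2"
proof -
  assume \<omega>: "\<omega> \<in> space M"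
  show ?thesis
  proof (cases "X \<omega> = 0")
    case False
    then have "1 \<le> ln (1 + real (X \<omega>)) / ln 2" by simp
    from mult_left_mono[OF this Xh_nonneg[OF \<omega>]] show ?thesis by simp
  qed (simp add: Xh_def)
qed

lemma Xh_integrable: "integrable M Xh"
proof (rule Bochner_Integration.integrable_bound)
  show "integrable M (\<lambda>\<omega>. Xh \<omega> * ln (1 + real (X \<omega>)) / ln 2)"
    using Xh_log_integrable by simp
  show "AE \<omega> in M. norm (Xh \<omega>) \<le> norm (Xh \<omega> * ln (1 + real (X \<omega>)) / ln 2)"
    using Xh_le_log Xh_nonneg by (intro AE_I2) (simp add: abs_of_nonneg order_trans)
qed (rule Xh_meas)

lemma kappa_eq: "\<kappa> = expectation Xh"
  by (simp add: kappa_def Xh_def[abs_def])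

lemma kappa_nonneg: "0 \<le> \<kappa>"
  unfolding kappa_eq using Xh_nonneg by (intro integral_nonneg_AE AE_I2)

section \<open>Decay of the tail of the logarithmic moment\<close>

lemma tail_integrable: "integrable M (\<lambda>\<omega>. Xh \<omega> * min 1 (real (X \<omega>) * real n powr - \<epsilon>))"
proof (rule Bochner_Integration.integrable_bound[OF Xh_integrable])
  show "(\<lambda>\<omega>. Xh \<omega> * min 1 (real (X \<omega>) * real n powr - \<epsilon>)) \<in> borel_measurable M"
    using Xh_meas X_real_meas by simp
  show "AE \<omega> in M. norm (Xh \<omega> * min 1 (real (X \<omega>) * real n powr - \<epsilon>)) \<le> norm (Xh \<omega>)"
    by (intro AE_I2) (simp add: abs_mult mult_left_le)
qed

lemma tail_nonneg: "0 \<le> tail \<epsilon> n"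
  unfolding tail_def using Xh_nonneg by (intro integral_nonneg_AE AE_I2) simp

text \<open>Split at x = n^(\<epsilon>/2). Above, ln n is at most (2/\<epsilon>) ln(1+x); below, the
  minimum is at most n^(-\<epsilon>/2), which beats ln n up to 2/\<epsilon>. The factor 1/ln 2
  covers the second case, where only ln(1+x) \<ge> ln 2 is available. The right-hand side does not
  depend on n and serves for dominated convergence.\<close>

lemma ln_times_min_le:
  fixes x n :: nat
  assumes \<epsilon>: "\<epsilon> > 0" and n: "n \<ge> 1"
  shows "ln (real n) * min 1 (real x * real n powr - \<epsilon>) \<le> 2 / (\<epsilon> * ln 2) * ln (1 + real x)"
proof (cases "x = 0")
  case False
  have ln2: "ln 2 \<le> (1::real)" using ln_2_less_1 by simp
  have l0: "0 \<le> ln (real n)" using n by simp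
  have lx: "ln 2 \<le> ln (1 + real x)" using False by simp
  have npos: "real n powr (\<epsilon> / 2) > 0" using n by simp
  have lnn: "ln (real n) \<le> 2 / \<epsilon> * real n powr (\<epsilon> / 2)"
  proof -
    have "\<epsilon> / 2 * ln (real n) = ln (real n powr (\<epsilon> / 2))" using n by (simp add: ln_powr)
    also have "\<dots> \<le> real n powr (\<epsilon> / 2)" using npos ln_le_minus_one[of "real n powr (\<epsilon> / 2)"] by linarith
    finally show ?thesis using \<epsilon> by (simp add: field_simps)
  qed
  show ?thesis
  proof (cases "real x \<ge> real n powr (\<epsilon> / 2)")
    case True
    have "\<epsilon> / 2 * ln (real n) = ln (real n powr (\<epsilon> / 2))" using n by (simp add: ln_powr)
    also have "\<dots> \<le> ln (1 + real x)" using True npos by (subst ln_le_cancel_iff) auto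
    finally have "ln (real n) \<le> 2 / \<epsilon> * ln (1 + real x)" using \<epsilon> by (simp add: field_simps)
    also have "\<dots> \<le> 2 / (\<epsilon> * ln 2) * ln (1 + real x)"
      using \<epsilon> ln2 lx by (intro mult_right_mono divide_left_mono) (auto simp: mult_left_le)
    finally show ?thesis using l0 mult_left_le[of "min 1 (real x * real n powr - \<epsilon>)" "ln (real n)"] by simp
  next
    case False
    have "ln (real n) * min 1 (real x * real n powr - \<epsilon>) \<le> ln (real n) * (real n powr (\<epsilon> / 2) * real n powr - \<epsilon>)"
      using l0 False by (intro mult_left_mono min.coboundedI2 mult_right_mono) auto
    also have "real n powr (\<epsilon> / 2) * real n powr - \<epsilon> = 1 / real n powr (\<epsilon> / 2)"
      using n by (simp flip: powr_add add: powr_minus_divide[symmetric])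
    also have "ln (real n) * (1 / real n powr (\<epsilon> / 2)) \<le> 2 / \<epsilon>"
      using lnn npos by (simp add: divide_le_eq)
    also have "\<dots> = 2 / (\<epsilon> * ln 2) * ln 2" by simp
    also have "\<dots> \<le> 2 / (\<epsilon> * ln 2) * ln (1 + real x)"
      using lx \<epsilon> by (intro mult_left_mono) auto
    finally show ?thesis .
  qed
qed simp

lemma tail_log_limit:
  assumes \<epsilon>: "\<epsilon> > 0"
  shows "(\<lambda>n. ln (real n) * tail \<epsilon> n) \<longlonglongrightarrow> 0"
proof -
  let ?f = "\<lambda>n \<omega>. ln (real n) * (Xh \<omega> * min 1 (real (X \<omega>) * real n powr - \<epsilon>))"
  let ?w = "\<lambda>\<omega>. 2 / (\<epsilon> * ln 2) * (Xh \<omega> * ln (1 + real (X \<omega>)))"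
  \<comment> \<open>Shifted by one because the dominating bound needs n \<ge> 1.\<close>
  have "(\<lambda>n. expectation (?f (n + 1))) \<longlonglongrightarrow> expectation (\<lambda>\<omega>. 0)"
  proof (rule integral_dominated_convergence[where w = ?w])
    show "integrable M ?w" using Xh_log_integrable by simp
    show "?f (n + 1) \<in> borel_measurable M" for n
      using borel_measurable_integrable[OF tail_integrable[of "n + 1" \<epsilon>]]
      by (intro borel_measurable_times[OF borel_measurable_const])
    show "AE \<omega> in M. (\<lambda>n. ?f (n + 1) \<omega>) \<longlonglongrightarrow> 0"
    proof (intro AE_I2)
      fix \<omega>
      have "(\<lambda>n. Xh \<omega> * (ln (real (n + 1)) * min 1 (real (X \<omega>) * real (n + 1) powr - \<epsilon>))) \<longlonglongrightarrow> Xh \<omega> * 0"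
      proof (rule tendsto_mult_left)
        have up: "(\<lambda>n. ln (real (n + 1)) * (real (X \<omega>) * real (n + 1) powr - \<epsilon>)) \<longlonglongrightarrow> 0"
          using \<epsilon> by real_asymp
        show "(\<lambda>n. ln (real (n + 1)) * min 1 (real (X \<omega>) * real (n + 1) powr - \<epsilon>)) \<longlonglongrightarrow> 0"
          by (rule tendsto_sandwich[OF _ _ tendsto_const up]) (auto intro!: always_eventually mult_left_mono)
      qed
      then show "(\<lambda>n. ?f (n + 1) \<omega>) \<longlonglongrightarrow> 0" by (simp add: mult_ac)
    qed
    show "AE \<omega> in M. norm (?f (n + 1) \<omega>) \<le> ?w \<omega>" for n
    proof (intro AE_I2)
      fix \<omega> assume \<omega>: "\<omega> \<in> space M"
      have "norm (?f (n + 1) \<omega>) = Xh \<omega> * (ln (real (n + 1)) * min 1 (real (X \<omega>) * real (n + 1) powr - \<epsilon>))"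
        using Xh_nonneg[OF \<omega>] by (simp add: abs_mult)
      also have "\<dots> \<le> Xh \<omega> * (2 / (\<epsilon> * ln 2) * ln (1 + real (X \<omega>)))"
        by (intro mult_left_mono ln_times_min_le Xh_nonneg \<omega> \<epsilon>) simp
      finally show "norm (?f (n + 1) \<omega>) \<le> ?w \<omega>" by (simp add: mult_ac)
    qed
  qed simp_all
  moreover have "expectation (?f (n + 1)) = ln (real (n + 1)) * tail \<epsilon> (n + 1)" for n
    unfolding tail_def by simp
  ultimately have "(\<lambda>n. ln (real (n + 1)) * tail \<epsilon> (n + 1)) \<longlonglongrightarrow> 0"
    by (simp only: Bochner_Integration.integral_zero)
  then show ?thesis by (rule LIMSEQ_offset)
qed

section \<open>Averaged probabilities for one community\<close>

definition p0 :: "nat \<Rightarrow> real" where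
  "p0 n = expectation (\<lambda>\<omega>. real (min (X \<omega>) n) / real n * h (min (X \<omega>) n) (Q \<omega>))"

definition p1 :: "nat \<Rightarrow> real" where
  "p1 n = expectation (\<lambda>\<omega>. real (min (X \<omega>) n) / real n *
     ((real (min (X \<omega>) n) - 1) * Q \<omega> * (1 - Q \<omega>) ^ (min (X \<omega>) n - 2)))"

lemma law_nonisolated:
  assumes "v \<in> {1..n}"
  shows "measure (\<nu> n) {g. incident (snd g) v \<noteq> {}} = p0 n"
  unfolding law_eq p0_def
  using assms Q_bounds
  by (intro Bochner_Integration.integral_cong refl prob_community_nonisolated) auto

lemma law_degree_one:
  assumes "v \<in> {1..n}"
  shows "measure (\<nu> n) {g. card (incident (snd g) v) = 1} = p1 n"
  unfolding law_eq p1_def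
  using assms Q_bounds
  by (intro Bochner_Integration.integral_cong refl prob_community_degree_one) auto

lemma truncated_Xh:
  assumes "\<omega> \<in> space M"
  shows "0 \<le> real (min (X \<omega>) n) * h (min (X \<omega>) n) (Q \<omega>)"
    and "real (min (X \<omega>) n) * h (min (X \<omega>) n) (Q \<omega>) \<le> Xh \<omega>"
  using Q_bounds[OF assms] h_bounds(1)[of "Q \<omega>" "min (X \<omega>) n"]
  by (auto simp: Xh_def intro!: mult_mono h_mono mult_nonneg_nonneg simp del: mult_eq_0_iff)

lemma p0_le:
  assumes "n \<ge> 1"
  shows "p0 n \<le> \<kappa> / real n"
proof -
  have "p0 n \<le> expectation (\<lambda>\<omega>. Xh \<omega> / real n)"
    unfolding p0_def
  proof (rule integral_mono')
    show "integrable M (\<lambda>\<omega>. Xh \<omega> / real n)" using Xh_integrable by simp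
    fix \<omega> assume \<omega>: "\<omega> \<in> space M"
    show "real (min (X \<omega>) n) / real n * h (min (X \<omega>) n) (Q \<omega>) \<le> Xh \<omega> / real n"
      using divide_right_mono[OF truncated_Xh(2)[OF \<omega>], of "real n" n] by simp
    show "0 \<le> Xh \<omega> / real n" using Xh_nonneg[OF \<omega>] by simp
  qed
  then show ?thesis by (simp add: kappa_eq)
qed

text \<open>The size condition gives (|A| + k)/n \<le> n^(-\<epsilon>), so averaging the expansion
  bound over (X, Q) yields |A|/n times \<kappa> minus the tail.\<close>

lemma law_expand_small:
  assumes A: "A \<subseteq> {1..n}" and B: "B \<subseteq> {1..n}" "card B < k"
    and small: "real (card A + k) \<le> real n powr (1 - \<epsilon>)" and \<epsilon>: "\<epsilon> \<le> 1" and n: "n \<ge> 1"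
  shows "measure (\<nu> n) {g. nb n (snd g) A \<subseteq> B} \<le> 1 - real (card A) / real n * (\<kappa> - tail \<epsilon> n)"
proof -
  interpret N: prob_space "\<nu> n" by (rule prob_space_\<nu>)
  have "real (card A) / real n * (\<kappa> - tail \<epsilon> n) =
     expectation (\<lambda>\<omega>. real (card A) / real n * (Xh \<omega> - Xh \<omega> * min 1 (real (X \<omega>) * real n powr - \<epsilon>)))"
    unfolding kappa_eq tail_def using Xh_integrable tail_integrable
    by (subst integral_mult_right_zero, subst Bochner_Integration.integral_diff) auto
  also have "\<dots> \<le> measure (\<nu> n) {g. \<not> nb n (snd g) A \<subseteq> B}"
    unfolding law_eq
  proof (rule integral_mono)
    show "integrable M (\<lambda>\<omega>. real (card A) / real n * (Xh \<omega> - Xh \<omega> * min 1 (real (X \<omega>) * real n powr - \<epsilon>)))"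
      using Xh_integrable tail_integrable by auto
    fix \<omega> assume \<omega>: "\<omega> \<in> space M"
    let ?j = "min (X \<omega>) n"
    have "Xh \<omega> - Xh \<omega> * min 1 (real (X \<omega>) * real n powr - \<epsilon>) \<le>
      real ?j * h ?j (Q \<omega>) * (1 - min 1 ((real (card A) + real k) * real ?j / real n))"
    proof (cases "X \<omega> \<le> n")
      case True
      have "(real (card A) + real k) / real n \<le> real n powr (1 - \<epsilon>) / real n"
        using small by (intro divide_right_mono) auto
      also have "\<dots> = real n powr - \<epsilon>" using n by (simp add: powr_diff powr_minus_divide)
      finally have "(real (card A) + real k) * real (X \<omega>) / real n \<le> real (X \<omega>) * real n powr - \<epsilon>"
        using mult_right_mono[of _ _ "real (X \<omega>)"] by (fastforce simp: mult.commute)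
      then have "Xh \<omega> * (1 - min 1 (real (X \<omega>) * real n powr - \<epsilon>)) \<le>
         Xh \<omega> * (1 - min 1 ((real (card A) + real k) * real (X \<omega>) / real n))"
        by (intro mult_left_mono Xh_nonneg \<omega>) auto
      then show ?thesis using True by (simp add: Xh_def right_diff_distrib)
    next
      \<comment> \<open>For X > n the cut-off is inactive: X n^(-\<epsilon>) \<ge> n^(1-\<epsilon>)
        \<ge> 1, so the left side is 0 and nothing has to be known about the truncated
        community.\<close>
      case False
      have "1 = real n powr 0" using n by simp
      also have "\<dots> \<le> real n powr (1 - \<epsilon>)" using n \<epsilon> by (intro powr_mono) auto
      also have "\<dots> = real n * real n powr - \<epsilon>" using n by (simp add: powr_diff powr_minus_divide)
      also have "\<dots> \<le> real (X \<omega>) * real n powr - \<epsilon>" using False by (intro mult_right_mono) auto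
      finally have "min 1 (real (X \<omega>) * real n powr - \<epsilon>) = 1" by simp
      moreover have "0 \<le> real ?j * h ?j (Q \<omega>) * (1 - min 1 ((real (card A) + real k) * real ?j / real n))"
        by (intro mult_nonneg_nonneg[OF truncated_Xh(1)[OF \<omega>]]) auto
      ultimately show ?thesis by simp
    qed
    from mult_left_mono[OF this, of "real (card A) / real n"]
    show "real (card A) / real n * (Xh \<omega> - Xh \<omega> * min 1 (real (X \<omega>) * real n powr - \<epsilon>)) \<le>
       measure_pmf.prob (community_pmf n (X \<omega>, Q \<omega>)) {g. \<not> nb n (snd g) A \<subseteq> B}"
      using prob_community_expand_small[OF _ _ A B, of "Q \<omega>" "X \<omega>"] Q_bounds[OF \<omega>] by simp
  qed (rule integrable_community)
  also have "{g. \<not> nb n (snd g) A \<subseteq> B} = space (\<nu> n) - {g. nb n (snd g) A \<subseteq> B}"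
    using sets_eq_imp_space_eq[of "\<nu> n" "count_space UNIV"] sets_\<nu> by auto
  also have "measure (\<nu> n) \<dots> = 1 - measure (\<nu> n) {g. nb n (snd g) A \<subseteq> B}"
    by (rule N.prob_compl) (simp add: sets_\<nu>)
  finally show ?thesis by simp
qed

lemma law_both_nonisolated:
  assumes uv: "u \<in> {1..n}" "v \<in> {1..n}" "u \<noteq> v"
  shows "measure (\<nu> n) {g. incident (snd g) u \<noteq> {} \<and> incident (snd g) v \<noteq> {}} \<le> tail 1 n / real n"
proof -
  have n: "n \<ge> 1" using uv by auto
  have "measure (\<nu> n) {g. incident (snd g) u \<noteq> {} \<and> incident (snd g) v \<noteq> {}} \<le>
      expectation (\<lambda>\<omega>. Xh \<omega> * min 1 (real (X \<omega>) * real n powr - 1) / real n)"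
    unfolding law_eq
  proof (rule integral_mono[OF integrable_community])
    show "integrable M (\<lambda>\<omega>. Xh \<omega> * min 1 (real (X \<omega>) * real n powr - 1) / real n)"
      by (intro integrable_divide_zero tail_integrable)
    fix \<omega> assume \<omega>: "\<omega> \<in> space M"
    let ?j = "min (X \<omega>) n"
    have "measure_pmf.prob (community_pmf n (X \<omega>, Q \<omega>))
        {g. incident (snd g) u \<noteq> {} \<and> incident (snd g) v \<noteq> {}} \<le> (real ?j / real n)\<^sup>2 * h ?j (Q \<omega>)"
      using Q_bounds[OF \<omega>] by (intro prob_community_both_nonisolated uv) auto
    also have "\<dots> = real ?j * h ?j (Q \<omega>) * (real ?j / real n) / real n"
      by (simp add: power2_eq_square)
    also have "\<dots> \<le> Xh \<omega> * (real ?j / real n) / real n"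
      by (intro divide_right_mono mult_right_mono truncated_Xh(2) \<omega>) auto
    also have "real ?j / real n = min 1 (real (X \<omega>) * real n powr - 1)"
      using n by (auto simp: powr_minus_divide min_def field_simps)
    finally show "measure_pmf.prob (community_pmf n (X \<omega>, Q \<omega>))
        {g. incident (snd g) u \<noteq> {} \<and> incident (snd g) v \<noteq> {}} \<le>
       Xh \<omega> * min 1 (real (X \<omega>) * real n powr - 1) / real n" .
  qed
  then show ?thesis by (simp add: tail_def)
qed

lemma alpha_nonneg: "0 \<le> \<alpha>"
  unfolding alpha_def using Q_bounds by (intro integral_nonneg_AE AE_I2) (auto simp: indicator_def)

lemma alpha_integrable: "integrable M (\<lambda>\<omega>. Q \<omega> * indicator {\<omega>. X \<omega> \<ge> 2} \<omega>)"
proof (rule integrable_const_bound[where B = 1])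
  show "AE \<omega> in M. norm (Q \<omega> * indicator {\<omega>. X \<omega> \<ge> 2} \<omega>) \<le> 1"
    using Q_bounds by (intro AE_I2) (auto simp: indicator_def)
  have "(\<lambda>\<omega>. (\<lambda>x \<omega>. Q \<omega> * (if x \<ge> 2 then 1 else 0)) (X \<omega>) \<omega>) \<in> borel_measurable M"
    by (rule measurable_nat_param[OF X_meas]) (use Q_meas in simp)
  moreover have "(\<lambda>\<omega>. (\<lambda>x \<omega>. Q \<omega> * (if x \<ge> 2 then 1 else 0)) (X \<omega>) \<omega>) =
      (\<lambda>\<omega>. Q \<omega> * indicator {\<omega>. X \<omega> \<ge> 2} \<omega>)"
    by (auto simp: indicator_def fun_eq_iff)
  ultimately show "(\<lambda>\<omega>. Q \<omega> * indicator {\<omega>. X \<omega> \<ge> 2} \<omega>) \<in> borel_measurable M"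
    by (simp only:)
qed

text \<open>Applied to the set \<open>C\<close> of vertices outside \<open>A\<close> and
  \<open>B\<close>, which has at least n - |A| - k elements; an edge from A into \<open>C\<close>
  yields a neighbour outside \<open>B\<close>.\<close>

lemma law_expand_large:
  assumes A: "A \<subseteq> {1..n}" and B: "B \<subseteq> {1..n}" "card B < k" and n: "n \<ge> 2"
  shows "measure (\<nu> n) {g. nb n (snd g) A \<subseteq> B} \<le>
    1 - \<alpha> * real (card A) * (real n - real (card A) - real k) / (real n)\<^sup>2"
proof -
  interpret N: prob_space "\<nu> n" by (rule prob_space_\<nu>)
  define C where "C = {1..n} - A - B"
  have fin: "finite A" using A finite_subset by blast
  have "n = card {1..n}" by simp
  also have "\<dots> \<le> card (C \<union> (A \<union> B))"
    using fin finite_subset[OF B(1)] by (intro card_mono) (auto simp: C_def)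
  also have "\<dots> \<le> card C + (card A + card B)"
    by (meson card_Un_le add_left_mono order_trans)
  finally have cC: "real n - real (card A) - real k \<le> real (card C)" using B by linarith
  have "\<alpha> * real (card A) * (real n - real (card A) - real k) / (real n)\<^sup>2 \<le>
     \<alpha> * real (card A) * real (card C) / (real n)\<^sup>2"
    using cC alpha_nonneg by (intro divide_right_mono mult_left_mono) auto
  also have "\<dots> = expectation (\<lambda>\<omega>. Q \<omega> * indicator {\<omega>. X \<omega> \<ge> 2} \<omega> * real (card A) * real (card C) / (real n)\<^sup>2)"
    unfolding alpha_def by simp
  also have "\<dots> \<le> measure (\<nu> n) {g. \<not> nb n (snd g) A \<subseteq> {1..n} - C}"
    unfolding law_eq
  proof (rule integral_mono[OF _ integrable_community])
    show "integrable M (\<lambda>\<omega>. Q \<omega> * indicator {\<omega>. X \<omega> \<ge> 2} \<omega> * real (card A) * real (card C) / (real n)\<^sup>2)"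
      using alpha_integrable by auto
    fix \<omega> assume \<omega>: "\<omega> \<in> space M"
    show "Q \<omega> * indicator {\<omega>. X \<omega> \<ge> 2} \<omega> * real (card A) * real (card C) / (real n)\<^sup>2 \<le>
       measure_pmf.prob (community_pmf n (X \<omega>, Q \<omega>)) {g. \<not> nb n (snd g) A \<subseteq> {1..n} - C}"
    proof (cases "X \<omega> \<ge> 2")
      case True
      then show ?thesis
        using prob_community_expand_large[OF _ _ A, of "Q \<omega>" "X \<omega>" C] Q_bounds[OF \<omega>] n
        by (auto simp: C_def)
    qed simp
  qed
  also have "{g. \<not> nb n (snd g) A \<subseteq> {1..n} - C} = space (\<nu> n) - {g. nb n (snd g) A \<subseteq> {1..n} - C}"
    using sets_eq_imp_space_eq[of "\<nu> n" "count_space UNIV"] sets_\<nu> by auto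
  also have "measure (\<nu> n) \<dots> = 1 - measure (\<nu> n) {g. nb n (snd g) A \<subseteq> {1..n} - C}"
    by (rule N.prob_compl) (simp add: sets_\<nu>)
  also have "\<dots> \<le> 1 - measure (\<nu> n) {g. nb n (snd g) A \<subseteq> B}"
    by (intro diff_left_mono N.finite_measure_mono) (auto simp: sets_\<nu> C_def nb_def)
  finally show ?thesis by simp
qed

lemma law_nb_nonempty:
  assumes A: "A \<subseteq> {1..n}" and n: "n \<ge> 1"
  shows "measure (\<nu> n) {g. nb n (snd g) A \<noteq> {}} \<le> real (card A) * \<kappa> / real n"
proof -
  interpret N: prob_space "\<nu> n" by (rule prob_space_\<nu>)
  have fin: "finite A" using A finite_subset by blast
  have "measure (\<nu> n) {g. nb n (snd g) A \<noteq> {}} \<le> measure (\<nu> n) (\<Union>v\<in>A. {g. incident (snd g) v \<noteq> {}})"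
    by (intro N.finite_measure_mono) (auto simp: sets_\<nu> nb_def incident_def)
  also have "\<dots> \<le> (\<Sum>v\<in>A. measure (\<nu> n) {g. incident (snd g) v \<noteq> {}})"
    using fin by (intro measure_UNION_le) (auto simp: sets_\<nu>)
  also have "\<dots> = (\<Sum>v\<in>A. p0 n)" using A by (intro sum.cong refl law_nonisolated) auto
  also have "\<dots> \<le> real (card A) * (\<kappa> / real n)"
    using mult_left_mono[OF p0_le[OF n], of "real (card A)"] by simp
  finally show ?thesis by simp
qed

text \<open>Both sides are probabilities for vertex 1 of a community on {1..x}, and degree one
  implies nonisolated. This supplies the dominating function \<open>Xh\<close> for the limit of n
  p1.\<close>

lemma degree_one_le_h:
  assumes "0 \<le> q" "q \<le> 1" "x \<ge> 1"
  shows "(real x - 1) * q * (1 - q) ^ (x - 2) \<le> h x q"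
proof -
  have "measure_pmf.prob (coin_edges {1..x} q) {E. card (incident E 1) = 1} \<le>
      measure_pmf.prob (coin_edges {1..x} q) {E. incident E 1 \<noteq> {}}"
    by (intro measure_pmf.finite_measure_mono) auto
  then show ?thesis
    using prob_coin_degree_one[of "{1..x}" q 1] prob_coin_nonisolated[of "{1..x}" q 1] assms by simp
qed

lemma p1_limit: "(\<lambda>n. real n * p1 n) \<longlonglongrightarrow> \<tau>"
proof -
  let ?f = "\<lambda>n \<omega>. real (min (X \<omega>) n) *
     ((real (min (X \<omega>) n) - 1) * Q \<omega> * (1 - Q \<omega>) ^ (min (X \<omega>) n - 2))"
  let ?g = "\<lambda>\<omega>. real (X \<omega>) * (real (X \<omega>) - 1) * Q \<omega> * (1 - Q \<omega>) ^ (X \<omega> - 2)"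
  have "(\<lambda>n. expectation (?f n)) \<longlonglongrightarrow> expectation ?g"
  proof (rule integral_dominated_convergence[where w = Xh])
    show "?g \<in> borel_measurable M"
      by (rule measurable_nat_param[OF X_meas]) (use Q_meas in simp)
    show "?f n \<in> borel_measurable M" for n
      by (rule measurable_nat_param[OF X_meas]) (use Q_meas in simp)
    show "AE \<omega> in M. (\<lambda>n. ?f n \<omega>) \<longlonglongrightarrow> ?g \<omega>"
    proof (intro AE_I2 tendsto_eventually)
      fix \<omega>
      show "\<forall>\<^sub>F n in sequentially. ?f n \<omega> = ?g \<omega>"
        using eventually_ge_at_top[of "X \<omega>"] by eventually_elim simp
    qed
    show "AE \<omega> in M. norm (?f n \<omega>) \<le> Xh \<omega>" for n
    proof (intro AE_I2)
      fix \<omega> assume \<omega>: "\<omega> \<in> space M"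
      let ?j = "min (X \<omega>) n"
      show "norm (?f n \<omega>) \<le> Xh \<omega>"
      proof (cases "?j = 0")
        case True
        then show ?thesis using Xh_nonneg[OF \<omega>] by simp
      next
        case False
        then have j: "?j \<ge> 1" by simp
        have "0 \<le> (real ?j - 1) * Q \<omega> * (1 - Q \<omega>) ^ (?j - 2)"
          using j Q_bounds[OF \<omega>] by (intro mult_nonneg_nonneg) auto
        then have "norm (?f n \<omega>) = real ?j * ((real ?j - 1) * Q \<omega> * (1 - Q \<omega>) ^ (?j - 2))"
          by (simp only: real_norm_def abs_of_nonneg mult_nonneg_nonneg of_nat_0_le_iff)
        also have "\<dots> \<le> real ?j * h ?j (Q \<omega>)"
          using Q_bounds[OF \<omega>] j by (intro mult_left_mono degree_one_le_h) auto
        also have "\<dots> \<le> Xh \<omega>" by (rule truncated_Xh(2)[OF \<omega>])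
        finally show ?thesis .
      qed
    qed
  qed (rule Xh_integrable)
  moreover have "expectation ?g = \<tau>" by (simp add: tau_def)
  moreover have "\<forall>\<^sub>F n in sequentially. expectation (?f n) = real n * p1 n"
    using eventually_gt_at_top[of 0]
  proof eventually_elim
    case (elim n)
    have "real n * p1 n = expectation (\<lambda>\<omega>. real n * (?f n \<omega> / real n))"
      unfolding p1_def by (subst integral_mult_right_zero) simp
    then show ?case using elim by simp
  qed
  ultimately show ?thesis using Lim_transform_eventually by fastforce
qed

end

section \<open>Probability bounds for a fixed number of vertices\<close>

lemma sum_power_over_fact_le_exp:
  fixes x :: real
  assumes "finite F" "0 \<le> x"
  shows "(\<Sum>i\<in>F. x ^ i / fact i) \<le> exp x"
proof -
  have "(\<Sum>i\<in>F. x ^ i / fact i) \<le> (\<Sum>i. x ^ i / fact i)"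
    using assms summable_exp[of x] by (intro sum_le_suminf) (auto simp: field_simps)
  also have "\<dots> = exp x" by (simp add: exp_def divide_inverse mult.commute scaleR_conv_of_real)
  finally show ?thesis .
qed

lemma power_le_fact_exp:
  fixes x :: real
  assumes "0 \<le> x"
  shows "x ^ i \<le> fact i * exp x"
  using sum_power_over_fact_le_exp[of "{i}" x] assms by (simp add: field_simps)

lemma binomial_le_power_over_fact: "real (n choose a) \<le> real n ^ a / fact a"
proof -
  have "real ((n choose a) * fact a) \<le> real (n ^ a)"
    using binomial_fact_pow by (rule of_nat_mono)
  then show ?thesis by (simp add: field_simps)
qed

lemma binomial_le_power: "real (m choose t) \<le> real m ^ t"
proof (cases "t \<le> m")
  case True
  then have "real (m choose t) \<le> real (m ^ t)" by (intro of_nat_mono binomial_le_pow)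
  then show ?thesis by simp
qed (simp add: binomial_eq_0)

lemma sum_over_subsets:
  fixes f :: "nat \<Rightarrow> real"
  shows "(\<Sum>A\<in>{A. A \<subseteq> {1..n} \<and> P (card A)}. f (card A)) = (\<Sum>a\<in>{a. a \<le> n \<and> P a}. real (n choose a) * f a)"
proof -
  let ?S = "{A. A \<subseteq> {1..n} \<and> P (card A)}"
  have fin: "finite ?S" by (rule finite_subset[of _ "Pow {1..n}"]) auto
  have le: "card A \<le> n" if "A \<subseteq> {1..n}" for A
    using card_mono[OF _ that] by simp
  have "(\<Sum>A\<in>?S. f (card A)) = (\<Sum>a\<in>{a. a \<le> n \<and> P a}. \<Sum>A\<in>{A\<in>?S. card A = a}. f (card A))"
    using fin le by (intro sum.group[symmetric]) auto
  also have "\<dots> = (\<Sum>a\<in>{a. a \<le> n \<and> P a}. real (n choose a) * f a)"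
  proof (rule sum.cong)
    fix a assume "a \<in> {a. a \<le> n \<and> P a}"
    then have "{A\<in>?S. card A = a} = {A. A \<subseteq> {1..n} \<and> card A = a}" by auto
    then have "card {A\<in>?S. card A = a} = n choose a" by (simp add: n_subsets)
    then show "(\<Sum>A\<in>{A\<in>?S. card A = a}. f (card A)) = real (n choose a) * f a" by simp
  qed simp
  finally show ?thesis .
qed

text \<open>Vertex sets of linear or almost linear size: the entropy factor \<open>n choose a\<close> is at most
  \<open>n powr (2 * \<epsilon> * a)\<close>, the other factor at most \<open>n powr (- 4 * \<epsilon> * a)\<close> up to a power of \<open>n\<close>.\<close>

lemma large_set_term:
  fixes \<epsilon> \<beta> L :: real
  assumes n: "n \<ge> 1" and a: "1 \<le> a" "real n powr (1 - \<epsilon>) \<le> 2 * real a"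
    and \<epsilon>: "0 < \<epsilon>" "2 \<le> \<epsilon> * ln (real n)" "real k + 1 \<le> \<epsilon> * real a"
    and \<beta>: "4 * \<epsilon> * ln (real n) \<le> \<beta> * L" and m: "real m \<le> (real n)\<^sup>2"
  shows "real (n choose a) * (real k * real m ^ k * exp (- \<beta> * real a * L)) \<le> real k / (real n)\<^sup>2"
proof -
  let ?l = "ln (real n)"
  have l0: "0 \<le> ?l" using n by simp
  have "real n ^ a / fact a \<le> exp (real a) * (real n / real a) ^ a"
  proof -
    \<comment> \<open>Stirling's lower bound in the form a! \<ge> (a/e)^a, read off from one term of
      the exponential series.\<close>
    have "real a ^ a \<le> fact a * exp (real a)" by (rule power_le_fact_exp) simp
    then have "real n ^ a * real a ^ a \<le> real n ^ a * (fact a * exp (real a))" by (intro mult_left_mono) auto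
    then show ?thesis using a by (simp add: power_divide field_simps)
  qed
  also have "\<dots> \<le> exp (real a) * exp (1 + \<epsilon> * ?l) ^ a"
  proof (intro mult_left_mono power_mono)
    have "real n = real n powr (1 - \<epsilon>) * real n powr \<epsilon>" using n by (simp flip: powr_add)
    also have "\<dots> \<le> 2 * real a * real n powr \<epsilon>" using a by (intro mult_right_mono) auto
    finally have "real n / real a \<le> 2 * real n powr \<epsilon>" using a by (simp add: divide_le_eq mult_ac)
    also have "\<dots> \<le> exp 1 * real n powr \<epsilon>"
      using exp_ge_add_one_self[of 1] by (intro mult_right_mono) auto
    also have "\<dots> = exp (1 + \<epsilon> * ?l)" using n by (simp add: powr_def exp_add)
    finally show "real n / real a \<le> exp (1 + \<epsilon> * ?l)" .
  qed auto
  also have "\<dots> = exp (real a * (2 + \<epsilon> * ?l))"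
    by (simp add: exp_add[symmetric] exp_of_nat_mult[symmetric] algebra_simps)
  \<comment> \<open>The condition 2 \<le> \<epsilon> ln n absorbs the constant 2 into a second
    \<epsilon> ln n.\<close>
  also have "\<dots> \<le> exp (2 * \<epsilon> * ?l * real a)"
    using mult_left_mono[OF \<epsilon>(2), of "real a"] by (simp add: algebra_simps)
  finally have choose: "real (n choose a) \<le> exp (2 * \<epsilon> * ?l * real a)"
    using binomial_le_power_over_fact order_trans by blast
  have "exp (- \<beta> * real a * L) \<le> exp (- (4 * \<epsilon> * ?l * real a))"
    using mult_left_mono[OF \<beta>, of "real a"] by (simp add: algebra_simps)
  moreover have "real m ^ k \<le> ((real n)\<^sup>2) ^ k" using m by (intro power_mono) auto
  ultimately have "real (n choose a) * (real k * real m ^ k * exp (- \<beta> * real a * L)) \<le>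
     exp (2 * \<epsilon> * ?l * real a) * (real k * ((real n)\<^sup>2) ^ k * exp (- (4 * \<epsilon> * ?l * real a)))"
    using choose by (intro mult_mono mult_nonneg_nonneg) auto
  also have "\<dots> = real k * real n ^ (2 * k) * (exp (2 * \<epsilon> * ?l * real a) * exp (- (4 * \<epsilon> * ?l * real a)))"
    by (simp add: power_mult[symmetric] mult_ac)
  also have "exp (2 * \<epsilon> * ?l * real a) * exp (- (4 * \<epsilon> * ?l * real a)) = exp (- (2 * ?l * (\<epsilon> * real a)))"
    by (simp add: exp_add[symmetric])
  \<comment> \<open>Since \<epsilon> a \<ge> k + 1, the exponential is at most n^(-2k-2). It cancels
    n^(2k), the bound for m^k, and leaves n^(-2), which can still be summed over at most n values of
    a.\<close>
  also have "real k * real n ^ (2 * k) * \<dots> \<le> real k * real n ^ (2 * k) * exp (- (2 * ?l * (real k + 1)))"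
    using \<epsilon> l0 by (intro mult_left_mono) (auto intro!: mult_left_mono)
  also have "exp (- (2 * ?l * (real k + 1))) = 1 / real n ^ (2 * k + 2)"
  proof -
    have "2 * ?l * (real k + 1) = real (2 * k + 2) * ?l" by (simp add: algebra_simps)
    then have "exp (2 * ?l * (real k + 1)) = real n ^ (2 * k + 2)"
      using n by (simp only: exp_of_nat_mult) simp
    then show ?thesis by (simp add: exp_minus inverse_eq_divide)
  qed
  also have "real k * real n ^ (2 * k) * (1 / real n ^ (2 * k + 2)) = real k / (real n)\<^sup>2"
    using n by (simp add: power_add power2_eq_square)
  finally show ?thesis .
qed

section \<open>Failure of connectivity for fixed n and m\<close>

context community_model
begin

text \<open>With p = |A| \<kappa>/n, the t covering communities cost at most (|A| L \<kappa>)^t, and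
  the other m - t avoid new neighbours with probability at most exp(-|A| (\<kappa> - tail)/n) each.
  The condition L tail \<le> 1 turns the tail into a factor e^|A|.\<close>

lemma prob_few_neighbours_small:
  assumes A: "A \<subseteq> {1..n}" "A \<noteq> {}" and small: "real (card A + k) \<le> real n powr (1 - \<epsilon>)"
    and \<epsilon>: "\<epsilon> \<le> 1" and k: "1 \<le> k" "k \<le> m" and L: "L = real m / real n" "1 \<le> L" "L * tail \<epsilon> n \<le> 1"
  shows "measure (communities D n m) {G. card (\<Union>i\<in>{1..m}. nb n (snd (G i)) A) < k} \<le>
    real k * exp (\<kappa> * real k) * (\<kappa> + 1) ^ (k - 1) * (real (card A) * L) ^ (k - 1) * exp (1 - \<kappa> * L) ^ card A"
proof -
  interpret iid_family "communities D n m" "\<nu> n" m by (rule iid)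
  let ?a = "card A"
  have a: "1 \<le> ?a" "?a \<le> n"
    using A finite_subset[OF A(1)] card_mono[OF _ A(1)] by (auto simp: Suc_le_eq card_gt_0_iff)
  have n: "n \<ge> 1" using a by simp
  have mL: "real m = L * real n" using L n by simp
  define c where "c = real ?a / real n * (\<kappa> - tail \<epsilon> n)"
  have \<rho>: "measure (\<nu> n) {g. nb n (snd g) A \<subseteq> S} \<le> exp (- c)" if "S \<subseteq> {1..n}" "card S < k" for S
  proof -
    have "measure (\<nu> n) {g. nb n (snd g) A \<subseteq> S} \<le> 1 - c"
      unfolding c_def by (rule law_expand_small[OF A(1) that small \<epsilon> n])
    also have "\<dots> \<le> exp (- c)" using exp_ge_add_one_self[of "- c"] by simp
    finally show ?thesis .
  qed
  \<comment> \<open>Replacing \<kappa> by \<kappa> + 1 makes the base at least 1, so every exponent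
    t < k can be raised to k - 1.\<close>
  have base: "1 \<le> real ?a * L * (\<kappa> + 1)"
  proof -
    have "1 * 1 * 1 \<le> real ?a * L * (\<kappa> + 1)"
      using a L kappa_nonneg by (intro mult_mono) auto
    then show ?thesis by simp
  qed
  have "measure (communities D n m) {G. card (\<Union>i\<in>{1..m}. nb n (snd (G i)) A) < k} \<le>
     (\<Sum>t<k. real (m choose t) * (real ?a * \<kappa> / real n) ^ t * exp (- c) ^ (m - t))"
    using k by (intro prob_small_union[where U = "{1..n}"] law_nb_nonempty A n \<rho>) (auto simp: nb_def)
  also have "\<dots> \<le> (\<Sum>t<k. (real ?a * L * (\<kappa> + 1)) ^ (k - 1) * (exp (\<kappa> * real k) * exp (1 - \<kappa> * L) ^ ?a))"
  proof (intro sum_mono mult_mono)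
    fix t assume t: "t \<in> {..<k}"
    have "real (m choose t) * (real ?a * \<kappa> / real n) ^ t \<le> real m ^ t * (real ?a * \<kappa> / real n) ^ t"
      using kappa_nonneg by (intro mult_right_mono binomial_le_power) auto
    also have "\<dots> = (real ?a * L * \<kappa>) ^ t"
      using n by (simp add: mL power_mult_distrib[symmetric] mult_ac)
    also have "\<dots> \<le> (real ?a * L * (\<kappa> + 1)) ^ t"
      using kappa_nonneg L by (intro power_mono mult_left_mono) auto
    also have "\<dots> \<le> (real ?a * L * (\<kappa> + 1)) ^ (k - 1)"
      using t base by (intro power_increasing) auto
    finally show "real (m choose t) * (real ?a * \<kappa> / real n) ^ t \<le> (real ?a * L * (\<kappa> + 1)) ^ (k - 1)" .
    have r1: "real ?a / real n \<le> 1" using a n by (simp add: divide_le_eq)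
    \<comment> \<open>The t communities missing from the exponent m cost at most \<kappa> k, since t
      |A|/n \<le> k, and the tail costs at most |A|.\<close>
    have "real ?a * \<kappa> * L - \<kappa> * real k - real ?a \<le>
       real ?a * \<kappa> * L - real ?a / real n * (\<kappa> * real t) - real ?a * (L * tail \<epsilon> n)"
    proof -
      have "real ?a / real n * (\<kappa> * real t) \<le> 1 * (\<kappa> * real k)"
        using r1 t kappa_nonneg by (intro mult_mono) auto
      moreover have "real ?a * (L * tail \<epsilon> n) \<le> real ?a * 1" using L by (intro mult_left_mono) auto
      ultimately show ?thesis by simp
    qed
    also have "\<dots> \<le> \<dots> + real ?a / real n * (tail \<epsilon> n * real t)"
      using tail_nonneg by simp
    also have "\<dots> = real (m - t) * c"
      using t k n by (simp add: c_def of_nat_diff mL) (simp add: field_simps)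
    finally have "- (real (m - t) * c) \<le> \<kappa> * real k + real ?a * (1 - \<kappa> * L)"
      by (simp add: algebra_simps)
    then have "exp (real (m - t) * (- c)) \<le> exp (\<kappa> * real k + real ?a * (1 - \<kappa> * L))" by simp
    then show "exp (- c) ^ (m - t) \<le> exp (\<kappa> * real k) * exp (1 - \<kappa> * L) ^ ?a"
      by (simp only: exp_of_nat_mult exp_add)
  qed (use base in auto)
  also have "\<dots> = real k * exp (\<kappa> * real k) * (\<kappa> + 1) ^ (k - 1) * (real ?a * L) ^ (k - 1) * exp (1 - \<kappa> * L) ^ ?a"
    by (simp add: power_mult_distrib mult_ac)
  finally show ?thesis .
qed

text \<open>Here p = 1 suffices: the resulting m^k is only polynomial in m. The constant 1/8 is 1/4,
  from n - |A| - k \<ge> n/4, times 1/2, from m - t \<ge> m/2.\<close>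

lemma prob_few_neighbours_large:
  assumes A: "A \<subseteq> {1..n}" "2 * card A \<le> n" and k: "1 \<le> k" "2 * k \<le> m" "4 * k \<le> n"
    and L: "L = real m / real n"
  shows "measure (communities D n m) {G. card (\<Union>i\<in>{1..m}. nb n (snd (G i)) A) < k} \<le>
    real k * real m ^ k * exp (- (\<alpha> / 8) * real (card A) * L)"
proof -
  interpret iid_family "communities D n m" "\<nu> n" m by (rule iid)
  let ?a = "card A"
  have n: "n \<ge> 2" using k by simp
  define c where "c = \<alpha> * real ?a / (4 * real n)"
  have c0: "0 \<le> c" using alpha_nonneg by (simp add: c_def)
  have \<rho>: "measure (\<nu> n) {g. nb n (snd g) A \<subseteq> S} \<le> exp (- c)" if "S \<subseteq> {1..n}" "card S < k" for S
  proof -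
    have "measure (\<nu> n) {g. nb n (snd g) A \<subseteq> S} \<le> 1 - \<alpha> * real ?a * (real n - real ?a - real k) / (real n)\<^sup>2"
      by (rule law_expand_large[OF A(1) that n])
    also have "\<dots> \<le> 1 - \<alpha> * real ?a * (real n / 4) / (real n)\<^sup>2"
      using A k alpha_nonneg by (intro diff_left_mono divide_right_mono mult_left_mono) auto
    also have "\<dots> = 1 - c" using n by (simp add: c_def power2_eq_square)
    also have "\<dots> \<le> exp (- c)" using exp_ge_add_one_self[of "- c"] by simp
    finally show ?thesis .
  qed
  have "measure (communities D n m) {G. card (\<Union>i\<in>{1..m}. nb n (snd (G i)) A) < k} \<le>
     (\<Sum>t<k. real (m choose t) * 1 ^ t * exp (- c) ^ (m - t))"
    using k by (intro prob_small_union[where U = "{1..n}"] \<rho> N.prob_le_1) (auto simp: nb_def)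
  also have "\<dots> \<le> (\<Sum>t<k. real m ^ k * exp (- (\<alpha> / 8) * real ?a * L))"
  proof (intro sum_mono mult_mono)
    fix t assume t: "t \<in> {..<k}"
    have "real (m choose t) \<le> real m ^ t" by (rule binomial_le_power)
    also have "\<dots> \<le> real m ^ k" using t k by (intro power_increasing) auto
    finally show "real (m choose t) * 1 ^ t \<le> real m ^ k" by simp
    have "real m / 2 \<le> real (m - t)" using t k by (simp add: of_nat_diff)
    from mult_right_mono[OF this c0] have "exp (real (m - t) * (- c)) \<le> exp (- (real m / 2 * c))" by simp
    also have "real m / 2 * c = (\<alpha> / 8) * real ?a * L" by (simp add: c_def L)
    finally show "exp (- c) ^ (m - t) \<le> exp (- (\<alpha> / 8) * real ?a * L)"
      by (simp only: exp_of_nat_mult) simp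
  qed auto
  finally show ?thesis by (simp add: mult_ac)
qed

text \<open>\<open>E\<close> is e times exp \<lambda>. A small set of size a contributes at most a
  constant times E^a e^a / a!, and E \<le> 1 lets one factor E be extracted, leaving a series
  bounded by exp e. The large sets together contribute at most k/n.\<close>

lemma prob_not_vertex_connected:
  fixes n m k :: nat and \<epsilon> L E :: real
  assumes L: "L = real m / real n" "1 \<le> L" "L * tail \<epsilon> n \<le> 1"
    and k: "1 \<le> k" "2 * k \<le> m" "4 * k \<le> n"
    and E: "E = real n * L ^ (k - 1) * exp (1 - \<kappa> * L)" "E \<le> 1"
    and \<epsilon>: "0 < \<epsilon>" "\<epsilon> \<le> 1" "2 \<le> \<epsilon> * ln (real n)"
    and big: "2 * real k \<le> real n powr (1 - \<epsilon>)" "2 * (real k + 1) \<le> \<epsilon> * real n powr (1 - \<epsilon>)"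
    and \<beta>: "4 * \<epsilon> * ln (real n) \<le> \<alpha> / 8 * L" and m: "real m \<le> (real n)\<^sup>2"
  shows "measure (communities D n m) {G. \<not> vertex_k_connected k (superposition n m G)} \<le>
    real k * exp (\<kappa> * real k) * (\<kappa> + 1) ^ (k - 1) * (fact (k - 1) * exp (exp 1)) * E + real k / real n"
proof -
  interpret iid_family "communities D n m" "\<nu> n" m by (rule iid)
  let ?P = "measure (communities D n m)"
  let ?F = "\<lambda>A. {G. card (\<Union>i\<in>{1..m}. nb n (snd (G i)) A) < k}"
  define K where "K = real k * exp (\<kappa> * real k) * (\<kappa> + 1) ^ (k - 1)"
  have K0: "0 \<le> K" using kappa_nonneg by (simp add: K_def)
  have n: "n \<ge> 1" using k by simp
  have E0: "0 \<le> E" using L by (simp add: E)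
  \<comment> \<open>The summand k is there because the expansion bound counts meetings with A
    together with a set of fewer than k further vertices.\<close>
  define small where "small a \<longleftrightarrow> 1 \<le> a \<and> real (a + k) \<le> real n powr (1 - \<epsilon>)" for a :: nat
  define large where "large a \<longleftrightarrow> 1 \<le> a \<and> 2 * a \<le> n \<and> \<not> small a" for a :: nat
  let ?\<S> = "{A. A \<subseteq> {1..n} \<and> small (card A)}"
  let ?\<L> = "{A. A \<subseteq> {1..n} \<and> large (card A)}"
  have fS: "finite ?\<S>" and fL: "finite ?\<L>"
    by (rule finite_subset[of _ "Pow {1..n}"]; auto)+
  have "{G. \<not> vertex_k_connected k (superposition n m G)} \<subseteq> (\<Union>A\<in>?\<S>. ?F A) \<union> (\<Union>A\<in>?\<L>. ?F A)"
  proof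
    fix G assume "G \<in> {G. \<not> vertex_k_connected k (superposition n m G)}"
    then have "\<not> vertex_k_connected k ({1..n}, \<Union>i\<in>{1..m}. snd (G i))" by (simp add: superposition_def)
    then obtain A where A: "A \<subseteq> {1..n}" "A \<noteq> {}" "2 * card A \<le> n"
        "card (nb n (\<Union>i\<in>{1..m}. snd (G i)) A) < k"
      by (rule not_vertex_k_connectedE)
    have "1 \<le> card A" using A finite_subset[OF A(1)] by (simp add: Suc_le_eq card_gt_0_iff)
    then have "A \<in> ?\<S> \<or> A \<in> ?\<L>" using A by (auto simp: large_def)
    moreover have "G \<in> ?F A" using A(4) by (simp add: nb_UN)
    ultimately show "G \<in> (\<Union>A\<in>?\<S>. ?F A) \<union> (\<Union>A\<in>?\<L>. ?F A)" by blast
  qed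
  then have "?P {G. \<not> vertex_k_connected k (superposition n m G)} \<le> ?P ((\<Union>A\<in>?\<S>. ?F A) \<union> (\<Union>A\<in>?\<L>. ?F A))"
    by (intro P.finite_measure_mono) (auto simp: sets_P)
  also have "\<dots> \<le> ?P (\<Union>A\<in>?\<S>. ?F A) + ?P (\<Union>A\<in>?\<L>. ?F A)"
    by (intro measure_Un_le) (auto simp: sets_P)
  also have "\<dots> \<le> K * (fact (k - 1) * exp (exp 1)) * E + real k / real n"
  proof (rule add_mono)
    have "?P (\<Union>A\<in>?\<S>. ?F A) \<le> (\<Sum>A\<in>?\<S>. ?P (?F A))"
      using fS by (intro measure_UNION_le) (auto simp: sets_P)
    also have "\<dots> \<le> (\<Sum>A\<in>?\<S>. K * (real (card A) * L) ^ (k - 1) * exp (1 - \<kappa> * L) ^ card A)"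
      unfolding K_def using k L \<epsilon>
      by (intro sum_mono prob_few_neighbours_small[where \<epsilon> = \<epsilon>]) (auto simp: small_def)
    also have "\<dots> = (\<Sum>a\<in>{a. a \<le> n \<and> small a}. real (n choose a) * (K * (real a * L) ^ (k - 1) * exp (1 - \<kappa> * L) ^ a))"
      by (rule sum_over_subsets)
    also have "\<dots> \<le> (\<Sum>a\<in>{a. a \<le> n \<and> small a}. K * fact (k - 1) * E * (exp 1 ^ a / fact a))"
    proof (rule sum_mono)
      fix a assume "a \<in> {a. a \<le> n \<and> small a}"
      then have a: "1 \<le> a" by (simp add: small_def)
      \<comment> \<open>Only one power of L^(k-1) is present; raising it to the power a, possible as
        L \<ge> 1, completes E^a.\<close>
      have "L ^ (k - 1) \<le> (L ^ (k - 1)) ^ a"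
        using a L by (intro self_le_power one_le_power) auto
      moreover have "real a ^ (k - 1) \<le> fact (k - 1) * exp 1 ^ a"
        using power_le_fact_exp[of "real a" "k - 1"] by (simp add: exp_of_nat_mult[symmetric])
      ultimately have "(real a * L) ^ (k - 1) \<le> (fact (k - 1) * exp 1 ^ a) * (L ^ (k - 1)) ^ a"
        unfolding power_mult_distrib using L by (intro mult_mono) auto
      then have "real (n choose a) * (K * (real a * L) ^ (k - 1) * exp (1 - \<kappa> * L) ^ a) \<le>
         (real n ^ a / fact a) * (K * ((fact (k - 1) * exp 1 ^ a) * (L ^ (k - 1)) ^ a) * exp (1 - \<kappa> * L) ^ a)"
        using K0 L by (intro mult_mono[OF binomial_le_power_over_fact] mult_right_mono mult_left_mono) auto
      also have "\<dots> = K * fact (k - 1) * E ^ a * (exp 1 ^ a / fact a)"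
        by (simp add: E power_mult_distrib)
      also have "\<dots> \<le> K * fact (k - 1) * E * (exp 1 ^ a / fact a)"
        using K0 E0 E(2) a power_decreasing[of 1 a E] by (intro mult_right_mono mult_left_mono) auto
      finally show "real (n choose a) * (K * (real a * L) ^ (k - 1) * exp (1 - \<kappa> * L) ^ a) \<le>
         K * fact (k - 1) * E * (exp 1 ^ a / fact a)" .
    qed
    also have "\<dots> = K * fact (k - 1) * E * (\<Sum>a\<in>{a. a \<le> n \<and> small a}. exp 1 ^ a / fact a)"
      by (simp add: sum_distrib_left)
    also have "\<dots> \<le> K * fact (k - 1) * E * exp (exp 1)"
      using K0 E0 by (intro mult_left_mono sum_power_over_fact_le_exp) auto
    finally show "?P (\<Union>A\<in>?\<S>. ?F A) \<le> K * (fact (k - 1) * exp (exp 1)) * E" by (simp add: mult_ac)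
    have "?P (\<Union>A\<in>?\<L>. ?F A) \<le> (\<Sum>A\<in>?\<L>. ?P (?F A))"
      using fL by (intro measure_UNION_le) (auto simp: sets_P)
    also have "\<dots> \<le> (\<Sum>A\<in>?\<L>. real k * real m ^ k * exp (- (\<alpha> / 8) * real (card A) * L))"
      using k L by (intro sum_mono prob_few_neighbours_large) (auto simp: large_def)
    also have "\<dots> = (\<Sum>a\<in>{a. a \<le> n \<and> large a}. real (n choose a) * (real k * real m ^ k * exp (- (\<alpha> / 8) * real a * L)))"
      by (rule sum_over_subsets)
    also have "\<dots> \<le> (\<Sum>a\<in>{a. a \<le> n \<and> large a}. real k / (real n)\<^sup>2)"
    proof (rule sum_mono)
      fix a assume "a \<in> {a. a \<le> n \<and> large a}"
      then have a: "1 \<le> a" "real n powr (1 - \<epsilon>) < real a + real k" by (auto simp: large_def small_def)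
      \<comment> \<open>A set that is not small has a + k > n^(1-\<epsilon>), and k is at most half
        of the right-hand side.\<close>
      then have a2: "real n powr (1 - \<epsilon>) \<le> 2 * real a" using big by simp
      have "2 * (real k + 1) \<le> \<epsilon> * (2 * real a)"
        using big(2) mult_left_mono[OF a2, of \<epsilon>] \<epsilon> by linarith
      then show "real (n choose a) * (real k * real m ^ k * exp (- (\<alpha> / 8) * real a * L)) \<le> real k / (real n)\<^sup>2"
        using a a2 n \<epsilon> \<beta> m by (intro large_set_term[where \<epsilon> = \<epsilon>]) auto
    qed
    also have "\<dots> = real (card {a. a \<le> n \<and> large a}) * (real k / (real n)\<^sup>2)" by simp
    also have "\<dots> \<le> real n * (real k / (real n)\<^sup>2)"
    proof (intro mult_right_mono of_nat_mono)
      have "card {a. a \<le> n \<and> large a} \<le> card {1..n}"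
        by (intro card_mono) (auto simp: large_def)
      then show "card {a. a \<le> n \<and> large a} \<le> n" by simp
    qed auto
    also have "\<dots> = real k / real n" using n by (simp add: power2_eq_square)
    finally show "?P (\<Union>A\<in>?\<L>. ?F A) \<le> real k / real n" .
  qed
  finally show ?thesis by (simp add: K_def)
qed

text \<open>\<open>a\<close> is the probability that a fixed vertex has degree one in exactly r
  communities and degree zero in the others; such a vertex has degree at most r. \<open>w\<close> is
  the probability that two vertices are both isolated in one community, if they were independent;
  the exponential bounds the effect of the dependence over all m communities, and 1/w^r comes from
  comparing the exponents m - 2r and m - r.\<close>

lemma prob_edge_connected_le:
  fixes n m r :: nat and y L :: real
  defines "a \<equiv> real (m choose r) * p1 n ^ r * (1 - p0 n) ^ (m - r)"
  defines "w \<equiv> (1 - p0 n)\<^sup>2"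
  assumes n: "n \<ge> 2" and r: "2 * r \<le> m" and m: "0 < m" and p: "0 < p1 n" "p0 n < 1"
    and y: "tail 1 n / real n \<le> y * (real m * (p1 n)\<^sup>2)" "y \<le> 1" and L: "L = real m / real n"
  shows "measure (communities D n m) {G. edge_k_connected (Suc r) (superposition n m G)} \<le>
    1 / (real n * a) + exp (L * tail 1 n / w) / w ^ r * (1 + real r * (2 * real r) ^ r * y) - 1"
proof -
  interpret iid_family "communities D n m" "\<nu> n" m by (rule iid)
  define B1 where "B1 v = {g :: nat graph. card (incident (snd g) v) = 1}" for v
  define B0 where "B0 v = {g :: nat graph. incident (snd g) v = {}}" for v
  let ?A = "\<lambda>v. pick r (B1 v) (B0 v)"
  let ?K = "1 + real r * (2 * real r) ^ r * y"
  have sp: "space (communities D n m) = UNIV" "space (\<nu> n) = UNIV"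
    using sets_eq_imp_space_eq[of _ "count_space UNIV"] sets_P sets_\<nu> by auto
  have w: "0 < w" using p by (simp add: w_def)
  have a0: "0 < a" using p r by (simp add: a_def)
  have t0: "0 \<le> tail 1 n" by (rule tail_nonneg)
  have y0: "0 \<le> y"
  proof -
    have "0 \<le> tail 1 n / real n" using t0 by simp
    with y(1) have "0 \<le> y * (real m * (p1 n)\<^sup>2)" by (rule order_trans[rotated])
    moreover have "0 < real m * (p1 n)\<^sup>2" using m p by simp
    ultimately show ?thesis by (simp only: zero_le_mult_iff) linarith
  qed
  have B1: "measure (\<nu> n) (B1 v) = p1 n" if "v \<in> {1..n}" for v
    unfolding B1_def by (rule law_degree_one[OF that])
  have B0c: "- B0 v = {g. incident (snd g) v \<noteq> {}}" for v by (auto simp: B0_def)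
  have B0: "measure (\<nu> n) (B0 v) = 1 - p0 n" if "v \<in> {1..n}" for v
    using N.prob_compl[of "- B0 v"] law_nonisolated[OF that] sets_\<nu> sp by (simp add: B0c[symmetric] Compl_eq_Diff_UNIV[symmetric])
  have disj: "B1 v \<inter> B0 v = {}" for v by (auto simp: B1_def B0_def)
  \<comment> \<open>The cap at 1 provides the condition z \<le> 1 under which exponents are lowered.
    The sum is inclusion-exclusion: 1 - 2 p0 + tail/n is at most (1 - p0)^2 + tail/n.\<close>
  define z where "z = min 1 (w + tail 1 n / real n)"
  have B00: "measure (\<nu> n) (B0 u \<inter> B0 v) \<le> z" if uv: "u \<in> {1..n}" "v \<in> {1..n}" "u \<noteq> v" for u v
  proof -
    have "measure (\<nu> n) (B0 u \<inter> B0 v) = 1 - measure (\<nu> n) (- B0 u \<union> - B0 v)"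
      using N.prob_compl[of "- B0 u \<union> - B0 v"] sets_\<nu> sp by (simp add: Compl_eq_Diff_UNIV[symmetric])
    also have "measure (\<nu> n) (- B0 u \<union> - B0 v) =
        measure (\<nu> n) (- B0 u) + measure (\<nu> n) (- B0 v) - measure (\<nu> n) (- B0 u \<inter> - B0 v)"
      by (intro measure_Un3) (auto simp: fmeasurable_eq_sets sets_\<nu> N.fmeasurable_eq_sets)
    also have "measure (\<nu> n) (- B0 u) = p0 n" using law_nonisolated uv by (simp add: B0c)
    also have "measure (\<nu> n) (- B0 v) = p0 n" using law_nonisolated uv by (simp add: B0c)
    also have "1 - (p0 n + p0 n - measure (\<nu> n) (- B0 u \<inter> - B0 v)) \<le> 1 - (p0 n + p0 n - tail 1 n / real n)"
      using law_both_nonisolated[OF uv] by (simp add: B0c Int_def)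
    also have "\<dots> \<le> w + tail 1 n / real n" by (simp add: w_def power2_eq_square algebra_simps)
    finally show ?thesis by (simp add: z_def)
  qed
  define b where "b = z ^ (m - 2 * r) * (real (m choose r))\<^sup>2 * p1 n ^ (2 * r) * ?K"
  have z0: "0 \<le> z" using w t0 by (simp add: z_def)
  have b0: "0 \<le> b" using z0 y0 p by (simp add: b_def)
  have "{G. edge_k_connected (Suc r) (superposition n m G)} \<subseteq> space (communities D n m) - (\<Union>v\<in>{1..n}. ?A v)"
  proof (rule subsetI, rule ccontr)
    fix G assume ec: "G \<in> {G. edge_k_connected (Suc r) (superposition n m G)}"
    assume "G \<notin> space (communities D n m) - (\<Union>v\<in>{1..n}. ?A v)"
    then obtain v T where v: "v \<in> {1..n}" and T: "T \<subseteq> {1..m}" "card T = r"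
        "\<And>i. i \<in> {1..m} \<Longrightarrow> G i \<in> (if i \<in> T then B1 v else B0 v)"
      by (auto simp: sp pick_def)
    let ?U = "\<Union>i\<in>{1..m}. snd (G i)"
    have fT: "finite T" using T finite_subset by blast
    have c1: "card (incident (snd (G i)) v) = 1" if "i \<in> T" for i
      using T(1) T(3)[of i] that by (auto simp: B1_def)
    have c0: "incident (snd (G i)) v = {}" if "i \<in> {1..m} - T" for i
      using T(3)[of i] that by (auto simp: B0_def)
    have U: "incident ?U v = (\<Union>i\<in>T. incident (snd (G i)) v)"
      unfolding incident_UN using c0 T(1) by blast
    have "finite (incident ?U v)"
      unfolding U using fT c1 by (auto intro!: card_ge_0_finite)
    \<comment> \<open>Different communities may contribute the same edge, so only an upper bound on
      the degree is available; it suffices.\<close>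
    moreover have "card (incident ?U v) \<le> (\<Sum>i\<in>T. card (incident (snd (G i)) v))"
      unfolding U by (rule card_UN_le[OF fT])
    then have "card (incident ?U v) < Suc r" using c1 T by simp
    moreover obtain u where "u \<in> {1..n}" "u \<noteq> v" using n v by (cases "v = 1") (auto intro: that[of 1] that[of 2])
    ultimately have "\<not> edge_k_connected (Suc r) ({1..n}, ?U)"
      using v by (intro not_edge_k_connected[where v = v and u = u]) auto
    then show False using ec by (simp add: superposition_def)
  qed
  then have "measure (communities D n m) {G. edge_k_connected (Suc r) (superposition n m G)} \<le>
      measure (communities D n m) (space (communities D n m) - (\<Union>v\<in>{1..n}. ?A v))"
    by (intro P.finite_measure_mono) (auto simp: sets_P)
  also have "\<dots> \<le> 1 / (real (card {1..n}) * a) + b / a\<^sup>2 - 1"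
  proof (rule P.second_moment_bound)
    show "measure (communities D n m) (?A v) = a" if "v \<in> {1..n}" for v
      unfolding prob_pick[OF disj] B1[OF that] B0[OF that] by (simp add: a_def)
    show "measure (communities D n m) (?A u \<inter> ?A v) \<le> b" if uv: "u \<in> {1..n}" "v \<in> {1..n}" "u \<noteq> v" for u v
      unfolding b_def
    proof (rule prob_pick_both[where \<rho> = "tail 1 n / real n"])
      have "measure (\<nu> n) (B1 u \<inter> B1 v) \<le> measure (\<nu> n) {g. incident (snd g) u \<noteq> {} \<and> incident (snd g) v \<noteq> {}}"
        by (intro N.finite_measure_mono) (auto simp: B1_def sets_\<nu>)
      also have "\<dots> \<le> tail 1 n / real n" by (rule law_both_nonisolated[OF uv])
      finally show "measure (\<nu> n) (B1 u \<inter> B1 v) \<le> tail 1 n / real n" .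
      show "measure (\<nu> n) (B1 u \<inter> B0 v) \<le> p1 n"
        unfolding B1[OF uv(1), symmetric] by (intro N.finite_measure_mono) (auto simp: sets_\<nu>)
      show "measure (\<nu> n) (B0 u \<inter> B1 v) \<le> p1 n"
        unfolding B1[OF uv(2), symmetric] by (intro N.finite_measure_mono) (auto simp: sets_\<nu>)
      show "measure (\<nu> n) (B0 u \<inter> B0 v) \<le> z" by (rule B00[OF uv])
    qed (use y p m r in \<open>auto simp: z_def\<close>)
  qed (use n a0 b0 in \<open>auto simp: sets_P\<close>)
  also have "b / a\<^sup>2 \<le> exp (L * tail 1 n / w) / w ^ r * ?K"
  proof -
    have "a\<^sup>2 = (real (m choose r))\<^sup>2 * p1 n ^ (2 * r) * w ^ (m - r)"
      by (simp add: a_def w_def power_mult_distrib power_mult[symmetric] mult.commute[of 2])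
    then have "b / a\<^sup>2 = z ^ (m - 2 * r) / w ^ (m - r) * ?K"
      using p r by (simp add: b_def)
    also have "w ^ (m - r) = w ^ (m - 2 * r) * w ^ r"
      using r by (simp flip: power_add)
    also have "z ^ (m - 2 * r) / (w ^ (m - 2 * r) * w ^ r) * ?K = (z / w) ^ (m - 2 * r) / w ^ r * ?K"
      by (simp add: power_divide)
    also have "\<dots> \<le> exp (L * tail 1 n / w) / w ^ r * ?K"
    proof (intro mult_right_mono divide_right_mono)
      let ?e = "tail 1 n / real n / w"
      have e0: "0 \<le> ?e" using t0 w by simp
      have "z / w \<le> (w + tail 1 n / real n) / w" using w by (intro divide_right_mono) (auto simp: z_def)
      also have "\<dots> = 1 + ?e" using w by (simp add: add_divide_distrib)
      also have "\<dots> \<le> exp ?e" by (rule exp_ge_add_one_self)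
      finally have "(z / w) ^ (m - 2 * r) \<le> exp ?e ^ (m - 2 * r)"
        using z0 w by (intro power_mono) auto
      also have "\<dots> \<le> exp ?e ^ m" using e0 by (intro power_increasing) auto
      also have "\<dots> = exp (L * tail 1 n / w)" by (simp add: exp_of_nat_mult[symmetric] L)
      finally show "(z / w) ^ (m - 2 * r) \<le> exp (L * tail 1 n / w)" .
    qed (use w y0 in auto)
    finally show ?thesis .
  qed
  finally show ?thesis by simp
qed

end

section \<open>Asymptotics\<close>

locale superposition_model = community_model M X Q for M :: "'a measure" and X Q +
  fixes m :: "nat \<Rightarrow> nat" and k :: nat
  assumes k: "k \<ge> 2"
    and m_theta: "(\<lambda>n. real (m n)) \<in> \<Theta>(\<lambda>n. real n * ln (real n))"
begin

abbreviation "L n \<equiv> real (m n) / real n"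

abbreviation "lam n \<equiv> lambda M X Q n (m n) k"

lemma L_bounds:
  obtains c1 c2 where "c1 > 0" "c2 > 0"
    "\<forall>\<^sub>F n in sequentially. c1 * ln (real n) \<le> L n" "\<forall>\<^sub>F n in sequentially. L n \<le> c2 * ln (real n)"
proof -
  from m_theta have up: "(\<lambda>n. real (m n)) \<in> O(\<lambda>n. real n * ln (real n))"
    and lo: "(\<lambda>n. real (m n)) \<in> \<Omega>(\<lambda>n. real n * ln (real n))" by (auto simp: bigtheta_def)
  from up obtain c2 where c2: "c2 > 0"
      "\<forall>\<^sub>F n in sequentially. norm (real (m n)) \<le> c2 * norm (real n * ln (real n))"
    by (rule landau_o.bigE)
  from lo obtain c1 where c1: "c1 > 0"
      "\<forall>\<^sub>F n in sequentially. norm (real (m n)) \<ge> c1 * norm (real n * ln (real n))"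
    by (rule landau_omega.bigE)
  show thesis
  proof (rule that[OF c1(1) c2(1)])
    show "\<forall>\<^sub>F n in sequentially. c1 * ln (real n) \<le> L n"
      using c1(2) eventually_ge_at_top[of 1] by eventually_elim (simp add: field_simps)
    show "\<forall>\<^sub>F n in sequentially. L n \<le> c2 * ln (real n)"
      using c2(2) eventually_ge_at_top[of 1] by eventually_elim (simp add: field_simps)
  qed
qed

lemma L_at_top: "filterlim L at_top sequentially"
proof -
  obtain c1 c2 where c: "c1 > 0" "\<forall>\<^sub>F n in sequentially. c1 * ln (real n) \<le> L n" by (rule L_bounds)
  have "filterlim (\<lambda>n. c1 * ln (real n)) at_top sequentially" using c(1) by real_asymp
  then show ?thesis using c(2) by (rule filterlim_at_top_mono)
qed

lemma L_over_n_limit: "(\<lambda>n. L n / real n) \<longlonglongrightarrow> 0"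
proof -
  obtain c1 c2 where c: "\<forall>\<^sub>F n in sequentially. L n \<le> c2 * ln (real n)" by (rule L_bounds)
  have up: "(\<lambda>n. c2 * ln (real n) / real n) \<longlonglongrightarrow> 0" by real_asymp
  show ?thesis
  proof (rule tendsto_sandwich[OF _ _ tendsto_const up])
    show "\<forall>\<^sub>F n in sequentially. L n / real n \<le> c2 * ln (real n) / real n"
      using c by eventually_elim (rule divide_right_mono, auto)
  qed simp
qed

lemma L_tail_limit:
  assumes "\<epsilon> > 0"
  shows "(\<lambda>n. L n * tail \<epsilon> n) \<longlonglongrightarrow> 0"
proof -
  obtain c1 c2 where c: "\<forall>\<^sub>F n in sequentially. L n \<le> c2 * ln (real n)" by (rule L_bounds)
  have up: "(\<lambda>n. c2 * (ln (real n) * tail \<epsilon> n)) \<longlonglongrightarrow> 0"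
    using tendsto_mult_left[OF tail_log_limit[OF assms], of c2] by simp
  show ?thesis
  proof (rule tendsto_sandwich[OF _ _ tendsto_const up])
    show "\<forall>\<^sub>F n in sequentially. L n * tail \<epsilon> n \<le> c2 * (ln (real n) * tail \<epsilon> n)"
      using c
    proof eventually_elim
      case (elim n)
      from mult_right_mono[OF elim tail_nonneg[of \<epsilon> n]] show ?case by simp
    qed
  qed (simp add: tail_nonneg)
qed

text \<open>Links \<lambda> to both estimates: e times this is the quantity \<open>E\<close> of the
  vertex bound, and a constant times it is a lower bound for the mean number of low-degree
  vertices.\<close>

lemma exp_lam:
  assumes "n \<ge> 1" "L n > 0"
  shows "exp (lam n) = real n * L n ^ (k - 1) * exp (- \<kappa> * L n)"
proof -
  have "exp (real (k - 1) * ln (L n)) = L n ^ (k - 1)"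
    using assms by (subst exp_of_nat_mult) simp
  moreover have "lam n = ln (real n) + real (k - 1) * ln (L n) + (- \<kappa> * L n)"
    by (simp add: lambda_def mult.commute)
  ultimately show ?thesis using assms(1) by (simp only: exp_add) simp
qed

section \<open>The two limit statements\<close>

lemma vertex_connected_limit:
  assumes \<alpha>: "\<alpha> > 0" and lam: "filterlim lam at_bot sequentially"
  shows "(\<lambda>n. measure (communities D n (m n)) {G. vertex_k_connected k (superposition n (m n) G)}) \<longlonglongrightarrow> 1"
proof -
  let ?N = "\<lambda>n. measure (communities D n (m n)) {G. \<not> vertex_k_connected k (superposition n (m n) G)}"
  obtain c1 c2 where c: "c1 > 0" "c2 > 0" "\<forall>\<^sub>F n in sequentially. c1 * ln (real n) \<le> L n"
    "\<forall>\<^sub>F n in sequentially. L n \<le> c2 * ln (real n)" by (rule L_bounds)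
  \<comment> \<open>The second entry gives 4 \<epsilon> ln n \<le> (\<alpha>/8) c1 ln n \<le>
    (\<alpha>/8) L, the margin over the entropy of large sets; the first keeps n^(1-\<epsilon>)
    tending to infinity.\<close>
  define \<epsilon> where "\<epsilon> = min (1 / 2) (\<alpha> * c1 / 32)"
  have \<epsilon>: "0 < \<epsilon>" "\<epsilon> \<le> 1 / 2" "\<epsilon> \<le> \<alpha> * c1 / 32" using \<alpha> c by (auto simp: \<epsilon>_def)
  define K where "K = real k * exp (\<kappa> * real k) * (\<kappa> + 1) ^ (k - 1) * (fact (k - 1) * exp (exp 1))"
  have E_lim: "(\<lambda>n. exp 1 * exp (lam n)) \<longlonglongrightarrow> 0"
    using tendsto_mult_left[OF filterlim_compose[OF exp_at_bot lam], of "exp 1"] by simp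
  have pow: "filterlim (\<lambda>n::nat. real n powr (1 - \<epsilon>)) at_top sequentially"
    using \<epsilon> by real_asymp
  have \<epsilon>pow: "filterlim (\<lambda>n::nat. \<epsilon> * real n powr (1 - \<epsilon>)) at_top sequentially"
    using \<epsilon> by real_asymp
  have \<epsilon>ln: "filterlim (\<lambda>n::nat. \<epsilon> * ln (real n)) at_top sequentially"
    using \<epsilon> by real_asymp
  \<comment> \<open>Together with L \<le> c2 ln n this yields m \<le> n^2.\<close>
  have c2ln: "\<forall>\<^sub>F n in sequentially. c2 * ln (real n) \<le> real n" by real_asymp
  have bound: "\<forall>\<^sub>F n in sequentially. ?N n \<le> K * (exp 1 * exp (lam n)) + real k / real n"
    using c(3) c(4) c2ln order_tendstoD(2)[OF E_lim zero_less_one]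
      order_tendstoD(2)[OF L_tail_limit[OF \<epsilon>(1)] zero_less_one]
      filterlim_at_top[THEN iffD1, OF L_at_top, rule_format, of 1]
      filterlim_at_top[THEN iffD1, OF pow, rule_format, of "2 * real k"]
      filterlim_at_top[THEN iffD1, OF \<epsilon>pow, rule_format, of "2 * (real k + 1)"]
      filterlim_at_top[THEN iffD1, OF \<epsilon>ln, rule_format, of 2]
      eventually_ge_at_top[of "4 * k"]
  proof eventually_elim
    case (elim n)
    have n: "n \<ge> 1" using elim k by linarith
    have mn: "real n \<le> real (m n)" using elim(6) n by (simp add: field_simps)
    have "0 < L n" using elim(6) by linarith
    moreover have "exp (1 - \<kappa> * L n) = exp 1 * exp (- \<kappa> * L n)" by (simp flip: exp_add)
    ultimately have ex: "exp 1 * exp (lam n) = real n * L n ^ (k - 1) * exp (1 - \<kappa> * L n)"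
      using exp_lam[OF n] by (simp only: mult_ac)
    show ?case
      unfolding K_def
    proof (rule prob_not_vertex_connected[where \<epsilon> = \<epsilon> and L = "L n", OF refl])
      show "4 * \<epsilon> * ln (real n) \<le> \<alpha> / 8 * L n"
      proof -
        have "4 * \<epsilon> * ln (real n) \<le> 4 * (\<alpha> * c1 / 32) * ln (real n)"
          using \<epsilon>(3) n by (intro mult_right_mono mult_left_mono) auto
        also have "\<dots> = \<alpha> / 8 * (c1 * ln (real n))" by simp
        also have "\<dots> \<le> \<alpha> / 8 * L n" using elim(1) \<alpha> by (intro mult_left_mono) auto
        finally show ?thesis .
      qed
      have "L n \<le> real n" using elim by linarith
      then show "real (m n) \<le> (real n)\<^sup>2" using n by (simp add: power2_eq_square divide_le_eq)
      show "2 * k \<le> m n" using mn elim(10) by linarith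
    qed (use elim ex \<epsilon> k in auto)
  qed
  have "(\<lambda>n. K * (exp 1 * exp (lam n)) + real k / real n) \<longlonglongrightarrow> K * 0 + 0"
    by (intro tendsto_add tendsto_mult_left E_lim) real_asymp
  then have up: "(\<lambda>n. K * (exp 1 * exp (lam n)) + real k / real n) \<longlonglongrightarrow> 0" by simp
  have "?N \<longlonglongrightarrow> 0"
    by (rule tendsto_sandwich[OF _ bound tendsto_const up]) simp
  then have "(\<lambda>n. 1 - ?N n) \<longlonglongrightarrow> 1 - 0" by (intro tendsto_intros)
  moreover have "1 - ?N n = measure (communities D n (m n)) {G. vertex_k_connected k (superposition n (m n) G)}" for n
  proof -
    interpret iid_family "communities D n (m n)" "\<nu> n" "m n" by (rule iid)
    have "space (communities D n (m n)) = UNIV"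
      using sets_eq_imp_space_eq[of _ "count_space UNIV"] sets_P by auto
    then show ?thesis
      using P.prob_compl[of "{G. vertex_k_connected k (superposition n (m n) G)}"] sets_P
      by (simp add: Compl_eq_Diff_UNIV[symmetric] Collect_neg_eq)
  qed
  ultimately show ?thesis by simp
qed

lemma edge_connected_limit:
  assumes \<tau>: "\<tau> > 0" and lam: "filterlim lam at_top sequentially"
  shows "(\<lambda>n. measure (communities D n (m n)) {G. edge_k_connected k (superposition n (m n) G)}) \<longlonglongrightarrow> 0"
proof -
  define r where "r = k - 1"
  have r: "r \<ge> 1" "k = Suc r" using k by (auto simp: r_def)
  define a where "a n = real (m n choose r) * p1 n ^ r * (1 - p0 n) ^ (m n - r)" for n
  define w where "w n = (1 - p0 n)\<^sup>2" for n
  \<comment> \<open>This solves y m p1^2 = tail/n with equality when p1 > 0, written as a product of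
    sequences with known limits: L tail and 1/L tend to 0, and n p1 tends to \<tau>.\<close>
  define y where "y n = L n * tail 1 n * inverse (L n) * inverse (L n) * inverse (real n * p1 n) ^ 2" for n
  \<comment> \<open>The power combines (m choose r) \<ge> (m/r)^r with n p1 > \<tau>/2. The factor
    exp(-1) pays for the second-order term of ln(1 - p0) \<ge> - p0 - 2 p0^2, because 2 m p0^2 \<le>
    1 eventually.\<close>
  define C where "C = (\<tau> / 2 / real r) ^ r * exp (- 1)"
  have C: "C > 0" using \<tau> r by (simp add: C_def)
  have p0_nonneg: "0 \<le> p0 n" for n
    unfolding p0_def using truncated_Xh(1) by (intro integral_nonneg_AE AE_I2) simp
  have p0_lim: "p0 \<longlonglongrightarrow> 0"
  proof (rule tendsto_sandwich[OF _ _ tendsto_const])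
    show "\<forall>\<^sub>F n in sequentially. p0 n \<le> \<kappa> / real n"
      using eventually_ge_at_top[of 1] by eventually_elim (rule p0_le)
    show "(\<lambda>n. \<kappa> / real n) \<longlonglongrightarrow> 0" by (rule lim_const_over_n)
  qed (simp add: p0_nonneg)
  have w_lim: "w \<longlonglongrightarrow> 1"
  proof -
    have "(\<lambda>n. (1 - p0 n)\<^sup>2) \<longlonglongrightarrow> (1 - 0)\<^sup>2" by (intro tendsto_intros p0_lim)
    then show ?thesis by (simp add: w_def[abs_def])
  qed
  have iL: "(\<lambda>n. inverse (L n)) \<longlonglongrightarrow> 0"
    by (rule tendsto_inverse_0_at_top[OF L_at_top])
  have y_lim: "y \<longlonglongrightarrow> 0"
  proof -
    have "y \<longlonglongrightarrow> 0 * 0 * 0 * inverse \<tau> ^ 2"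
      unfolding y_def using \<tau> by (intro tendsto_mult tendsto_power tendsto_inverse L_tail_limit iL p1_limit) auto
    then show ?thesis by simp
  qed
  have Lk: "(\<lambda>n. 2 * \<kappa>\<^sup>2 * (L n / real n)) \<longlonglongrightarrow> 0"
    using tendsto_mult_left[OF L_over_n_limit, of "2 * \<kappa>\<^sup>2"] by simp
  have p1_ev: "\<forall>\<^sub>F n in sequentially. \<tau> / 2 < real n * p1 n"
    using \<tau> by (intro order_tendstoD(1)[OF p1_limit]) simp
  have p0_ev: "\<forall>\<^sub>F n in sequentially. p0 n < 1 / 2"
    by (rule order_tendstoD(2)[OF p0_lim]) simp
  have L_ev: "\<forall>\<^sub>F n in sequentially. 1 \<le> L n"
    using L_at_top by (simp add: filterlim_at_top)
  have a_bound: "\<forall>\<^sub>F n in sequentially. C * exp (lam n) \<le> real n * a n"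
    using p1_ev p0_ev L_ev order_tendstoD(2)[OF Lk zero_less_one] eventually_ge_at_top[of "2 * k"]
  proof eventually_elim
    case (elim n)
    have n: "n \<ge> 1" using elim k by linarith
    have mn: "real n \<le> real (m n)" using elim(3) n by (simp add: field_simps)
    have rm: "r \<le> m n" using mn elim(5) by (simp add: r_def)
    have p1: "0 < p1 n" 
    proof -
      have "0 < real n * p1 n" using elim(1) \<tau> by linarith
      then show ?thesis using n by (simp add: zero_less_mult_iff)
    qed
    have "exp (- \<kappa> * L n - 1) \<le> exp (real (m n) * (- p0 n - 2 * (p0 n)\<^sup>2))"
    proof -
      have p: "real n * p0 n \<le> \<kappa>" using p0_le[OF n] n by (simp add: field_simps)
      have "real (m n) * p0 n = L n * (real n * p0 n)" using n by simp
      also have "\<dots> \<le> L n * \<kappa>" using p elim(3) by (intro mult_left_mono) auto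
      finally have 1: "real (m n) * p0 n \<le> \<kappa> * L n" by (simp add: mult.commute)
      have "real (m n) * (2 * (p0 n)\<^sup>2) = 2 * (L n / real n) * (real n * p0 n)\<^sup>2"
        using n by (simp add: power2_eq_square)
      also have "\<dots> \<le> 2 * (L n / real n) * \<kappa>\<^sup>2"
        using p p0_nonneg[of n] by (intro mult_left_mono power_mono) auto
      also have "\<dots> \<le> 1" using elim(4) by (simp add: mult_ac)
      finally have 2: "real (m n) * (2 * (p0 n)\<^sup>2) \<le> 1" .
      show ?thesis using 1 2 by (simp add: algebra_simps)
    qed
    also have "\<dots> = exp (- p0 n - 2 * (p0 n)\<^sup>2) ^ m n" by (simp only: exp_of_nat_mult)
    also have "\<dots> \<le> (1 - p0 n) ^ m n"
    proof (rule power_mono)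
      have "- p0 n - 2 * (p0 n)\<^sup>2 \<le> ln (1 - p0 n)"
        using elim(2) p0_nonneg by (intro ln_one_minus_pos_lower_bound) auto
      then have "exp (- p0 n - 2 * (p0 n)\<^sup>2) \<le> exp (ln (1 - p0 n))" by (simp only: exp_le_cancel_iff)
      then show "exp (- p0 n - 2 * (p0 n)\<^sup>2) \<le> 1 - p0 n" using elim(2) by simp
    qed simp
    also have "\<dots> \<le> (1 - p0 n) ^ (m n - r)"
      using elim(2) p0_nonneg[of n] by (intro power_decreasing) auto
    finally have e: "exp (- \<kappa> * L n - 1) \<le> (1 - p0 n) ^ (m n - r)" .
    have "(L n * (\<tau> / 2) / real r) ^ r \<le> (real (m n) / real r * p1 n) ^ r"
    proof (rule power_mono)
      have "L n * (\<tau> / 2) \<le> L n * (real n * p1 n)"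
        using elim by (intro mult_left_mono) auto
      then show "L n * (\<tau> / 2) / real r \<le> real (m n) / real r * p1 n"
        using divide_right_mono[of "L n * (\<tau> / 2)" "L n * (real n * p1 n)" "real r"] n by simp
    qed (use elim \<tau> in auto)
    also have "\<dots> = (real (m n) / real r) ^ r * p1 n ^ r" by (rule power_mult_distrib)
    also have "\<dots> \<le> real (m n choose r) * p1 n ^ r"
      using p1 rm by (intro mult_right_mono binomial_ge_n_over_k_pow_k) auto
    finally have c: "(L n * (\<tau> / 2) / real r) ^ r \<le> real (m n choose r) * p1 n ^ r" .
    have "0 < L n" using elim(3) by linarith
    then have "exp (lam n) = real n * L n ^ r * exp (- \<kappa> * L n)"
      unfolding r_def by (rule exp_lam[OF n])
    moreover have "(L n * (\<tau> / 2) / real r) ^ r = L n ^ r * (\<tau> / 2 / real r) ^ r"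
      by (simp only: power_mult_distrib[symmetric] times_divide_eq_right)
    moreover have "exp (- \<kappa> * L n - 1) = exp (- 1) * exp (- \<kappa> * L n)"
      by (simp flip: exp_add)
    ultimately have "C * exp (lam n) = real n * ((L n * (\<tau> / 2) / real r) ^ r * exp (- \<kappa> * L n - 1))"
      by (simp only: C_def mult_ac)
    also have "\<dots> \<le> real n * (real (m n choose r) * p1 n ^ r * (1 - p0 n) ^ (m n - r))"
      using c e elim \<tau> p1 by (intro mult_left_mono mult_mono) auto
    finally show ?case by (simp add: a_def)
  qed
  let ?b = "\<lambda>n. 1 / (C * exp (lam n)) + exp (L n * tail 1 n / w n) / w n ^ r * (1 + real r * (2 * real r) ^ r * y n) - 1"
  have "\<forall>\<^sub>F n in sequentially. y n < 1" using order_tendstoD(2)[OF y_lim zero_less_one] .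
  from this a_bound p1_ev p0_ev L_ev eventually_ge_at_top[of "2 * k"]
  have bound: "\<forall>\<^sub>F n in sequentially.
      measure (communities D n (m n)) {G. edge_k_connected k (superposition n (m n) G)} \<le> ?b n"
  proof eventually_elim
    case (elim n)
    have n: "n \<ge> 2" using elim k by linarith
    have mn: "real n \<le> real (m n)" using elim(5) n by (simp add: field_simps)
    have np1: "0 < real n * p1 n" using elim(3) \<tau> by linarith
    then have p1: "0 < p1 n" using n by (simp add: zero_less_mult_iff)
    have "measure (communities D n (m n)) {G. edge_k_connected (Suc r) (superposition n (m n) G)} \<le>
       1 / (real n * a n) + exp (L n * tail 1 n / w n) / w n ^ r * (1 + real r * (2 * real r) ^ r * y n) - 1"
      unfolding a_def w_def
    proof (rule prob_edge_connected_le)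
      have "y n * (real (m n) * (p1 n)\<^sup>2) = tail 1 n / real n"
        using p1 n mn by (simp add: y_def power2_eq_square field_simps)
      then show "tail 1 n / real n \<le> y n * (real (m n) * (p1 n)\<^sup>2)" by simp
      show "2 * r \<le> m n" using mn elim(6) by (simp add: r_def)
    qed (use elim n mn p1 in auto)
    also have "1 / (real n * a n) \<le> 1 / (C * exp (lam n))"
    proof (rule divide_left_mono)
      have pos: "0 < C * exp (lam n)" using C by simp
      then have "0 < real n * a n" using elim(2) by linarith
      then show "0 < real n * a n * (C * exp (lam n))" using pos by (rule mult_pos_pos)
    qed (use elim(2) in auto)
    finally show ?case using r by simp
  qed
  \<comment> \<open>The inverse of the mean vanishes as \<lambda> tends to infinity, while the ratio
    of second moment to squared mean tends to 1 and cancels against the -1.\<close>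
  have "?b \<longlonglongrightarrow> 0 + exp (0 / 1) / 1 ^ r * (1 + real r * (2 * real r) ^ r * 0) - 1"
  proof (intro tendsto_intros w_lim y_lim L_tail_limit)
    have "filterlim (\<lambda>n. C * exp (lam n)) at_top sequentially"
      by (rule filterlim_tendsto_pos_mult_at_top[OF tendsto_const C filterlim_compose[OF exp_at_top lam]])
    from tendsto_inverse_0_at_top[OF this]
    show "(\<lambda>n. 1 / (C * exp (lam n))) \<longlonglongrightarrow> 0" by (simp only: inverse_eq_divide)
  qed auto
  then have up: "?b \<longlonglongrightarrow> 0" by simp
  show ?thesis
    by (rule tendsto_sandwich[OF _ bound tendsto_const up]) simp
qed

end

theorem theorem1:
  fixes M :: "'a measure" and X :: "'a \<Rightarrow> nat" and Q :: "'a \<Rightarrow> real"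
    and k :: nat and m :: "nat \<Rightarrow> nat"
  assumes "prob_space M"
    and "X \<in> measurable M (count_space UNIV)"
    and "Q \<in> borel_measurable M"
    and "\<And>\<omega>. \<omega> \<in> space M \<Longrightarrow> 0 \<le> Q \<omega> \<and> Q \<omega> \<le> 1"
    and "k \<ge> 2"
    and "\<And>n. m n > 0"
    and "(\<lambda>n. real (m n)) \<in> \<Theta>(\<lambda>n. real n * ln (real n))"
    and "alpha M X Q > 0"
    and "tau M X Q > 0"
    and "integrable M (\<lambda>\<omega>. real (X \<omega>) * h (X \<omega>) (Q \<omega>) * ln (1 + real (X \<omega>)))"
    and "integrable M (\<lambda>\<omega>. real (X \<omega>) * min 1 (real (X \<omega>) * Q \<omega>) * ln (1 + real (X \<omega>)))"
    and "\<And>j. 2 \<le> j \<Longrightarrow> j \<le> k \<Longrightarrow> integrable M (\<lambda>\<omega>. real (X \<omega>) ^ j * Q \<omega> ^ (j - 1))"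
  shows "(filterlim (\<lambda>n. lambda M X Q n (m n) k) at_bot sequentially \<longrightarrow>
           (\<lambda>n. measure (communities (XQ_law M X Q) n (m n))
                  {G. vertex_k_connected k (superposition n (m n) G)}) \<longlonglongrightarrow> 1)
       \<and> (filterlim (\<lambda>n. lambda M X Q n (m n) k) at_top sequentially \<longrightarrow>
           (\<lambda>n. measure (communities (XQ_law M X Q) n (m n))
                  {G. edge_k_connected k (superposition n (m n) G)}) \<longlonglongrightarrow> 0)"
proof -
  interpret prob_space M by fact
  interpret superposition_model M X Q m k
    by standard (use assms in auto)
  show ?thesis
    using vertex_connected_limit edge_connected_limit assms(8,9) by blast
qed

end
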